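(* Let $G_\bullet$ be a vertex-stable $\mathrm{FI}$-graph of stable degree $\le d$. Then for any graph $T$, the functor $n \mapsto \mathscr{H}om(T,G_n)$ from $\mathrm{FI}$ to topological spaces is representation stable, i.e. for every $i\ge 0$ the $\mathrm{FI}$-module over $\mathbb{Z}$ given by $n\mapsto H_i(\mathscr{H}om(T,G_n);\mathbb{Z})$ is finitely generated. In particular, if $i \geq 0$ is fixed, then the function $$n \mapsto \dim_{\mathbb{R}} H_i(\mathscr{H}om(T,G_n);\mathbb{R})$$ agrees, for all sufficiently large $n$, with a polynomial of degree at most $|V(T)|\cdot d(i+1)$.
   Context: Graphs are finite and simple (no multi-edges, no self-loops), possibly disconnected. A homomorphism of graphs $\phi:G\to G'$ is a map $V(G)\to V(G')$ such that $\{x,y\}\in E(G)$ implies $\{\phi(x),\phi(y)\}\in E(G')$. Let $[n]=\{1,\dots,n\}$, and let $\mathrm{FI}$ be the category with objects $[n]$, $n\ge 0$, and morphisms all injections. An $\mathrm{FI}$-graph $G_\bullet$ is a functor from $\mathrm{FI}$ to the category of graphs and graph homomorphisms; $G_n$ is its value on $[n]$ and $G(f)$ is the map induced by an injection $f$. $G_\bullet$ is vertex-stable with stable degree $\le d$ if for all $n\ge d$ and every $v\in V(G_{n+1})$ there exist $w\in V(G_n)$ and an injection $f:[n]\hookrightarrow[n+1]$ with $G(f)(w)=v$. A multi-homomorphism from $T$ to $G$ is a map $\alpha$ from $V(T)$ to the set of non-empty subsets of $V(G)$ such that if $\{x,y\}\in E(T)$ then $\{x',y'\}\in E(G)$ for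 all $x'\in\alpha(x)$, $y'\in\alpha(y)$. The Hom-complex $\mathscr{H}om(T,G)$ is the cell complex whose cells are the multi-homomorphisms from $T$ to $G$, with $\alpha$ a face of $\tau$ iff $\alpha(x)\subseteq\tau(x)$ for all $x\in V(T)$; the cell of $\alpha$ is the product over $x\in V(T)$ of the simplices with vertex sets $\alpha(x)$, of dimension $\sum_{x}(|\alpha(x)|-1)$. A graph homomorphism $\phi:G\to G'$ induces a continuous map $\mathscr{H}om(T,G)\to\mathscr{H}om(T,G')$ (on each cell, the product of the simplicial maps induced by $\phi$), sending the cell $\alpha$ onto the cell $x\mapsto\phi(\alpha(x))$. An $\mathrm{FI}$-module over a ring $R$ is a functor $V$ from $\mathrm{FI}$ to $R$-modules; it is finitely generated if there is a finite set of elements of $\bigsqcup_n V_n$ not contained in any proper submodule. *)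

theory Defs
  imports "HOL-Homology.Homology" "Jordan_Normal_Form.VS_Connect"
begin

section \<open>Graphs\<close>

record 'v graph =
  verts :: "'v set"
  edges :: "'v set set"

definition simple_graph :: "'v graph \<Rightarrow> bool" where
  "simple_graph G \<longleftrightarrow>
     finite (verts G) \<and> edges G \<subseteq> {{x, y} | x y. x \<in> verts G \<and> y \<in> verts G \<and> x \<noteq> y}"

definition graph_hom :: "'v graph \<Rightarrow> 'w graph \<Rightarrow> ('v \<Rightarrow> 'w) \<Rightarrow> bool" where
  "graph_hom G G' \<phi> \<longleftrightarrow>
     \<phi> \<in> verts G \<rightarrow> verts G' \<and> (\<forall>x y. {x, y} \<in> edges G \<longrightarrow> {\<phi> x, \<phi> y} \<in> edges G')"


section \<open>Functors on the category FI\<close>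

text \<open>
  The object \<open>[n]\<close> is represented by its index \<open>n\<close>. Morphisms are extensional functions, so that
  equality of morphisms is equality in HOL. A functor consists of its values on objects and a
  family \<open>F m n f\<close> of maps indexed by source, target and morphism; maps out of an object only
  matter on its carrier.
\<close>

definition FI_mor :: "nat \<Rightarrow> nat \<Rightarrow> (nat \<Rightarrow> nat) set" where
  "FI_mor m n = {f \<in> {1..m} \<rightarrow>\<^sub>E {1..n}. inj_on f {1..m}}"

definition FI_id :: "nat \<Rightarrow> nat \<Rightarrow> nat" where
  "FI_id n = (\<lambda>k\<in>{1..n}. k)"

definition FI_graph :: "(nat \<Rightarrow> 'v graph) \<Rightarrow> (nat \<Rightarrow> nat \<Rightarrow> (nat \<Rightarrow> nat) \<Rightarrow> 'v \<Rightarrow> 'v) \<Rightarrow> bool" where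
  "FI_graph G F \<longleftrightarrow>
     (\<forall>n. simple_graph (G n)) \<and>
     (\<forall>m n. \<forall>f \<in> FI_mor m n. graph_hom (G m) (G n) (F m n f)) \<and>
     (\<forall>n. \<forall>v \<in> verts (G n). F n n (FI_id n) v = v) \<and>
     (\<forall>l m n. \<forall>f \<in> FI_mor l m. \<forall>g \<in> FI_mor m n. \<forall>v \<in> verts (G l).
        F l n (compose {1..l} g f) v = F m n g (F l m f v))"

definition vertex_stable ::
    "(nat \<Rightarrow> 'v graph) \<Rightarrow> (nat \<Rightarrow> nat \<Rightarrow> (nat \<Rightarrow> nat) \<Rightarrow> 'v \<Rightarrow> 'v) \<Rightarrow> nat \<Rightarrow> bool" where
  "vertex_stable G F d \<longleftrightarrow>
     (\<forall>n\<ge>d. \<forall>v \<in> verts (G (n + 1)). \<exists>w \<in> verts (G n). \<exists>f \<in> FI_mor n (n + 1). F n (n + 1) f w = v)"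

definition FI_space :: "(nat \<Rightarrow> 'a topology) \<Rightarrow> (nat \<Rightarrow> nat \<Rightarrow> (nat \<Rightarrow> nat) \<Rightarrow> 'a \<Rightarrow> 'a) \<Rightarrow> bool" where
  "FI_space X F \<longleftrightarrow>
     (\<forall>m n. \<forall>f \<in> FI_mor m n. continuous_map (X m) (X n) (F m n f)) \<and>
     (\<forall>n. \<forall>x \<in> topspace (X n). F n n (FI_id n) x = x) \<and>
     (\<forall>l m n. \<forall>f \<in> FI_mor l m. \<forall>g \<in> FI_mor m n. \<forall>x \<in> topspace (X l).
        F l n (compose {1..l} g f) x = F m n g (F l m f x))"

text \<open>
  FI-modules over the integers: \<open>\<int>\<close>-modules are abelian groups (written multiplicatively in the
  algebra library), and submodules are subgroups.
\<close>

definition FI_module :: "(nat \<Rightarrow> 'a monoid) \<Rightarrow> (nat \<Rightarrow> nat \<Rightarrow> (nat \<Rightarrow> nat) \<Rightarrow> 'a \<Rightarrow> 'a) \<Rightarrow> bool" where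
  "FI_module M F \<longleftrightarrow>
     (\<forall>n. comm_group (M n)) \<and>
     (\<forall>m n. \<forall>f \<in> FI_mor m n. F m n f \<in> hom (M m) (M n)) \<and>
     (\<forall>n. \<forall>x \<in> carrier (M n). F n n (FI_id n) x = x) \<and>
     (\<forall>l m n. \<forall>f \<in> FI_mor l m. \<forall>g \<in> FI_mor m n. \<forall>x \<in> carrier (M l).
        F l n (compose {1..l} g f) x = F m n g (F l m f x))"

definition FI_submodule ::
    "(nat \<Rightarrow> 'a set) \<Rightarrow> (nat \<Rightarrow> 'a monoid) \<Rightarrow> (nat \<Rightarrow> nat \<Rightarrow> (nat \<Rightarrow> nat) \<Rightarrow> 'a \<Rightarrow> 'a) \<Rightarrow> bool" where
  "FI_submodule N M F \<longleftrightarrow>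
     (\<forall>n. subgroup (N n) (M n)) \<and>
     (\<forall>m n. \<forall>f \<in> FI_mor m n. \<forall>x \<in> N m. F m n f x \<in> N n)"

definition FI_finitely_generated ::
    "(nat \<Rightarrow> 'a monoid) \<Rightarrow> (nat \<Rightarrow> nat \<Rightarrow> (nat \<Rightarrow> nat) \<Rightarrow> 'a \<Rightarrow> 'a) \<Rightarrow> bool" where
  "FI_finitely_generated M F \<longleftrightarrow>
     (\<exists>S. finite S \<and> S \<subseteq> (SIGMA n:UNIV. carrier (M n)) \<and>
        (\<forall>N. FI_submodule N M F \<and> S \<subseteq> (SIGMA n:UNIV. N n) \<longrightarrow> (\<forall>n. N n = carrier (M n))))"

definition representation_stable ::
    "(nat \<Rightarrow> 'a topology) \<Rightarrow> (nat \<Rightarrow> nat \<Rightarrow> (nat \<Rightarrow> nat) \<Rightarrow> 'a \<Rightarrow> 'a) \<Rightarrow> bool" where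
  "representation_stable X F \<longleftrightarrow>
     FI_space X F \<and>
     (\<forall>i::nat.
        let M = (\<lambda>n. homology_group (int i) (X n));
            H = (\<lambda>m n f. hom_induced (int i) (X m) {} (X n) {} (F m n f))
        in FI_module M H \<and> FI_finitely_generated M H)"


section \<open>Hom-complexes\<close>

definition multi_homs :: "'t graph \<Rightarrow> 'v graph \<Rightarrow> ('t \<Rightarrow> 'v set) set" where
  "multi_homs T G =
     {\<alpha> \<in> verts T \<rightarrow>\<^sub>E {A. A \<subseteq> verts G \<and> A \<noteq> {}}.
        \<forall>x y. {x, y} \<in> edges T \<longrightarrow> (\<forall>x' \<in> \<alpha> x. \<forall>y' \<in> \<alpha> y. {x', y'} \<in> edges G)}"

text \<open>
  The simplex with vertex set \<open>A\<close>, in barycentric coordinates.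
\<close>

definition simplex_on :: "'v set \<Rightarrow> ('v \<Rightarrow> real) set" where
  "simplex_on A = {q. (\<forall>v. 0 \<le> q v) \<and> (\<forall>v. v \<notin> A \<longrightarrow> q v = 0) \<and> sum q A = 1}"

definition hom_cell :: "'t graph \<Rightarrow> ('t \<Rightarrow> 'v set) \<Rightarrow> ('t \<Rightarrow> 'v \<Rightarrow> real) set" where
  "hom_cell T \<alpha> = {p. (\<forall>x \<in> verts T. p x \<in> simplex_on (\<alpha> x)) \<and> (\<forall>x. x \<notin> verts T \<longrightarrow> p x = (\<lambda>v. 0))}"

text \<open>
  All closed cells lie in the product over \<open>verts T\<close> of copies of the full simplex on \<open>verts G\<close>, where
  they meet exactly in common faces: the cells of \<open>\<alpha>\<close> and \<open>\<tau>\<close> meet in the cell of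
  \<open>x \<mapsto> \<alpha> x \<inter> \<tau> x\<close> if all these sets are nonempty, and are disjoint otherwise. For finite \<open>T\<close> and \<open>G\<close>
  the complex is finite, so the topology of the cell complex is the subspace topology. The topology
  of \<open>'t \<Rightarrow> 'v \<Rightarrow> real\<close> is the product topology.
\<close>

definition hom_complex :: "'t graph \<Rightarrow> 'v graph \<Rightarrow> ('t \<Rightarrow> 'v \<Rightarrow> real) topology" where
  "hom_complex T G = top_of_set (\<Union>\<alpha> \<in> multi_homs T G. hom_cell T \<alpha>)"

text \<open>
  In each factor this is the affine extension of the vertex map \<open>\<phi>\<close>: the barycentric coordinate at
  \<open>w\<close> of the image is the sum of the coordinates at the vertices mapped to \<open>w\<close>.
\<close>

definition hom_complex_map ::
    "'v graph \<Rightarrow> ('v \<Rightarrow> 'w) \<Rightarrow> ('t \<Rightarrow> 'v \<Rightarrow> real) \<Rightarrow> ('t \<Rightarrow> 'w \<Rightarrow> real)" where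
  "hom_complex_map G \<phi> p = (\<lambda>x w. \<Sum>v \<in> {v \<in> verts G. \<phi> v = w}. p x v)"


section \<open>Singular homology with coefficients in a commutative ring\<close>

text \<open>
  The homology library only treats integer coefficients. The definitions below repeat the same
  construction, with the library's singular simplices and faces, for coefficients in an arbitrary
  commutative ring \<open>'r\<close>. The multiplicative part of the module records is irrelevant.
\<close>

type_synonym ('a, 'r) coeff_chain = "((nat \<Rightarrow> real) \<Rightarrow> 'a) \<Rightarrow>\<^sub>0 'r"

definition coeff_chains :: "nat \<Rightarrow> 'a topology \<Rightarrow> ('a, 'r::comm_ring_1) coeff_chain set" where
  "coeff_chains p X = {c. Poly_Mapping.keys c \<subseteq> singular_simplex_set p X}"

definition coeff_boundary ::
    "nat \<Rightarrow> ('a, 'r::comm_ring_1) coeff_chain \<Rightarrow> ('a, 'r) coeff_chain" where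
  "coeff_boundary p c =
     (if p = 0 then 0
      else \<Sum>\<sigma> \<in> Poly_Mapping.keys c. \<Sum>k\<le>p.
             Poly_Mapping.single (singular_face p k \<sigma>) ((-1) ^ k * Poly_Mapping.lookup c \<sigma>))"

definition coeff_cycles :: "nat \<Rightarrow> 'a topology \<Rightarrow> ('a, 'r::comm_ring_1) coeff_chain set" where
  "coeff_cycles p X = {c \<in> coeff_chains p X. coeff_boundary p c = 0}"

definition coeff_boundaries :: "nat \<Rightarrow> 'a topology \<Rightarrow> ('a, 'r::comm_ring_1) coeff_chain set" where
  "coeff_boundaries p X = coeff_boundary (Suc p) ` coeff_chains (Suc p) X"

definition coeff_cycle_module ::
    "nat \<Rightarrow> 'a topology \<Rightarrow> ('r::comm_ring_1, ('a, 'r) coeff_chain) module" where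
  "coeff_cycle_module p X =
     \<lparr>carrier = coeff_cycles p X, mult = undefined, one = undefined, zero = 0, add = (+),
      smult = (\<lambda>r. Poly_Mapping.map ((*) r))\<rparr>"

text \<open>
  The quotient of the module of cycles by the boundaries. The scalar multiple of a coset is formed
  as a union of cosets, since the set of multiples of its elements is not a coset for scalar 0.
\<close>

definition coeff_homology ::
    "nat \<Rightarrow> 'a topology \<Rightarrow> ('r::comm_ring_1, ('a, 'r) coeff_chain set) module" where
  "coeff_homology p X =
     (let Z = coeff_cycle_module p X; B = coeff_boundaries p X
      in \<lparr>carrier = a_rcosets\<^bsub>Z\<^esub> B, mult = undefined, one = undefined, zero = B, add = set_add Z,
          smult = (\<lambda>r K. \<Union>c \<in> K. B +>\<^bsub>Z\<^esub> (r \<odot>\<^bsub>Z\<^esub> c))\<rparr>)"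

abbreviation real_homology ::
    "nat \<Rightarrow> 'a topology \<Rightarrow> (real, ('a, real) coeff_chain set) module" where
  "real_homology \<equiv> coeff_homology"

end

theory Submission
  imports Defs "HOL-Computational_Algebra.Polynomial" "HOL-Library.List_Lexorder"
begin

text \<open>
  Everything is restricted to order-preserving injections (OI), under which monomials of free modules
  can be totally ordered. By Dickson's lemma and leading coefficients, submodules of finitely generated
  OI-modules over the integers are finitely generated. The monomials that are not leading form a basis
  up to torsion, and counting the complement of a finitely generated upper set shows that the rank is
  eventually a polynomial in \<open>n\<close>.

  Let \<open>X\<^sub>k\<close> be the \<open>k\<close>-skeleton of the Hom-complex \<open>X\<close>. The group \<open>H\<^sub>i(X\<^sub>i)\<close> surjects onto
  \<open>H\<^sub>i(X)\<close> and embeds into \<open>H\<^sub>i(X\<^sub>i, X\<^sub>i\<^sub>-\<^sub>1)\<close>, which is generated by one class for every \<open>i\<close>-cell.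
  By Dickson's lemma again, all \<open>i\<close>-cells arise from finitely many, so \<open>H\<^sub>i(X)\<close> is a subquotient of a
  finitely generated OI-module. An \<open>i\<close>-cell is a choice of \<open>i + |V(T)|\<close> pairs in \<open>V(T) \<times> V(G\<^sub>n)\<close>, and
  \<open>|V(G\<^sub>n)|\<close> is \<open>O(n^d)\<close>; so the rank is \<open>O(n^(d (i + |V(T)|)))\<close>, and \<open>i + |V(T)| \<le> |V(T)| (i + 1)\<close>
  unless \<open>V(T)\<close> is empty. Rational coordinates of real numbers turn the rank of integral homology
  into the dimension of real homology.
\<close>

section \<open>Dickson's lemma and Hilbert functions\<close>

text \<open>No cellular chain complex is built. The relative groups of consecutive skeleta stand in
  for the cellular chain groups, so neither a boundary formula nor a coherent choice of orientations
  is needed: each cell gets an arbitrary generator of its cyclic group. Likewise neither free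
  OI-modules nor modules of relations are constructed. Monomials are handled through their images,
  and leading coefficients are taken modulo the span of the smaller monomials. Over the integers the
  minimal leading coefficient is one more coordinate for Dickson's lemma, and a monomial counts
  towards the rank only if no positive multiple of it reduces to smaller ones. Polynomiality and
  degree are obtained separately: the Hilbert function yields some polynomial without control of its
  degree, and the degree is then read off from a growth estimate. Passing from FI to OI is harmless
  because an FI-submodule is closed under OI in particular, and because the reordering contained in
  an arbitrary injection can be absorbed into the vertex that it is applied to.\<close>

lemma dickson:
  fixes A :: "nat list set"
  assumes "\<And>a. a \<in> A \<Longrightarrow> length a = k"
  shows "\<exists>B. finite B \<and> B \<subseteq> A \<and> (\<forall>a\<in>A. \<exists>b\<in>B. list_all2 (\<le>) b a)"
  using assms
proof (induction k arbitrary: A)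
  case 0
  then have "A \<subseteq> {[]}" by auto
  then have "finite A" by (rule finite_subset) simp
  then show ?case by (intro exI[of _ A]) (auto intro: list.rel_refl)
next
  case (Suc k)
  have "\<exists>B. finite B \<and> B \<subseteq> tl ` A \<and> (\<forall>a\<in>tl ` A. \<exists>b\<in>B. list_all2 (\<le>) b a)"
    by (rule Suc.IH) (use Suc.prems in auto)
  then obtain B0 where B0: "finite B0" "B0 \<subseteq> tl ` A" "\<forall>a\<in>tl ` A. \<exists>b\<in>B0. list_all2 (\<le>) b a"
    by blast
  have "\<forall>t\<in>B0. \<exists>a. a \<in> A \<and> tl a = t" using B0(2) by blast
  then obtain g where g: "\<And>t. t \<in> B0 \<Longrightarrow> g t \<in> A \<and> tl (g t) = t" by metis
  \<comment> \<open>A list whose head exceeds \<open>M\<close> lies above the lift of a minimal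
    tail. Only the heads up to \<open>M\<close> need separate treatment, one slice each.\<close>
  define M where "M = Max (insert 0 (hd ` g ` B0))"
  have M: "hd (g t) \<le> M" if "t \<in> B0" for t
    unfolding M_def by (rule Max_ge) (use B0(1) that in auto)
  have "\<exists>B. finite B \<and> B \<subseteq> A \<and> (\<forall>t. c # t \<in> A \<longrightarrow> (\<exists>b\<in>B. list_all2 (\<le>) b (c # t)))" for c
  proof -
    have "\<exists>B. finite B \<and> B \<subseteq> {t. c # t \<in> A} \<and> (\<forall>a\<in>{t. c # t \<in> A}. \<exists>b\<in>B. list_all2 (\<le>) b a)"
      by (rule Suc.IH) (use Suc.prems in force)
    then obtain B where "finite B" "B \<subseteq> {t. c # t \<in> A}"
      "\<forall>a\<in>{t. c # t \<in> A}. \<exists>b\<in>B. list_all2 (\<le>) b a" by blast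
    then show ?thesis by (intro exI[of _ "(#) c ` B"]) auto
  qed
  then obtain C where C: "\<And>c. finite (C c)" "\<And>c. C c \<subseteq> A"
    "\<And>c t. c # t \<in> A \<Longrightarrow> \<exists>b\<in>C c. list_all2 (\<le>) b (c # t)" by metis
  show ?case
  proof (intro exI[of _ "g ` B0 \<union> (\<Union>c\<le>M. C c)"] conjI ballI)
    show "finite (g ` B0 \<union> (\<Union>c\<le>M. C c))" using B0 C by auto
    show "g ` B0 \<union> (\<Union>c\<le>M. C c) \<subseteq> A" using g C by auto
    fix a assume a: "a \<in> A"
    then obtain c t where ct: "a = c # t" using Suc.prems[of a] by (cases a) auto
    show "\<exists>b\<in>g ` B0 \<union> (\<Union>c\<le>M. C c). list_all2 (\<le>) b a"
    proof (cases "c \<le> M")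
      case True
      then show ?thesis using C(3)[of c t] a ct by auto
    next
      case False
      from a ct have "t \<in> tl ` A" by force
      then obtain b where b: "b \<in> B0" "list_all2 (\<le>) b t" using B0(3) by blast
      obtain e where e: "g b = e # b" using g[OF b(1)] Suc.prems[of "g b"] by (cases "g b") auto
      have "list_all2 (\<le>) (g b) a" using M[OF b(1)] False b(2) e ct by simp
      then show ?thesis using b(1) by blast
    qed
  qed
qed

section \<open>Functions that are eventually polynomial, and their partial sums\<close>

definition eventually_polynomial :: "(nat \<Rightarrow> real) \<Rightarrow> bool" where
  "eventually_polynomial f \<longleftrightarrow> (\<exists>P. \<forall>\<^sub>F n in sequentially. f n = poly P (real n))"

lemma eventually_polynomial_cong:
  assumes "eventually_polynomial f" "\<forall>\<^sub>F n in sequentially. g n = f n"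
  shows "eventually_polynomial g"
proof -
  obtain P where "\<forall>\<^sub>F n in sequentially. f n = poly P (real n)"
    using assms(1) by (auto simp: eventually_polynomial_def)
  with assms(2) have "\<forall>\<^sub>F n in sequentially. g n = poly P (real n)"
    by eventually_elim simp
  then show ?thesis by (auto simp: eventually_polynomial_def)
qed

lemma eventually_polynomial_const: "eventually_polynomial (\<lambda>n. c)"
  unfolding eventually_polynomial_def by (rule exI[of _ "[:c:]"]) simp

lemma eventually_polynomial_add:
  assumes "eventually_polynomial f" "eventually_polynomial g"
  shows "eventually_polynomial (\<lambda>n. f n + g n)"
proof -
  obtain P Q where "\<forall>\<^sub>F n in sequentially. f n = poly P (real n)"
    "\<forall>\<^sub>F n in sequentially. g n = poly Q (real n)"
    using assms by (auto simp: eventually_polynomial_def)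
  then have "\<forall>\<^sub>F n in sequentially. f n + g n = poly (P + Q) (real n)"
    by eventually_elim simp
  then show ?thesis unfolding eventually_polynomial_def by blast
qed

lemma eventually_polynomial_sum:
  assumes "\<And>i. i \<in> I \<Longrightarrow> eventually_polynomial (f i)"
  shows "eventually_polynomial (\<lambda>n. \<Sum>i\<in>I. f i n)"
  using assms
  by (induction I rule: infinite_finite_induct)
    (auto intro: eventually_polynomial_const eventually_polynomial_add)

lemma eventually_polynomial_shift:
  assumes "eventually_polynomial f"
  shows "eventually_polynomial (\<lambda>n. f (n - c))"
proof -
  obtain P where P: "\<forall>\<^sub>F n in sequentially. f n = poly P (real n)"
    using assms by (auto simp: eventually_polynomial_def)
  then obtain N where N: "\<And>n. n \<ge> N \<Longrightarrow> f n = poly P (real n)"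
    by (auto simp: eventually_sequentially)
  have "\<forall>n\<ge>N + c. f (n - c) = poly (P \<circ>\<^sub>p [:- real c, 1:]) (real n)"
    using N by (auto simp: poly_pcompose of_nat_diff)
  then show ?thesis unfolding eventually_polynomial_def eventually_sequentially by blast
qed

text \<open>The difference of \<open>x ^ Suc n\<close> is \<open>Suc n\<close> times
  \<open>x ^ n\<close> plus lower powers. The antidifferences of those, known by induction, are
  subtracted, and the result is divided by \<open>Suc n\<close>.\<close>

lemma poly_antidifference_power:
  "\<exists>Q :: real poly. \<forall>x. poly Q (x + 1) - poly Q x = x ^ n"
proof (induction n rule: less_induct)
  case (less n)
  then obtain Q :: "nat \<Rightarrow> real poly"
    where Q: "\<And>k x. k < n \<Longrightarrow> poly (Q k) (x + 1) - poly (Q k) x = x ^ k" by metis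
  define R where "R = Polynomial.smult (1 / real (Suc n))
    (monom 1 (Suc n) - (\<Sum>k<n. Polynomial.smult (real (Suc n choose k)) (Q k)))"
  have "poly R (x + 1) - poly R x = x ^ n" for x
  proof -
    have b: "(x + 1) ^ Suc n = x ^ Suc n + (real (Suc n) * x ^ n
        + (\<Sum>k<n. real (Suc n choose k) * x ^ k))"
      by (subst binomial_ring) (simp flip: lessThan_Suc_atMost)
    have s: "(\<Sum>k<n. real (Suc n choose k) * poly (Q k) (x + 1))
        = (\<Sum>k<n. real (Suc n choose k) * poly (Q k) x) + (\<Sum>k<n. real (Suc n choose k) * x ^ k)"
      unfolding sum.distrib[symmetric]
      by (rule sum.cong) (use Q[of _ x] in \<open>auto simp: algebra_simps\<close>)
    have "poly R (x + 1) - poly R x = (1 / real (Suc n)) * ((x + 1) ^ Suc n - x ^ Suc n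
       - ((\<Sum>k<n. real (Suc n choose k) * poly (Q k) (x + 1))
         - (\<Sum>k<n. real (Suc n choose k) * poly (Q k) x)))"
      unfolding R_def by (simp only: poly_smult poly_diff poly_monom poly_sum)
        (simp add: algebra_simps del: power_Suc of_nat_Suc binomial_Suc_Suc)
    also have "\<dots> = (1 / real (Suc n)) * (real (Suc n) * x ^ n)"
      unfolding b s by simp
    also have "\<dots> = x ^ n" by simp
    finally show ?thesis .
  qed
  then show ?case by blast
qed

lemma poly_antidifference:
  fixes P :: "real poly"
  shows "\<exists>Q. \<forall>x. poly Q (x + 1) - poly Q x = poly P x"
proof -
  obtain Q :: "nat \<Rightarrow> real poly" where Q: "\<And>k x. poly (Q k) (x + 1) - poly (Q k) x = x ^ k"
    using poly_antidifference_power by metis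
  have "poly (\<Sum>i\<le>degree P. Polynomial.smult (coeff P i) (Q i)) (x + 1)
      - poly (\<Sum>i\<le>degree P. Polynomial.smult (coeff P i) (Q i)) x = poly P x" for x
    unfolding poly_sum sum_subtractf[symmetric] poly_smult right_diff_distrib[symmetric] Q
    by (simp add: poly_altdef)
  then show ?thesis by blast
qed

lemma eventually_polynomial_sum_upto:
  assumes "eventually_polynomial f"
  shows "eventually_polynomial (\<lambda>n. \<Sum>j\<le>n. f j)"
proof -
  obtain P where P: "\<forall>\<^sub>F n in sequentially. f n = poly P (real n)"
    using assms by (auto simp: eventually_polynomial_def)
  then obtain N where N: "\<And>n. n \<ge> N \<Longrightarrow> f n = poly P (real n)"
    by (auto simp: eventually_sequentially)
  obtain Q where Q: "\<And>x. poly Q (x + 1) - poly Q x = poly P x"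
    using poly_antidifference by metis
  \<comment> \<open>\<open>c\<close> absorbs the values of \<open>f\<close> up to \<open>N\<close>,
    where \<open>f\<close> need not agree with \<open>P\<close>; beyond that the sum telescopes. The
    argument of \<open>Q\<close> is shifted by one because the upper end belongs to the sum.\<close>
  define c where "c = (\<Sum>j\<le>N. f j) - poly Q (real N + 1)"
  have "(\<Sum>j\<le>n. f j) = poly (Q \<circ>\<^sub>p [:1, 1:] + [:c:]) (real n)" if "n \<ge> N" for n
    using that
  proof (induction n rule: dec_induct)
    case base
    then show ?case by (simp add: c_def poly_pcompose add.commute)
  next
    case (step n)
    then show ?case using Q[of "real n + 1"] N[of "Suc n"]
      by (simp add: poly_pcompose algebra_simps)
  qed
  then show ?thesis unfolding eventually_polynomial_def eventually_sequentially by blast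
qed

lemma finite_lists_sum_list: "finite {g :: nat list. length g = k \<and> sum_list g = n}"
proof (rule finite_subset)
  show "{g :: nat list. length g = k \<and> sum_list g = n} \<subseteq> {g. set g \<subseteq> {..n} \<and> length g = k}"
    using member_le_sum_list by fastforce
  show "finite {g. set g \<subseteq> {..n} \<and> length g = k}" by (rule finite_lists_length_eq) simp
qed

text \<open>Slice by the first entry: by Dickson's lemma the slices of a down-closed set become constant.\<close>

lemma down_closed_Hilbert_function:
  fixes D :: "nat list set"
  assumes "\<And>a. a \<in> D \<Longrightarrow> length a = k"
    and "\<And>a b. a \<in> D \<Longrightarrow> list_all2 (\<le>) b a \<Longrightarrow> b \<in> D"
  shows "eventually_polynomial (\<lambda>n. real (card {g \<in> D. sum_list g = n}))"
  using assms
proof (induction k arbitrary: D)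
  case 0
  have "\<forall>n\<ge>1. real (card {g \<in> D. sum_list g = n}) = 0"
    using 0(1) by (fastforce simp: card_eq_0_iff)
  then show ?case
    by (intro eventually_polynomial_cong[OF eventually_polynomial_const[of 0]])
      (unfold eventually_sequentially, blast)
next
  case (Suc k)
  define S where "S c = {t. c # t \<in> D}" for c
  define h where "h c n = real (card {t \<in> S c. sum_list t = n})" for c n
  have h: "eventually_polynomial (h c)" for c
    unfolding h_def
    by (rule Suc.IH) (use Suc.prems(1) in \<open>force simp: S_def\<close>,
      use Suc.prems(2) in \<open>force simp: S_def\<close>)
  \<comment> \<open>The complement is closed upwards and lies above the finite set \<open>B\<close>.
    Beyond the largest first entry in \<open>B\<close>, the first entry no longer decides
    membership.\<close>
  define U where "U = {g. length g = Suc k \<and> g \<notin> D}"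
  obtain B where B: "finite B" "B \<subseteq> U" "\<forall>a\<in>U. \<exists>b\<in>B. list_all2 (\<le>) b a"
    using dickson[of U "Suc k"] unfolding U_def by auto
  define M where "M = Max (insert 0 (hd ` B))"
  have M: "hd b \<le> M" if "b \<in> B" for b
    unfolding M_def by (rule Max_ge) (use B(1) that in auto)
  have S: "S c = S M" if "c \<ge> M" for c
  proof (intro equalityI subsetI)
    fix t assume "t \<in> S c"
    then show "t \<in> S M" using Suc.prems(2)[of "c # t" "M # t"] that
      by (auto simp: S_def intro: list.rel_refl)
  next
    fix t assume t: "t \<in> S M"
    show "t \<in> S c"
    proof (rule ccontr)
      assume "t \<notin> S c"
      then have "c # t \<in> U" using t Suc.prems(1)[of "M # t"] by (auto simp: U_def S_def)
      then obtain b where b: "b \<in> B" "list_all2 (\<le>) b (c # t)" using B by blast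
      then obtain e s where es: "b = e # s" by (cases b) auto
      have "list_all2 (\<le>) b (M # t)" using b M[of b] es by auto
      then have "b \<in> D" using Suc.prems(2) t by (auto simp: S_def)
      then show False using b B by (auto simp: U_def)
    qed
  qed
  have fin: "finite {t \<in> S c. sum_list t = n}" for c n
    by (rule finite_subset[OF _ finite_lists_sum_list[of k n]])
      (use Suc.prems(1) in \<open>force simp: S_def\<close>)
  have slice: "real (card {g \<in> D. sum_list g = n}) = (\<Sum>c\<le>n. h c (n - c))" for n
  proof -
    have "{g \<in> D. sum_list g = n} = (\<Union>c\<le>n. (#) c ` {t \<in> S c. sum_list t = n - c})"
    proof (intro equalityI subsetI)
      fix g assume g: "g \<in> {g \<in> D. sum_list g = n}"
      then obtain c t where "g = c # t" using Suc.prems(1)[of g] by (cases g) auto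
      then show "g \<in> (\<Union>c\<le>n. (#) c ` {t \<in> S c. sum_list t = n - c})"
        using g by (intro UN_I[of c]) (auto simp: S_def)
    qed (auto simp: S_def)
    also have "card \<dots> = (\<Sum>c\<le>n. card ((#) c ` {t \<in> S c. sum_list t = n - c}))"
      by (rule card_UN_disjoint) (use fin in auto)
    finally show ?thesis by (simp add: h_def card_image)
  qed
  have hM: "h c = h M" if "c \<ge> M" for c unfolding h_def S[OF that] ..
  \<comment> \<open>Finitely many slices contribute shifted Hilbert functions. The others share the
    Hilbert function of slice \<open>M\<close> and add up to its partial sums.\<close>
  have "(\<Sum>c\<le>n. h c (n - c)) = (\<Sum>c<M. h c (n - c)) + (\<Sum>j\<le>n - M. h M j)" if "n \<ge> M" for n
  proof -
    have "{..n} = {..<M} \<union> {M..n}" using that by auto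
    moreover have "{..<M} \<inter> {M..n} = {}" by auto
    ultimately have "(\<Sum>c\<le>n. h c (n - c)) = (\<Sum>c<M. h c (n - c)) + (\<Sum>c\<in>{M..n}. h c (n - c))"
      by (metis finite_lessThan finite_atLeastAtMost sum.union_disjoint)
    also have "(\<Sum>c\<in>{M..n}. h c (n - c)) = (\<Sum>c\<in>{M..n}. h M (n - c))"
      by (rule sum.cong[OF refl]) (metis hM atLeastAtMost_iff)
    also have "\<dots> = (\<Sum>j\<le>n - M. h M j)"
      by (rule sum.reindex_bij_witness[of _ "\<lambda>j. n - j" "\<lambda>c. n - c"]) (use that in auto)
    finally show ?thesis .
  qed
  then have "\<forall>\<^sub>F n in sequentially. real (card {g \<in> D. sum_list g = n})
      = (\<Sum>c<M. h c (n - c)) + (\<Sum>j\<le>n - M. h M j)"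
    unfolding slice eventually_sequentially by blast
  then show ?case
    by (rule eventually_polynomial_cong[rotated])
      (intro eventually_polynomial_add eventually_polynomial_sum eventually_polynomial_shift h
        eventually_polynomial_shift[OF eventually_polynomial_sum_upto])
qed

section \<open>OI-modules\<close>

definition OI_mor :: "nat \<Rightarrow> nat \<Rightarrow> (nat \<Rightarrow> nat) set" where
  "OI_mor m n = {f \<in> FI_mor m n. strict_mono_on {1..m} f}"

lemma OI_morI:
  assumes "strict_mono_on {1..m} f" "f ` {1..m} \<subseteq> {1..n}"
  shows "restrict f {1..m} \<in> OI_mor m n"
proof -
  have "strict_mono_on {1..m} (restrict f {1..m})" using assms(1) by (simp add: strict_mono_on_def)
  moreover have "restrict f {1..m} \<in> {1..m} \<rightarrow>\<^sub>E {1..n}" using assms(2) by auto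
  ultimately show ?thesis
    unfolding OI_mor_def FI_mor_def using strict_mono_on_imp_inj_on by blast
qed

lemma OI_mor_FI: "f \<in> OI_mor m n \<Longrightarrow> f \<in> FI_mor m n"
  by (simp add: OI_mor_def)

lemma OI_mor_range: "f \<in> OI_mor m n \<Longrightarrow> k \<in> {1..m} \<Longrightarrow> f k \<in> {1..n}"
  unfolding OI_mor_def FI_mor_def by blast

lemma OI_mor_less: "f \<in> OI_mor m n \<Longrightarrow> k \<in> {1..m} \<Longrightarrow> l \<in> {1..m} \<Longrightarrow> k < l \<Longrightarrow> f k < f l"
  by (simp add: OI_mor_def strict_mono_on_def)

lemma FI_id_OI: "FI_id n \<in> OI_mor n n"
  unfolding FI_id_def by (rule OI_morI) (auto simp: strict_mono_on_def)

text \<open>For \<open>a = 0\<close> these are the value lists of order-preserving injections from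
  \<open>[m]\<close> to \<open>[n]\<close>. The lower bound varies so that a recursion can strip the
  first entry.\<close>

definition slists :: "nat \<Rightarrow> nat \<Rightarrow> nat \<Rightarrow> nat list set" where
  "slists m a n = {xs. length xs = m \<and> sorted_wrt (<) xs \<and> set xs \<subseteq> {a<..n}}"

lemma finite_slists: "finite (slists m a n)"
  by (rule finite_subset[OF _ finite_lists_length_eq[of "{a<..n}" m]]) (auto simp: slists_def)

lemma map_OI_slists:
  assumes "xs \<in> slists m 0 k" "h \<in> OI_mor k n"
  shows "map h xs \<in> slists m 0 n"
proof -
  have "sorted_wrt (\<lambda>x y. h x < h y) xs"
    by (rule sorted_wrt_mono_rel[of _ "(<)"])
      (use assms(1) in \<open>auto simp: slists_def subset_eq intro!: OI_mor_less[OF assms(2)]\<close>)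
  moreover have "h x \<in> {0<..n}" if "x \<in> set xs" for x
    using OI_mor_range[OF assms(2), of x] assms(1) that by (auto simp: slists_def)
  ultimately show ?thesis using assms(1) by (auto simp: slists_def sorted_wrt_map)
qed

text \<open>The numbers of omitted values before, between and after the entries. An increasing list
  becomes an unconstrained vector with one more entry, and the sum of the vector remembers
  \<open>n\<close>.\<close>

fun gaps :: "nat \<Rightarrow> nat \<Rightarrow> nat list \<Rightarrow> nat list" where
  "gaps a n [] = [n - a]"
| "gaps a n (x # xs) = (x - Suc a) # gaps x n xs"

lemma length_gaps [simp]: "length (gaps a n xs) = Suc (length xs)"
  by (induction xs arbitrary: a) auto

lemma sum_list_gaps: "xs \<in> slists m a n \<Longrightarrow> a \<le> n \<Longrightarrow> sum_list (gaps a n xs) + (a + m) = n"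
proof (induction xs arbitrary: a m)
  case (Cons x xs)
  then have "xs \<in> slists (length xs) x n" "a < x" "x \<le> n" "m = Suc (length xs)"
    by (auto simp: slists_def)
  with Cons.IH[of "length xs" x] show ?case by auto
qed (auto simp: slists_def)

lemma gaps_inject:
  "xs \<in> slists m a n \<Longrightarrow> ys \<in> slists m a n \<Longrightarrow> gaps a n xs = gaps a n ys \<Longrightarrow> xs = ys"
proof (induction xs arbitrary: a m ys)
  case (Cons x xs)
  then obtain y zs where y: "ys = y # zs" by (cases ys) (auto simp: slists_def)
  have "x = y" using Cons.prems y by (auto simp: slists_def)
  moreover have "xs \<in> slists (m - 1) x n" "zs \<in> slists (m - 1) y n"
    using Cons.prems y by (auto simp: slists_def)
  ultimately show ?case using Cons.IH[of "m - 1" x zs] Cons.prems y by auto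
qed (auto simp: slists_def)

lemma gaps_surj:
  "length g = Suc m \<Longrightarrow> \<exists>xs \<in> slists m a (a + m + sum_list g). gaps a (a + m + sum_list g) xs = g"
proof (induction m arbitrary: a g)
  case 0
  then obtain c where "g = [c]" by (metis length_Suc_conv length_0_conv)
  then show ?case by (auto simp: slists_def)
next
  case (Suc m)
  then obtain c t where g: "g = c # t" by (cases g) auto
  define x where "x = Suc (a + c)"
  have n: "x + m + sum_list t = a + Suc m + sum_list g" by (simp add: x_def g)
  obtain xs where xs: "xs \<in> slists m x (a + Suc m + sum_list g)"
      "gaps x (a + Suc m + sum_list g) xs = t"
    using Suc.IH[of t x] Suc.prems unfolding n by (auto simp: g)
  have "x # xs \<in> slists (Suc m) a (a + Suc m + sum_list g)"
    using xs(1) n by (force simp: slists_def x_def)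
  moreover have "gaps a (a + Suc m + sum_list g) (x # xs) = g"
    using xs(2) by (simp add: g x_def)
  ultimately show ?case by blast
qed

text \<open>Dickson's order on gap vectors is divisibility under OI: if each gap of
  \<open>xs\<close> is at most the corresponding gap of \<open>ys\<close>, the omitted values of the
  one fit, in order, among those of the other.\<close>

lemma gaps_embed:
  assumes "xs \<in> slists m a n" "ys \<in> slists m b k" "a \<le> n" "b \<le> k"
    and "list_all2 (\<le>) (gaps a n xs) (gaps b k ys)"
  shows "\<exists>h. strict_mono_on {a<..n} h \<and> h ` {a<..n} \<subseteq> {b<..k} \<and> map h xs = ys"
  using assms
proof (induction xs arbitrary: a b m ys)
  case Nil
  then have "ys = []" by (auto simp: slists_def)
  with Nil show ?case
    by (intro exI[of _ "\<lambda>i. i - a + b"]) (auto simp: strict_mono_on_def)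
next
  case (Cons x xs)
  then obtain y zs where y: "ys = y # zs" by (cases ys) (auto simp: slists_def)
  have 1: "xs \<in> slists (m - 1) x n" "zs \<in> slists (m - 1) y k" "a < x" "x \<le> n" "b < y" "y \<le> k"
    "x - a \<le> y - b" "list_all2 (\<le>) (gaps x n xs) (gaps y k zs)"
    using Cons.prems y by (auto simp: slists_def)
  obtain h where h: "strict_mono_on {x<..n} h" "h ` {x<..n} \<subseteq> {y<..k}" "map h xs = zs"
    using Cons.IH[OF 1(1,2,4,6,8)] by blast
  \<comment> \<open>The first gap is moved to start right after \<open>b\<close>;
    \<open>x - a \<le> y - b\<close> keeps its image below \<open>y\<close>.\<close>
  define h' where "h' i = (if i < x then i - a + b else if i = x then y else h i)" for i
  have "h i \<in> {y<..k}" if "x < i" "i \<le> n" for i using h(2) that by (auto simp: image_subset_iff)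
  note hr = this[simplified]
  have "strict_mono_on {a<..n} h'"
  proof (rule strict_mono_onI)
    fix r s assume "r \<in> {a<..n}" "s \<in> {a<..n}" "r < s"
    then show "h' r < h' s"
      using 1 hr[of s] hr[of r] strict_mono_onD[OF h(1), of r s] unfolding h'_def
      by (auto split: if_splits)
  qed
  moreover have "h' ` {a<..n} \<subseteq> {b<..k}"
  proof
    fix z assume "z \<in> h' ` {a<..n}"
    then obtain i where "i \<in> {a<..n}" "z = h' i" by blast
    then show "z \<in> {b<..k}" using 1 hr[of i] unfolding h'_def by (auto split: if_splits)
  qed
  moreover have "map h' (x # xs) = ys"
  proof -
    have "map h' xs = map h xs"
      using 1(1) by (auto simp: h'_def slists_def)
    then show ?thesis using h(3) y by (simp add: h'_def)
  qed
  ultimately show ?case by blast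
qed

lemma gaps_embed_OI:
  assumes "xs \<in> slists m 0 n" "ys \<in> slists m 0 k"
    and "list_all2 (\<le>) (gaps 0 n xs) (gaps 0 k ys)"
  shows "\<exists>h \<in> OI_mor n k. map h xs = ys"
proof -
  obtain h where h: "strict_mono_on {0<..n} h" "h ` {0<..n} \<subseteq> {0<..k}" "map h xs = ys"
    using gaps_embed[OF assms(1,2) _ _ assms(3)] by auto
  have s: "{0<..n} = {1..n}" "{0<..k} = {1..k}" by auto
  have "map (restrict h {1..n}) xs = ys"
    using h(3) assms(1) by (force simp: slists_def subset_eq)
  moreover have "restrict h {1..n} \<in> OI_mor n k" using OI_morI h(1,2) unfolding s by blast
  ultimately show ?thesis by blast
qed

text \<open>
  The monomial \<open>(j, xs)\<close> in degree \<open>n\<close> is the translate of the \<open>j\<close>-th generator, of degree \<open>ms ! j\<close>,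
  by the order-preserving injection listing \<open>xs\<close>.
\<close>

definition mons :: "nat list \<Rightarrow> nat \<Rightarrow> (nat \<times> nat list) set" where
  "mons ms n = (SIGMA j:{..<length ms}. slists (ms ! j) 0 n)"

definition act :: "(nat \<Rightarrow> nat) \<Rightarrow> nat \<times> nat list \<Rightarrow> nat \<times> nat list" where
  "act h t = (fst t, map h (snd t))"

text \<open>Lists are compared lexicographically, an order that strictly increasing maps preserve.
  Monomials are compared only within one degree, where there are finitely many.\<close>

definition mless :: "nat \<times> nat list \<Rightarrow> nat \<times> nat list \<Rightarrow> bool" where
  "mless s t \<longleftrightarrow> fst s # snd s < fst t # snd t"

lemma finite_mons: "finite (mons ms n)"
  unfolding mons_def by (intro finite_SigmaI finite_slists) auto

lemma act_mons: "t \<in> mons ms m \<Longrightarrow> h \<in> OI_mor m n \<Longrightarrow> act h t \<in> mons ms n"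
  unfolding mons_def act_def using map_OI_slists by auto

lemma mless_irrefl [simp]: "\<not> mless t t"
  by (simp add: mless_def)

lemma mless_trans: "mless s t \<Longrightarrow> mless t u \<Longrightarrow> mless s u"
  by (auto simp: mless_def)

lemma mless_linear: "mless s t \<or> s = t \<or> mless t s"
  by (cases s; cases t) (auto simp: mless_def)

lemma map_OI_less:
  assumes "h \<in> OI_mor m n"
  shows "set xs \<subseteq> {1..m} \<Longrightarrow> set ys \<subseteq> {1..m} \<Longrightarrow> xs < ys \<Longrightarrow> map h xs < map h ys"
proof (induction xs arbitrary: ys)
  case Nil
  then show ?case by (cases ys) auto
next
  case (Cons x xs)
  then obtain y zs where "ys = y # zs" by (cases ys) auto
  then show ?case using Cons OI_mor_less[OF assms, of x y] by auto
qed

lemma mless_act: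
  assumes "h \<in> OI_mor m n" "s \<in> mons ms m" "t \<in> mons ms m" "mless s t"
  shows "mless (act h s) (act h t)"
  using assms map_OI_less[OF assms(1), of "snd s" "snd t"]
  by (force simp: mless_def act_def mons_def slists_def)

text \<open>For each generator index, Dickson's lemma is applied to gap vectors with a number put in
  front. The number is there for leading coefficients; a use without coefficients leaves it
  arbitrary.\<close>

lemma mons_gaps_basis:
  fixes P :: "(nat \<times> (nat \<times> nat list) \<times> nat) set"
  assumes "\<And>n t a. (n, t, a) \<in> P \<Longrightarrow> t \<in> mons ms n"
  shows "\<exists>Q. finite Q \<and> Q \<subseteq> P \<and>
    (\<forall>(k, u, b) \<in> P. \<exists>(n, t, a) \<in> Q. \<exists>h \<in> OI_mor n k. act h t = u \<and> a \<le> b)"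
proof -
  define L where "L p = (case p of (n, t, a) \<Rightarrow> a # gaps 0 n (snd t))" for p :: "nat \<times> (nat \<times> nat list) \<times> nat"
  define Pj where "Pj j = {p \<in> P. fst (fst (snd p)) = j}" for j
  have "\<exists>Q. finite Q \<and> Q \<subseteq> Pj j \<and> (\<forall>p\<in>Pj j. \<exists>q\<in>Q. list_all2 (\<le>) (L q) (L p))" for j
  proof -
    have "length a = Suc (Suc (ms ! j))" if a: "a \<in> L ` Pj j" for a
    proof -
      obtain n xs b where "(n, (j, xs), b) \<in> P" "a = b # gaps 0 n xs"
        using a by (auto simp: Pj_def L_def)
      then show ?thesis using assms[of n "(j, xs)" b] by (auto simp: mons_def slists_def)
    qed
    note dickson[OF this]
    then obtain B where B: "finite B \<and> B \<subseteq> L ` Pj j \<and> (\<forall>a\<in>L ` Pj j. \<exists>b\<in>B. list_all2 (\<le>) b a)"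
      by (rule exE)
    then obtain Q where Q: "finite Q" "Q \<subseteq> Pj j" "B = L ` Q"
      by (meson finite_subset_image)
    have "\<exists>q\<in>Q. list_all2 (\<le>) (L q) (L p)" if "p \<in> Pj j" for p
      using B Q(3) that by (metis imageE imageI)
    with Q show ?thesis by metis
  qed
  then obtain Q where Q: "\<And>j. finite (Q j)" "\<And>j. Q j \<subseteq> Pj j"
    "\<And>j p. p \<in> Pj j \<Longrightarrow> \<exists>q\<in>Q j. list_all2 (\<le>) (L q) (L p)" by metis
  show ?thesis
  proof (intro exI[of _ "\<Union>j<length ms. Q j"] conjI)
    show "finite (\<Union>j<length ms. Q j)" using Q by auto
    show "(\<Union>j<length ms. Q j) \<subseteq> P" using Q(2) by (auto simp: Pj_def)
    show "\<forall>(k, u, b) \<in> P. \<exists>(n, t, a) \<in> (\<Union>j<length ms. Q j). \<exists>h \<in> OI_mor n k. act h t = u \<and> a \<le> b"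
    proof clarify
      fix k j ys b assume p: "(k, (j, ys), b) \<in> P"
      then have j: "j < length ms" "ys \<in> slists (ms ! j) 0 k" using assms by (auto simp: mons_def)
      obtain q where q: "q \<in> Q j" "list_all2 (\<le>) (L q) (L (k, (j, ys), b))"
        using Q(3)[of "(k, (j, ys), b)" j] p by (auto simp: Pj_def)
      obtain n i xs a where qe: "q = (n, (i, xs), a)" by (cases q) auto
      have qP: "q \<in> P" "i = j" using q(1) Q(2)[of j] qe by (auto simp: Pj_def)
      then have xs: "xs \<in> slists (ms ! j) 0 n" using assms[of n "(i, xs)" a] qe by (auto simp: mons_def)
      obtain h where "h \<in> OI_mor n k" "map h xs = ys"
        using gaps_embed_OI[OF xs j(2)] q(2) by (auto simp: L_def qe)
      moreover have "a \<le> b" using q(2) by (simp add: L_def qe)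
      ultimately show "\<exists>(n, t, a) \<in> (\<Union>j<length ms. Q j). \<exists>h \<in> OI_mor n k. act h t = (j, ys) \<and> a \<le> b"
        using q(1) qe qP j(1) by (intro bexI[of _ q]) (auto simp: act_def)
    qed
  qed
qed

text \<open>For a fixed generator, closure under divisors means that the gap vectors are closed
  downwards. Counting by degree is then counting by sum, shifted by the degree of the
  generator.\<close>

lemma mons_Hilbert_function:
  assumes "\<And>n. St n \<subseteq> mons ms n"
    and "\<And>m n t h. t \<in> mons ms m \<Longrightarrow> h \<in> OI_mor m n \<Longrightarrow> act h t \<in> St n \<Longrightarrow> t \<in> St m"
  shows "eventually_polynomial (\<lambda>n. real (card (St n)))"
proof -
  define S where "S j n = {xs. (j, xs) \<in> St n}" for j n
  have S: "S j n \<subseteq> slists (ms ! j) 0 n" for j n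
    using assms(1) by (auto simp: S_def mons_def)
  have fin: "finite (S j n)" for j n using finite_subset[OF S finite_slists] .
  have "St n = (SIGMA j:{..<length ms}. S j n)" for n
    using assms(1) by (auto simp: S_def mons_def)
  then have card: "real (card (St n)) = (\<Sum>j<length ms. real (card (S j n)))" for n
    using fin by (simp add: card_SigmaI)
  have "eventually_polynomial (\<lambda>n. real (card (S j n)))" if j: "j < length ms" for j
  proof -
    define m where "m = ms ! j"
    \<comment> \<open>The degree need not be recorded: the vectors of \<open>D\<close> with sum
      \<open>n - m\<close> are exactly those that come from degree \<open>n\<close>.\<close>
    define D where "D = {g. \<exists>n. \<exists>xs\<in>S j n. g = gaps 0 n xs}"
    have len: "length g = Suc m" if "g \<in> D" for g
    proof -
      obtain n xs where "xs \<in> S j n" "g = gaps 0 n xs" using \<open>g \<in> D\<close> by (auto simp: D_def)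
      then show ?thesis using S[of j n] by (auto simp: m_def slists_def)
    qed
    have down: "b \<in> D" if a: "a \<in> D" "list_all2 (\<le>) b a" for a b
    proof -
      obtain k ys where ys: "ys \<in> S j k" "a = gaps 0 k ys" using \<open>a \<in> D\<close> by (auto simp: D_def)
      have "length b = Suc m" using len[OF a(1)] list_all2_lengthD[OF a(2)] by simp
      then obtain n xs where xs: "xs \<in> slists m 0 n" "gaps 0 n xs = b"
        using gaps_surj[of b m 0] by auto
      obtain h where h: "h \<in> OI_mor n k" "map h xs = ys"
        using gaps_embed_OI[OF xs(1), of ys k] S[of j k] ys a(2) xs(2) by (auto simp: m_def)
      have "(j, xs) \<in> St n"
        by (rule assms(2)[OF _ h(1)]) (use xs j h ys in \<open>auto simp: mons_def m_def act_def S_def\<close>)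
      then show ?thesis using xs by (auto simp: D_def S_def)
    qed
    have "card (S j n) = card {g \<in> D. sum_list g = n - m}" if "n \<ge> m" for n
    proof (rule bij_betw_same_card[of "gaps 0 n"], rule bij_betw_imageI)
      show "inj_on (gaps 0 n) (S j n)"
        using gaps_inject S[of j n] by (blast intro: inj_onI)
      show "gaps 0 n ` S j n = {g \<in> D. sum_list g = n - m}"
      proof (intro equalityI subsetI)
        fix g assume "g \<in> gaps 0 n ` S j n"
        then show "g \<in> {g \<in> D. sum_list g = n - m}"
          using sum_list_gaps[of _ m 0 n] S[of j n] by (fastforce simp: D_def m_def)
      next
        fix g assume g: "g \<in> {g \<in> D. sum_list g = n - m}"
        then obtain k xs where k: "xs \<in> S j k" "g = gaps 0 k xs" by (auto simp: D_def)
        then have "k = n" using sum_list_gaps[of xs m 0 k] S[of j k] g that by (auto simp: m_def)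
        then show "g \<in> gaps 0 n ` S j n" using k by auto
      qed
    qed
    then have "\<forall>\<^sub>F n in sequentially. real (card (S j n)) = real (card {g \<in> D. sum_list g = n - m})"
      unfolding eventually_sequentially by metis
    moreover have "eventually_polynomial (\<lambda>n. real (card {g \<in> D. sum_list g = n}))"
      using len down by (rule down_closed_Hilbert_function[of D "Suc m"])
    ultimately show ?thesis
      by (rule eventually_polynomial_cong[OF eventually_polynomial_shift, rotated])
  qed
  then show ?thesis unfolding card by (intro eventually_polynomial_sum) auto
qed

section \<open>Integer combinations and rank in commutative groups\<close>

context comm_group begin

lemma generate_insert:
  assumes "x \<in> carrier G" "A \<subseteq> carrier G" "z \<in> generate G (insert x A)"
  shows "\<exists>c::int. \<exists>l\<in>generate G A. z = x [^] c \<otimes> l"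
  using assms(3)
proof induction
  case one
  show ?case by (intro exI[of _ 0] bexI[of _ \<one>] generate.one) (auto intro: int_pow_0)
next
  case (incl h)
  then show ?case
  proof (cases "h = x")
    case True
    then show ?thesis using assms(1)
      by (intro exI[of _ 1] bexI[of _ \<one>] generate.one) (auto simp: int_pow_1)
  next
    case False
    then have "h \<in> A" using incl by auto
    then show ?thesis using assms(2)
      by (intro exI[of _ 0] bexI[of _ h] generate.incl) (auto intro: int_pow_0)
  qed
next
  case (inv h)
  then show ?case
  proof (cases "h = x")
    case True
    then show ?thesis using assms(1) int_pow_neg[of x 1]
      by (intro exI[of _ "-1"] bexI[of _ \<one>] generate.one) (auto simp: int_pow_1)
  next
    case False
    then have "h \<in> A" using inv by auto
    then show ?thesis using assms(2)
      by (intro exI[of _ 0] bexI[of _ "inv h"] generate.inv) (auto intro: int_pow_0)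
  qed
next
  case (eng h1 h2)
  then obtain c d :: int and k l where
    "h1 = x [^] c \<otimes> k" "k \<in> generate G A" "h2 = x [^] d \<otimes> l" "l \<in> generate G A" by blast
  moreover from this have "k \<in> carrier G" "l \<in> carrier G"
    using generate_in_carrier[OF assms(2)] by auto
  ultimately show ?case using assms(1)
    by (intro exI[of _ "c + d"] bexI[of _ "k \<otimes> l"] generate.eng) (auto simp: int_pow_mult m_ac)
qed

lemma finprod_generate:
  assumes "e \<in> I \<rightarrow> carrier G"
  shows "finprod G (\<lambda>i. e i [^] (c i :: int)) I \<in> generate G (e ` I)"
proof -
  have sub: "subgroup (generate G (e ` I)) G"
    by (rule generate_is_subgroup) (use assms in auto)
  have "finprod G (\<lambda>i. e i [^] (c i :: int)) J \<in> generate G (e ` I)" if "J \<subseteq> I" for J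
    using that
  proof (induction J rule: infinite_finite_induct)
    case (insert i J)
    then have "e i [^] c i \<in> generate G (e ` I)"
      by (intro subgroup_int_pow_closed[OF sub] generate.incl) auto
    then show ?case using insert assms by (auto intro!: generate.eng simp: Pi_iff subset_eq)
  qed (auto intro: generate.one)
  then show ?thesis by blast
qed

lemma generate_eq_finprod:
  assumes "e \<in> I \<rightarrow> carrier G" "finite I" "z \<in> generate G (e ` I)"
  shows "\<exists>c :: 'i \<Rightarrow> int. z = finprod G (\<lambda>i. e i [^] c i) I"
  using assms(2,1,3)
proof (induction I arbitrary: z rule: finite_induct)
  case empty
  then show ?case using generate_empty by auto
next
  case (insert i I)
  then obtain c :: int and l where l: "l \<in> generate G (e ` I)" "z = e i [^] c \<otimes> l"
    using generate_insert[of "e i" "e ` I" z] by auto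
  then obtain b where b: "l = finprod G (\<lambda>i. e i [^] (b i :: int)) I" using insert by auto
  define b' where "b' = b(i := c)"
  have "finprod G (\<lambda>i. e i [^] b' i) I = l"
    unfolding b by (rule finprod_cong') (use insert in \<open>auto simp: b'_def\<close>)
  then have "z = finprod G (\<lambda>i. e i [^] b' i) (insert i I)"
    using insert l by (subst finprod_insert) (auto simp: b'_def)
  then show ?case by blast
qed

text \<open>The elements with a positive power in \<open>H\<close> form a subgroup; for a product
  the two exponents are multiplied.\<close>

lemma generate_root_closed:
  assumes "subgroup H G" "A \<subseteq> carrier G" "\<And>x. x \<in> A \<Longrightarrow> \<exists>a>0::int. x [^] a \<in> H"
    and "z \<in> generate G A"
  shows "\<exists>a>0::int. z [^] a \<in> H"
  using assms(4)
proof induction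
  case one
  then show ?case using subgroup.one_closed[OF assms(1)] by (intro exI[of _ 1]) auto
next
  case (incl h)
  then show ?case using assms(3) by blast
next
  case (inv h)
  then obtain a :: int where "a > 0" "h [^] a \<in> H" using assms(3) by blast
  then show ?case using inv assms(2) subgroup.m_inv_closed[OF assms(1)]
    by (intro exI[of _ a]) (auto simp: int_pow_inv)
next
  case (eng h1 h2)
  then obtain a b :: int where ab: "a > 0" "h1 [^] a \<in> H" "b > 0" "h2 [^] b \<in> H" by blast
  have h: "h1 \<in> carrier G" "h2 \<in> carrier G"
    using eng generate_in_carrier[OF assms(2)] by auto
  have "(h1 \<otimes> h2) [^] (a * b) = (h1 [^] a) [^] b \<otimes> (h2 [^] b) [^] a"
    using h by (simp add: int_pow_distrib int_pow_pow mult.commute)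
  also have "\<dots> \<in> H"
    using ab subgroup.m_closed[OF assms(1)] subgroup_int_pow_closed[OF assms(1)] by blast
  finally show ?case using ab by (intro exI[of _ "a * b"]) auto
qed

definition int_independent :: "('i \<Rightarrow> 'a) \<Rightarrow> 'i set \<Rightarrow> bool" where
  "int_independent e I \<longleftrightarrow>
    (\<forall>c :: 'i \<Rightarrow> int. finprod G (\<lambda>i. e i [^] c i) I = \<one> \<longrightarrow> (\<forall>i\<in>I. c i = 0))"

text \<open>A basis of the group after tensoring with the rationals, expressed without the tensor
  product: generation is required only up to a positive power.\<close>

definition rational_basis :: "('i \<Rightarrow> 'a) \<Rightarrow> 'i set \<Rightarrow> bool" where
  "rational_basis e I \<longleftrightarrow> finite I \<and> e \<in> I \<rightarrow> carrier G \<and> int_independent e I \<and>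
    (\<forall>z\<in>carrier G. \<exists>a>0::int. z [^] a \<in> generate G (e ` I))"

text \<open>Elimination over the integers: cross-multiply with a row whose leading entry is nonzero.\<close>

lemma int_independent_card_le:
  assumes "finite E" "E \<subseteq> carrier G" "finite I" "b \<in> I \<rightarrow> generate G E" "int_independent b I"
  shows "card I \<le> card E"
  using assms
proof (induction E arbitrary: I b rule: finite_induct)
  case empty
  have "finprod G (\<lambda>i. b i [^] (1::int)) I = \<one>"
    by (rule finprod_one_eqI) (use empty generate_empty in \<open>auto simp: Pi_iff\<close>)
  then have "\<forall>i\<in>I. (1::int) = 0"
    using spec[OF empty(4)[unfolded int_independent_def], of "\<lambda>_. 1"] by simp
  then show ?case by auto
next
  case (insert x E)
  have x: "x \<in> carrier G" "E \<subseteq> carrier G" using insert by auto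
  have bG: "b i \<in> carrier G" if "i \<in> I" for i
    using insert.prems that generate_in_carrier by blast
  have "\<forall>i\<in>I. \<exists>c::int. \<exists>l\<in>generate G E. b i = x [^] c \<otimes> l"
    using generate_insert[OF x] insert.prems by blast
  then obtain a :: "_ \<Rightarrow> int" and l where al: "\<And>i. i \<in> I \<Longrightarrow> l i \<in> generate G E"
    "\<And>i. i \<in> I \<Longrightarrow> b i = x [^] a i \<otimes> l i" by metis
  have lG: "l i \<in> carrier G" if "i \<in> I" for i using al(1)[OF that] generate_in_carrier[OF x(2)] by blast
  show ?case
  proof (cases "\<forall>i\<in>I. a i = 0")
    case True
    then have "b \<in> I \<rightarrow> generate G E" using al lG by auto
    then have "card I \<le> card E" using insert by auto
    then show ?thesis using insert by simp
  next
    case False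
    then obtain r where r: "r \<in> I" "a r \<noteq> 0" by blast
    \<comment> \<open>The exponents of \<open>x\<close> cancel, so \<open>b' i\<close> lies in the
      group generated by \<open>E\<close> alone.\<close>
    define b' where "b' i = b i [^] a r \<otimes> b r [^] (- a i)" for i
    have b'l: "b' i = l i [^] a r \<otimes> l r [^] (- a i)" if "i \<in> I" for i
    proof -
      have "b' i = (x [^] (a i * a r) \<otimes> x [^] (a r * (- a i))) \<otimes> (l i [^] a r \<otimes> l r [^] (- a i))"
        unfolding b'_def using that r al(2) lG x by (simp add: int_pow_distrib int_pow_pow m_ac)
      also have "x [^] (a i * a r) \<otimes> x [^] (a r * (- a i)) = \<one>"
        using x by (simp flip: int_pow_mult)
      finally show ?thesis using lG that r by simp
    qed
    have sub: "subgroup (generate G E) G" using generate_is_subgroup x by blast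
    have b': "b' \<in> I - {r} \<rightarrow> generate G E"
      using b'l al(1) r subgroup_int_pow_closed[OF sub] by (auto intro!: generate.eng)
    have b'G: "b' i \<in> carrier G" if "i \<in> I" for i unfolding b'_def using bG that r by auto
    have "int_independent b' (I - {r})"
      unfolding int_independent_def
    proof (intro allI impI)
      fix c :: "_ \<Rightarrow> int"
      assume c: "finprod G (\<lambda>i. b' i [^] c i) (I - {r}) = \<one>"
      \<comment> \<open>A relation \<open>c\<close> among the \<open>b' i\<close> is the relation
        \<open>d\<close> among the \<open>b i\<close>: the powers of \<open>b r\<close> collect in
        \<open>s\<close>, and the other exponents are scaled by the nonzero
        \<open>a r\<close>.\<close>
      define s where "s = (\<Sum>i\<in>I - {r}. - a i * c i)"
      define d where "d i = (if i = r then s else a r * c i)" for i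
      have "finprod G (\<lambda>i. b r [^] (- a i * c i)) J = b r [^] (\<Sum>i\<in>J. - a i * c i)" if "J \<subseteq> I - {r}" for J
        using finite_subset[OF that] that insert.prems(2)
      proof (induction J rule: infinite_finite_induct)
        case (insert i J)
        then show ?case using bG r by (subst finprod_insert) (auto simp flip: int_pow_mult)
      qed auto
      then have s: "finprod G (\<lambda>i. b r [^] (- a i * c i)) (I - {r}) = b r [^] s" by (simp add: s_def)
      have "finprod G (\<lambda>i. b i [^] d i) I = b r [^] d r \<otimes> finprod G (\<lambda>i. b i [^] d i) (I - {r})"
        using finprod_insert[of "I - {r}" r "\<lambda>i. b i [^] d i"] insert.prems(2) bG r
        by (auto simp: insert_absorb Pi_iff)
      also have "finprod G (\<lambda>i. b i [^] d i) (I - {r}) = finprod G (\<lambda>i. b i [^] (a r * c i)) (I - {r})"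
        by (rule finprod_cong') (use bG in \<open>auto simp: d_def\<close>)
      also have "b r [^] d r \<otimes> \<dots> = finprod G (\<lambda>i. b r [^] (- a i * c i) \<otimes> b i [^] (a r * c i)) (I - {r})"
        using bG r s by (subst finprod_multf) (auto simp: d_def)
      also have "\<dots> = finprod G (\<lambda>i. b' i [^] c i) (I - {r})"
        by (rule finprod_cong')
          (use bG r in \<open>auto simp: b'_def int_pow_distrib int_pow_pow m_ac\<close>)
      finally have "finprod G (\<lambda>i. b i [^] d i) I = \<one>" using c by simp
      then have d: "d i = 0" if "i \<in> I" for i
        using that insert.prems(4) unfolding int_independent_def by blast
      show "\<forall>i\<in>I - {r}. c i = 0"
      proof
        fix i assume "i \<in> I - {r}"
        then show "c i = 0" using d[of i] r(2) by (simp add: d_def)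
      qed
    qed
    then have "card (I - {r}) \<le> card E"
      using insert.IH[OF x(2), of "I - {r}" b'] insert.prems(2) b' by simp
    then show ?thesis using insert r by (simp add: card_Diff_singleton)
  qed
qed

end

lemma hom_finprod_int_pow:
  assumes "comm_group G" "comm_group H" "h \<in> hom G H" "e \<in> I \<rightarrow> carrier G"
  shows "h (finprod G (\<lambda>i. e i [^]\<^bsub>G\<^esub> (c i :: int)) I)
    = finprod H (\<lambda>i. h (e i) [^]\<^bsub>H\<^esub> c i) I"
proof -
  interpret G: comm_group G by fact
  interpret H: comm_group H by fact
  interpret group_hom G H h by unfold_locales fact
  show ?thesis using assms(4)
  proof (induction I rule: infinite_finite_induct)
    case (insert i I)
    then have "(\<lambda>i. e i [^]\<^bsub>G\<^esub> c i) \<in> I \<rightarrow> carrier G" "(\<lambda>i. h (e i) [^]\<^bsub>H\<^esub> c i) \<in> I \<rightarrow> carrier H"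
      "e i \<in> carrier G" by (auto simp: Pi_iff)
    then show ?case using insert by (simp add: hom_int_pow)
  qed auto
qed

lemma int_independent_hom_preimage:
  assumes "comm_group G" "comm_group H" "h \<in> hom G H" "e \<in> I \<rightarrow> carrier G"
    and "comm_group.int_independent H (h \<circ> e) I"
  shows "comm_group.int_independent G e I"
proof -
  interpret G: comm_group G by fact
  interpret H: comm_group H by fact
  interpret group_hom G H h by unfold_locales fact
  show ?thesis
    unfolding G.int_independent_def
  proof (intro allI impI)
    fix c :: "_ \<Rightarrow> int"
    assume "finprod G (\<lambda>i. e i [^]\<^bsub>G\<^esub> c i) I = \<one>\<^bsub>G\<^esub>"
    then have "finprod H (\<lambda>i. h (e i) [^]\<^bsub>H\<^esub> c i) I = \<one>\<^bsub>H\<^esub>"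
      by (subst hom_finprod_int_pow[OF assms(1-4), symmetric]) simp
    then show "\<forall>i\<in>I. c i = 0" using assms(5) unfolding H.int_independent_def by (auto simp: comp_def)
  qed
qed

lemma int_independent_hom_image:
  assumes "comm_group G" "comm_group H" "h \<in> hom G H" "inj_on h (carrier G)" "e \<in> I \<rightarrow> carrier G"
    and "comm_group.int_independent G e I"
  shows "comm_group.int_independent H (h \<circ> e) I"
proof -
  interpret G: comm_group G by fact
  interpret H: comm_group H by fact
  interpret group_hom G H h by unfold_locales fact
  show ?thesis
    unfolding H.int_independent_def
  proof (intro allI impI)
    fix c :: "_ \<Rightarrow> int"
    assume "finprod H (\<lambda>i. (h \<circ> e) i [^]\<^bsub>H\<^esub> c i) I = \<one>\<^bsub>H\<^esub>"
    then have "h (finprod G (\<lambda>i. e i [^]\<^bsub>G\<^esub> c i) I) = h \<one>\<^bsub>G\<^esub>"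
      by (subst hom_finprod_int_pow[OF assms(1-3,5)]) (simp add: comp_def)
    then have "finprod G (\<lambda>i. e i [^]\<^bsub>G\<^esub> c i) I = \<one>\<^bsub>G\<^esub>"
      by (rule inj_onD[OF assms(4)]) (use assms(5) in \<open>auto intro!: G.finprod_closed simp: Pi_iff\<close>)
    then show "\<forall>i\<in>I. c i = 0" using assms(6) unfolding G.int_independent_def by blast
  qed
qed

text \<open>List entries are numbered from 0, the points of \<open>[m]\<close> from 1.\<close>

definition inj_of :: "nat list \<Rightarrow> nat \<Rightarrow> nat" where
  "inj_of xs = (\<lambda>k\<in>{1..length xs}. xs ! (k - 1))"

lemma inj_of_OI:
  assumes "xs \<in> slists m 0 n"
  shows "inj_of xs \<in> OI_mor m n"
proof -
  have len: "length xs = m" and "sorted_wrt (<) xs" and sub: "set xs \<subseteq> {0<..n}"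
    using assms by (auto simp: slists_def)
  have "strict_mono_on {1..m} (\<lambda>k. xs ! (k - 1))"
    by (rule strict_mono_onI) (use len \<open>sorted_wrt (<) xs\<close> in \<open>auto simp: sorted_wrt_iff_nth_less\<close>)
  moreover have "xs ! (k - 1) \<in> {1..n}" if "k \<in> {1..m}" for k
  proof -
    have "xs ! (k - 1) \<in> set xs" using that len by (intro nth_mem) auto
    then show ?thesis using sub by auto
  qed
  ultimately show ?thesis unfolding inj_of_def len by (intro OI_morI) blast+
qed

lemma OI_mor_eq_inj_of:
  assumes "f \<in> OI_mor m n"
  shows "\<exists>xs\<in>slists m 0 n. f = inj_of xs"
proof (rule bexI[of _ "map f [1..<Suc m]"])
  have "f \<in> extensional {1..m}" using assms by (auto simp: OI_mor_def FI_mor_def PiE_def)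
  then show "f = inj_of (map f [1..<Suc m])"
    by (auto simp: inj_of_def extensional_def fun_eq_iff simp del: upt_Suc)
  have "sorted_wrt (\<lambda>x y. f x < f y) [1..<Suc m]"
    by (rule sorted_wrt_mono_rel[of _ "(<)"])
      (auto intro!: OI_mor_less[OF assms] simp del: upt_Suc)
  moreover have "f k \<in> {0<..n}" if "k \<in> {1..m}" for k using OI_mor_range[OF assms that] by auto
  ultimately show "map f [1..<Suc m] \<in> slists m 0 n"
    by (auto simp: slists_def sorted_wrt_map simp del: upt_Suc)
qed

lemma compose_inj_of: "compose {1..length xs} h (inj_of xs) = inj_of (map h xs)"
  by (auto simp: compose_def inj_of_def fun_eq_iff)

section \<open>OI-modules and their monomial filtration\<close>

definition translates ::
    "(nat \<Rightarrow> nat \<Rightarrow> (nat \<Rightarrow> nat) \<Rightarrow> 'a \<Rightarrow> 'a) \<Rightarrow> (nat \<times> 'a) set \<Rightarrow> nat \<Rightarrow> 'a set" where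
  "translates F S n = {F m n f x | m x f. (m, x) \<in> S \<and> f \<in> OI_mor m n}"

locale OI_module =
  fixes M :: "nat \<Rightarrow> 'a monoid" and F :: "nat \<Rightarrow> nat \<Rightarrow> (nat \<Rightarrow> nat) \<Rightarrow> 'a \<Rightarrow> 'a"
  assumes comm_group: "comm_group (M n)"
    and hom: "f \<in> OI_mor m n \<Longrightarrow> F m n f \<in> hom (M m) (M n)"
    and compose: "f \<in> OI_mor l m \<Longrightarrow> g \<in> OI_mor m n \<Longrightarrow> x \<in> carrier (M l) \<Longrightarrow>
      F l n (compose {1..l} g f) x = F m n g (F l m f x)"
begin

sublocale M: comm_group "M n" for n by (rule comm_group)

lemma group_hom: "f \<in> OI_mor m n \<Longrightarrow> group_hom (M m) (M n) (F m n f)"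
  by unfold_locales (rule hom)

lemma closed: "f \<in> OI_mor m n \<Longrightarrow> x \<in> carrier (M m) \<Longrightarrow> F m n f x \<in> carrier (M n)"
  by (rule hom_in_carrier[OF hom])

lemma translates_closed:
  assumes "S \<subseteq> (SIGMA n:UNIV. carrier (M n))"
  shows "translates F S n \<subseteq> carrier (M n)"
  using assms by (auto simp: translates_def intro!: closed)

end

text \<open>The generators form a list so that a monomial can name its generator by position and be
  ordered by it.\<close>

locale OI_module_gens = OI_module M F for M :: "nat \<Rightarrow> 'a monoid" and F +
  fixes gs :: "(nat \<times> 'a) list"
  assumes gs: "set gs \<subseteq> (SIGMA n:UNIV. carrier (M n))"
    and generates: "carrier (M n) \<subseteq> generate (M n) (translates F (set gs) n)"
begin

abbreviation "Mon \<equiv> mons (map fst gs)"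

text \<open>The image of a monomial under the map from the free module on \<open>gs\<close>.
  Distinct monomials may have equal images, so all bookkeeping is by monomials.\<close>

definition el :: "nat \<Rightarrow> nat \<times> nat list \<Rightarrow> 'a" where
  "el n t = F (fst (gs ! fst t)) n (inj_of (snd t)) (snd (gs ! fst t))"

text \<open>The substitute for leading terms: an element has leading monomial \<open>t\<close> and
  coefficient \<open>a\<close> if it is the \<open>a\<close>-th power of \<open>el n t\<close> times
  something in \<open>below n t\<close>. The coefficient is not determined by the element, because
  \<open>M n\<close> need not be free.\<close>

definition below :: "nat \<Rightarrow> nat \<times> nat list \<Rightarrow> 'a set" where
  "below n t = generate (M n) (el n ` {s \<in> Mon n. mless s t})"

lemma el_closed: "t \<in> Mon n \<Longrightarrow> el n t \<in> carrier (M n)"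
  unfolding el_def using gs nth_mem[of "fst t" gs]
  by (auto intro!: closed inj_of_OI simp: mons_def subset_eq Ball_def)

lemma el_image_closed: "A \<subseteq> Mon n \<Longrightarrow> el n ` A \<subseteq> carrier (M n)"
  using el_closed by blast

lemma F_el:
  assumes "h \<in> OI_mor m n" "t \<in> Mon m"
  shows "F m n h (el m t) = el n (act h t)"
proof -
  obtain j xs where t: "t = (j, xs)" by (cases t)
  have j: "j < length gs" "xs \<in> slists (fst (gs ! j)) 0 m" "length xs = fst (gs ! j)"
    using assms(2) by (auto simp: t mons_def slists_def)
  have "snd (gs ! j) \<in> carrier (M (fst (gs ! j)))"
    using gs nth_mem[OF j(1)] by (cases "gs ! j") auto
  then show ?thesis
    using compose[OF inj_of_OI[OF j(2)] assms(1)] compose_inj_of[of xs h] j(3)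
    by (simp add: el_def t act_def)
qed

lemma translates_el: "translates F (set gs) n = el n ` Mon n"
proof (intro equalityI subsetI)
  fix y assume "y \<in> translates F (set gs) n"
  then obtain m x f where f: "(m, x) \<in> set gs" "f \<in> OI_mor m n" "y = F m n f x"
    by (auto simp: translates_def)
  then obtain j where j: "j < length gs" "gs ! j = (m, x)" by (auto simp: in_set_conv_nth)
  obtain xs where xs: "xs \<in> slists m 0 n" "f = inj_of xs" using OI_mor_eq_inj_of[OF f(2)] by blast
  have "y = el n (j, xs)" "(j, xs) \<in> Mon n" using f j xs by (auto simp: el_def mons_def)
  then show "y \<in> el n ` Mon n" by blast
next
  fix y assume "y \<in> el n ` Mon n"
  then obtain j xs where j: "y = el n (j, xs)" "j < length gs" "xs \<in> slists (fst (gs ! j)) 0 n"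
    by (auto simp: mons_def)
  have "(fst (gs ! j), snd (gs ! j)) \<in> set gs" using j(2) by simp
  then show "y \<in> translates F (set gs) n"
    using j(1) inj_of_OI[OF j(3)] unfolding translates_def el_def by fastforce
qed

lemma generate_Mon: "carrier (M n) = generate (M n) (el n ` Mon n)"
  using generates[of n] M.generate_incl[OF el_image_closed[OF order_refl]] translates_el[of n] by auto

lemma below_subgroup: "subgroup (below n t) (M n)"
  unfolding below_def by (rule M.generate_is_subgroup) (auto simp: el_closed)

lemma below_closed: "x \<in> below n t \<Longrightarrow> x \<in> carrier (M n)"
  using below_subgroup subgroup.subset by blast

lemma F_below:
  assumes "h \<in> OI_mor m n" "t \<in> Mon m" "x \<in> below m t"
  shows "F m n h x \<in> below n (act h t)"
proof -
  interpret h: group_hom "M m" "M n" "F m n h" by (rule group_hom) fact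
  have "F m n h x \<in> generate (M n) (F m n h ` el m ` {s \<in> Mon m. mless s t})"
    using assms(3) unfolding below_def
    by (subst h.generate_img) (auto simp: el_closed)
  also have "F m n h ` el m ` {s \<in> Mon m. mless s t} \<subseteq> el n ` {s \<in> Mon n. mless s (act h t)}"
    using F_el[OF assms(1)] act_mons[OF _ assms(1)] mless_act[OF assms(1) _ assms(2)] by auto
  then have "generate (M n) (F m n h ` el m ` {s \<in> Mon m. mless s t}) \<subseteq> below n (act h t)"
    unfolding below_def by (rule M.mono_generate)
  finally show ?thesis .
qed

definition initial :: "nat \<Rightarrow> (nat \<times> nat list) set \<Rightarrow> bool" where
  "initial n A \<longleftrightarrow> A \<subseteq> Mon n \<and> (\<forall>s\<in>Mon n. \<forall>t\<in>A. mless s t \<longrightarrow> s \<in> A)"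

lemma ex_max_mless:
  assumes "finite A" "A \<noteq> {}"
  shows "\<exists>t\<in>A. \<forall>s\<in>A. s \<noteq> t \<longrightarrow> mless s t"
proof -
  have "Max ((\<lambda>t. fst t # snd t) ` A) \<in> (\<lambda>t. fst t # snd t) ` A" using assms by (intro Max_in) auto
  then obtain t where t: "t \<in> A" "Max ((\<lambda>t. fst t # snd t) ` A) = fst t # snd t" by auto
  have "fst s # snd s \<le> fst t # snd t" if "s \<in> A" for s
    unfolding t(2)[symmetric] by (rule Max_ge) (use assms(1) that in auto)
  then have "\<not> mless t s" if "s \<in> A" for s using that unfolding mless_def using leD by blast
  then show ?thesis using t(1) mless_linear by blast
qed

text \<open>Removing the largest monomial \<open>t\<close> from a down-closed set leaves exactly the
  monomials below \<open>t\<close>, so the induction only meets sets of that form.\<close>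

lemma initial_induct [consumes 1, case_names empty insert]:
  assumes "initial n A" "P {}"
    and "\<And>t. t \<in> Mon n \<Longrightarrow> P {s \<in> Mon n. mless s t} \<Longrightarrow> P (insert t {s \<in> Mon n. mless s t})"
  shows "P A"
  using assms(1)
proof (induction "card A" arbitrary: A)
  case 0
  then have "A = {}" using finite_subset[OF _ finite_mons] by (auto simp: initial_def)
  then show ?case using assms(2) by simp
next
  case (Suc k)
  have fin: "finite A" using Suc.prems finite_subset[OF _ finite_mons] by (auto simp: initial_def)
  then obtain t where t: "t \<in> A" "\<forall>s\<in>A. s \<noteq> t \<longrightarrow> mless s t"
    using ex_max_mless[of A] Suc.hyps(2) by fastforce
  have A: "A - {t} = {s \<in> Mon n. mless s t}"
    using t Suc.prems by (auto simp: initial_def)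
  have "initial n {s \<in> Mon n. mless s t}" by (auto simp: initial_def intro: mless_trans)
  then have "P {s \<in> Mon n. mless s t}"
    using Suc.hyps t fin by (metis A card_Diff_singleton diff_Suc_1)
  then have "P (insert t {s \<in> Mon n. mless s t})"
    using assms(3)[of t] t Suc.prems by (auto simp: initial_def)
  then show ?case using A t(1) by (metis insert_Diff)
qed

lemma initial_Mon: "initial n (Mon n)"
  by (simp add: initial_def)

text \<open>
  The smallest positive leading coefficient at each monomial divides all the others, and it can only
  decrease under the action.
\<close>

lemma noetherian:
  assumes sub: "\<And>n. subgroup (N n) (M n)"
    and inv: "\<And>m n h x. h \<in> OI_mor m n \<Longrightarrow> x \<in> N m \<Longrightarrow> F m n h x \<in> N n"
  shows "\<exists>S. finite S \<and> S \<subseteq> (SIGMA n:UNIV. N n) \<and> (\<forall>n. N n \<subseteq> generate (M n) (translates F S n))"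
proof -
  \<comment> \<open>Only the smallest leading coefficient at each monomial enters \<open>P\<close>.
    Dickson's lemma picks finitely many triples below all others, and elements of \<open>N\<close>
    realising them will be the generators.\<close>
  define lead where "lead n t a \<longleftrightarrow> 0 < a \<and> (\<exists>l\<in>below n t. el n t [^]\<^bsub>M n\<^esub> int a \<otimes>\<^bsub>M n\<^esub> l \<in> N n)"
    for n t and a :: nat
  define P where "P = {(n, t, a). t \<in> Mon n \<and> lead n t a \<and> (\<forall>b. lead n t b \<longrightarrow> a \<le> b)}"
  obtain Q where Q: "finite Q" "Q \<subseteq> P"
    "\<forall>(k, u, b) \<in> P. \<exists>(n, t, a) \<in> Q. \<exists>h \<in> OI_mor n k. act h t = u \<and> a \<le> b"
    using mons_gaps_basis[of P "map fst gs"] unfolding P_def by blast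
  have "\<forall>p\<in>Q. \<exists>l. case p of (n, t, a) \<Rightarrow> l \<in> below n t \<and> el n t [^]\<^bsub>M n\<^esub> int a \<otimes>\<^bsub>M n\<^esub> l \<in> N n"
    using Q(2) by (force simp: P_def lead_def)
  from bchoice[OF this] obtain L where L0: "\<forall>p\<in>Q. case p of (n, t, a) \<Rightarrow>
      L p \<in> below n t \<and> el n t [^]\<^bsub>M n\<^esub> int a \<otimes>\<^bsub>M n\<^esub> L p \<in> N n" ..
  have L: "L (n, t, a) \<in> below n t \<and> el n t [^]\<^bsub>M n\<^esub> int a \<otimes>\<^bsub>M n\<^esub> L (n, t, a) \<in> N n"
    if "(n, t, a) \<in> Q" for n t a using bspec[OF L0 that] by simp
  define S where "S = (\<lambda>(n, t, a). (n, el n t [^]\<^bsub>M n\<^esub> int a \<otimes>\<^bsub>M n\<^esub> L (n, t, a))) ` Q"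
  have S: "S \<subseteq> (SIGMA n:UNIV. N n)" using L by (auto simp: S_def)
  have NM: "N n \<subseteq> carrier (M n)" for n using sub subgroup.subset by blast
  have "N n \<subseteq> generate (M n) (translates F S n)" for n
  proof -
    have tr: "translates F S n \<subseteq> carrier (M n)" by (rule translates_closed) (use S NM in auto)
    have trN: "subgroup (generate (M n) (translates F S n)) (M n)" by (rule M.generate_is_subgroup[OF tr])
    have "N n \<inter> generate (M n) (el n ` A) \<subseteq> generate (M n) (translates F S n)" if "initial n A" for A
      using that
    proof (induction rule: initial_induct)
      case empty
      show ?case using M.generate_empty[of n] generate.one[of "M n"] by auto
    next
      case (insert t)
      show ?case
      proof
        fix z assume z: "z \<in> N n \<inter> generate (M n) (el n ` insert t {s \<in> Mon n. mless s t})"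
        note t = el_closed[OF insert(1)]
        have "el n ` {s \<in> Mon n. mless s t} \<subseteq> carrier (M n)" by (rule el_image_closed) auto
        moreover have "z \<in> generate (M n) (insert (el n t) (el n ` {s \<in> Mon n. mless s t}))"
          using z by simp
        ultimately have "\<exists>c::int. \<exists>l\<in>below n t. z = el n t [^]\<^bsub>M n\<^esub> c \<otimes>\<^bsub>M n\<^esub> l"
          unfolding below_def by (rule M.generate_insert[OF t])
        then obtain c :: int and l where l: "l \<in> below n t" "z = el n t [^]\<^bsub>M n\<^esub> c \<otimes>\<^bsub>M n\<^esub> l"
          by blast
        have IH: "w \<in> generate (M n) (translates F S n)" if "w \<in> N n" "w \<in> below n t" for w
          using insert(2) that unfolding below_def by blast
        have lead: "lead n t (nat b)"
          if "0 < b" "k \<in> below n t" "el n t [^]\<^bsub>M n\<^esub> b \<otimes>\<^bsub>M n\<^esub> k \<in> N n" for b k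
          using that unfolding lead_def by auto
        show "z \<in> generate (M n) (translates F S n)"
        proof (cases "c = 0")
          case True
          then have "z = l" using l t below_closed by (simp add: int_pow_0)
          then show ?thesis using IH l z by auto
        next
          case False
          have "\<exists>a. lead n t a"
          proof (cases "c > 0")
            case True
            then show ?thesis using lead[of c l] l z by blast
          next
            case neg: False
            \<comment> \<open>A negative leading exponent becomes positive after inverting the
              element.\<close>
            have "inv\<^bsub>M n\<^esub> z = el n t [^]\<^bsub>M n\<^esub> (- c) \<otimes>\<^bsub>M n\<^esub> inv\<^bsub>M n\<^esub> l"
              using l t below_closed by (simp add: M.inv_mult M.int_pow_neg)
            moreover have "inv\<^bsub>M n\<^esub> z \<in> N n" using z sub subgroup.m_inv_closed by fastforce
            moreover have "inv\<^bsub>M n\<^esub> l \<in> below n t" using l below_subgroup subgroup.m_inv_closed by fastforce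
            ultimately show ?thesis using lead[of "- c" "inv\<^bsub>M n\<^esub> l"] neg False by auto
          qed
          then obtain a where a: "lead n t a" "\<And>b. lead n t b \<Longrightarrow> a \<le> b"
            by (metis LeastI Least_le)
          then have "(n, t, a) \<in> P" using insert(1) by (simp add: P_def)
          then obtain m s b h where q: "(m, s, b) \<in> Q" "h \<in> OI_mor m n" "act h s = t" "b \<le> a"
            using Q(3) by blast
          then have s: "s \<in> Mon m" "0 < b" using Q(2) by (auto simp: P_def lead_def)
          interpret h: group_hom "M m" "M n" "F m n h" by (rule group_hom) fact
          define y where "y = el m s [^]\<^bsub>M m\<^esub> int b \<otimes>\<^bsub>M m\<^esub> L (m, s, b)"
          define k where "k = F m n h (L (m, s, b))"
          have Lc: "L (m, s, b) \<in> below m s" "y \<in> N m" using L[OF q(1)] by (auto simp: y_def)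
          have k: "k \<in> below n t" unfolding k_def using F_below[OF q(2) s(1) Lc(1)] q(3) by simp
          have hy: "F m n h y = el n t [^]\<^bsub>M n\<^esub> int b \<otimes>\<^bsub>M n\<^esub> k"
            unfolding y_def k_def using Lc below_closed el_closed[OF s(1)] F_el[OF q(2) s(1)] q(3)
            by (simp add: h.hom_int_pow del: int_pow_int)
          have hyN: "F m n h y \<in> N n" using inv q(2) Lc by blast
          \<comment> \<open>The translate of \<open>y\<close> has leading monomial \<open>t\<close>
            and coefficient \<open>b\<close>, so the minimality of \<open>a\<close> turns
            \<open>b \<le> a\<close> into an equality.\<close>
          have "lead n t (nat (int b))" by (rule lead[of _ k]) (use s k hy hyN in auto)
          then have ba: "b = a" using a(2) q(4) by fastforce
          \<comment> \<open>Division with remainder: removing the \<open>e\<close>-th power of the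
            translate leaves the leading coefficient \<open>r < b\<close>, and minimality forces it
            to be 0.\<close>
          define r where "r = c mod int b"
          define e where "e = c div int b"
          define w where "w = z \<otimes>\<^bsub>M n\<^esub> F m n h y [^]\<^bsub>M n\<^esub> (- e)"
          have wN: "w \<in> N n" unfolding w_def
            using z hyN sub M.subgroup_int_pow_closed[OF sub] subgroup.m_closed by fastforce
          define l' where "l' = l \<otimes>\<^bsub>M n\<^esub> k [^]\<^bsub>M n\<^esub> (- e)"
          have l': "l' \<in> below n t" unfolding l'_def
            using l k M.subgroup_int_pow_closed[OF below_subgroup] subgroup.m_closed[OF below_subgroup] by blast
          have "w = (el n t [^]\<^bsub>M n\<^esub> c \<otimes>\<^bsub>M n\<^esub> el n t [^]\<^bsub>M n\<^esub> (int b * - e)) \<otimes>\<^bsub>M n\<^esub> l'"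
            unfolding w_def l'_def hy using l k t below_closed
            by (simp add: M.int_pow_distrib M.int_pow_pow M.m_ac del: int_pow_int)
          also have "el n t [^]\<^bsub>M n\<^esub> c \<otimes>\<^bsub>M n\<^esub> el n t [^]\<^bsub>M n\<^esub> (int b * - e) = el n t [^]\<^bsub>M n\<^esub> r"
            unfolding M.int_pow_mult[OF t, symmetric] r_def e_def
            by (simp add: minus_mult_div_eq_mod)
          finally have w: "w = el n t [^]\<^bsub>M n\<^esub> r \<otimes>\<^bsub>M n\<^esub> l'" .
          have r: "0 \<le> r" "r < int b" using s by (auto simp: r_def)
          have "r = 0"
          proof (rule ccontr)
            assume "r \<noteq> 0"
            then have "lead n t (nat r)" using lead[of r l'] w wN l' r by simp
            then show False using a(2)[of "nat r"] r ba by auto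
          qed
          then have "w = l'" using w l' below_closed by (simp add: int_pow_0)
          then have wg: "w \<in> generate (M n) (translates F S n)" using IH wN l' by simp
          have "F m n h y \<in> translates F S n"
            using q(1,2) unfolding translates_def S_def y_def by force
          then have hg: "F m n h y \<in> generate (M n) (translates F S n)" by (rule generate.incl)
          have "z = w \<otimes>\<^bsub>M n\<^esub> F m n h y [^]\<^bsub>M n\<^esub> e"
            unfolding w_def using z hyN NM[of n] by (auto simp: M.int_pow_neg M.m_assoc subset_eq)
          then show ?thesis
            using wg M.subgroup_int_pow_closed[OF trN hg] by (simp add: generate.eng)
        qed
      qed
    qed
    from this[OF initial_Mon] show ?thesis using NM generate_Mon by blast
  qed
  then show ?thesis using S Q(1) by (intro exI[of _ S]) (auto simp: S_def)
qed

text \<open>The monomials that lead no relation. A relation counts as soon as some positive power of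
  \<open>el n t\<close> reduces to smaller monomials, which makes the count blind to
  torsion.\<close>

definition standard :: "nat \<Rightarrow> (nat \<times> nat list) set" where
  "standard n = {t \<in> Mon n. \<forall>a>0::int. el n t [^]\<^bsub>M n\<^esub> a \<notin> below n t}"

text \<open>The filtration is preserved by \<open>h\<close>, so a reduction at \<open>t\<close> is
  carried to a reduction at \<open>act h t\<close>.\<close>

lemma standard_act:
  assumes "t \<in> Mon m" "h \<in> OI_mor m n" "act h t \<in> standard n"
  shows "t \<in> standard m"
proof -
  interpret h: group_hom "M m" "M n" "F m n h" by (rule group_hom) fact
  have "el n (act h t) [^]\<^bsub>M n\<^esub> a \<in> below n (act h t)" if "el m t [^]\<^bsub>M m\<^esub> a \<in> below m t" for a :: int
    using F_below[OF assms(2,1) that] h.hom_int_pow[OF el_closed[OF assms(1)]] F_el[OF assms(2,1)] by simp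
  then show ?thesis using assms unfolding standard_def by blast
qed

lemma standard_eventually_polynomial: "eventually_polynomial (\<lambda>n. real (card (standard n)))"
  by (rule mons_Hilbert_function[of _ "map fst gs"])
    (use standard_act in \<open>auto simp: standard_def\<close>)

text \<open>In a nontrivial relation, the largest monomial with nonzero exponent would have a
  positive power in the span of the smaller ones, after an inversion if the exponent is
  negative.\<close>

lemma standard_independent: "M.int_independent n (el n) (standard n)"
  unfolding M.int_independent_def
proof (intro allI impI)
  fix c :: "_ \<Rightarrow> int"
  assume c: "finprod (M n) (\<lambda>t. el n t [^]\<^bsub>M n\<^esub> c t) (standard n) = \<one>\<^bsub>M n\<^esub>"
  have St: "standard n \<subseteq> Mon n" by (auto simp: standard_def)
  have fin: "finite (standard n)" using finite_subset[OF St finite_mons] .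
  show "\<forall>t\<in>standard n. c t = 0"
  proof (rule ccontr)
    assume "\<not> (\<forall>t\<in>standard n. c t = 0)"
    then have "{t \<in> standard n. c t \<noteq> 0} \<noteq> {}" by blast
    then obtain t where t: "t \<in> standard n" "c t \<noteq> 0"
      and max: "\<And>s. s \<in> standard n \<Longrightarrow> c s \<noteq> 0 \<Longrightarrow> s \<noteq> t \<Longrightarrow> mless s t"
      using ex_max_mless[of "{t \<in> standard n. c t \<noteq> 0}"] fin by auto
    define B where "B = {s \<in> standard n. mless s t}"
    have cl: "(\<lambda>t. el n t [^]\<^bsub>M n\<^esub> c t) \<in> A \<rightarrow> carrier (M n)" if "A \<subseteq> standard n" for A
      using that St el_closed by blast
    have tc: "el n t \<in> carrier (M n)" using t St el_closed by blast
    have c0: "c s = 0" if "s \<in> standard n - insert t B" for s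
      using that max[of s] by (auto simp: B_def)
    have "finprod (M n) (\<lambda>t. el n t [^]\<^bsub>M n\<^esub> c t) (standard n)
        = finprod (M n) (\<lambda>t. el n t [^]\<^bsub>M n\<^esub> c t) (insert t B)"
      by (rule M.finprod_mono_neutral_cong_right)
        (use t(1) fin cl[OF order_refl] in \<open>auto simp: B_def int_pow_0 dest!: c0[unfolded B_def, simplified]\<close>)
    also have "\<dots> = el n t [^]\<^bsub>M n\<^esub> c t \<otimes>\<^bsub>M n\<^esub> finprod (M n) (\<lambda>t. el n t [^]\<^bsub>M n\<^esub> c t) B"
      by (rule M.finprod_insert) (use fin cl[of B] tc in \<open>auto simp: B_def\<close>)
    finally have eq: "el n t [^]\<^bsub>M n\<^esub> c t \<otimes>\<^bsub>M n\<^esub> finprod (M n) (\<lambda>t. el n t [^]\<^bsub>M n\<^esub> c t) B = \<one>\<^bsub>M n\<^esub>"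
      using c by simp
    have fc: "finprod (M n) (\<lambda>t. el n t [^]\<^bsub>M n\<^esub> c t) B \<in> carrier (M n)"
      using cl[of B] by (auto simp: B_def)
    have fB: "finprod (M n) (\<lambda>t. el n t [^]\<^bsub>M n\<^esub> c t) B \<in> below n t"
    proof -
      have "finprod (M n) (\<lambda>t. el n t [^]\<^bsub>M n\<^esub> c t) B \<in> generate (M n) (el n ` B)"
        by (rule M.finprod_generate) (use St el_closed in \<open>auto simp: B_def\<close>)
      also have "\<dots> \<subseteq> below n t" unfolding below_def
        by (rule M.mono_generate) (use St in \<open>auto simp: B_def\<close>)
      finally show ?thesis .
    qed
    have "el n t [^]\<^bsub>M n\<^esub> c t = inv\<^bsub>M n\<^esub> finprod (M n) (\<lambda>t. el n t [^]\<^bsub>M n\<^esub> c t) B"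
      using eq tc fc by (metis M.int_pow_closed M.inv_equality)
    then have 1: "el n t [^]\<^bsub>M n\<^esub> c t \<in> below n t"
      using subgroup.m_inv_closed[OF below_subgroup fB] by simp
    then have 2: "el n t [^]\<^bsub>M n\<^esub> (- c t) \<in> below n t"
      using subgroup.m_inv_closed[OF below_subgroup 1] tc by (simp add: M.int_pow_neg)
    show False using 1 2 t unfolding standard_def by (cases "c t > 0") auto
  qed
qed

text \<open>Spanning up to powers goes upwards in the monomial order: a nonstandard monomial has a
  positive power in the span of smaller ones, and these already have positive powers in
  \<open>H\<close>.\<close>

lemma standard_rational_basis: "M.rational_basis n (el n) (standard n)"
proof -
  have St: "standard n \<subseteq> Mon n" by (auto simp: standard_def)
  define H where "H = generate (M n) (el n ` standard n)"
  have H: "subgroup H (M n)" unfolding H_def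
    by (rule M.generate_is_subgroup[OF el_image_closed[OF St]])
  have "\<forall>t\<in>A. \<exists>a>0::int. el n t [^]\<^bsub>M n\<^esub> a \<in> H" if "initial n A" for A
    using that
  proof (induction rule: initial_induct)
    case (insert t)
    have "\<exists>a>0::int. el n t [^]\<^bsub>M n\<^esub> a \<in> H"
    proof (cases "t \<in> standard n")
      case True
      then have "el n t \<in> H" unfolding H_def by (auto intro: generate.incl)
      then show ?thesis using el_closed[OF insert(1)] by (intro exI[of _ 1]) auto
    next
      case False
      then obtain a :: int where a: "a > 0" "el n t [^]\<^bsub>M n\<^esub> a \<in> below n t"
        using insert(1) by (auto simp: standard_def)
      have "\<exists>b>0::int. (el n t [^]\<^bsub>M n\<^esub> a) [^]\<^bsub>M n\<^esub> b \<in> H"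
        by (rule M.generate_root_closed[OF H _ _ a(2)[unfolded below_def]])
          (use insert(2) el_closed in blast)+
      then obtain b :: int where b: "b > 0" "(el n t [^]\<^bsub>M n\<^esub> a) [^]\<^bsub>M n\<^esub> b \<in> H" by blast
      then show ?thesis using a(1) el_closed[OF insert(1)]
        by (intro exI[of _ "a * b"]) (auto simp: M.int_pow_pow)
    qed
    then show ?case using insert(2) by blast
  qed auto
  from this[OF initial_Mon] have "\<exists>a>0::int. z [^]\<^bsub>M n\<^esub> a \<in> H" if "z \<in> carrier (M n)" for z
    using M.generate_root_closed[OF H el_image_closed[OF order_refl], of z] that generate_Mon by blast
  then show ?thesis
    unfolding M.rational_basis_def H_def
    using standard_independent finite_subset[OF St finite_mons] St el_closed by auto
qed

end

context OI_module begin

lemma finitely_generated_submodule: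
  assumes "finite S" "S \<subseteq> (SIGMA n:UNIV. carrier (M n))"
    and "\<And>n. carrier (M n) \<subseteq> generate (M n) (translates F S n)"
    and "\<And>n. subgroup (N n) (M n)"
    and "\<And>m n h x. h \<in> OI_mor m n \<Longrightarrow> x \<in> N m \<Longrightarrow> F m n h x \<in> N n"
  shows "\<exists>S. finite S \<and> S \<subseteq> (SIGMA n:UNIV. N n) \<and> (\<forall>n. N n \<subseteq> generate (M n) (translates F S n))"
proof -
  obtain gs where gs: "set gs = S" using finite_list[OF assms(1)] by blast
  interpret OI_module_gens M F gs
    by unfold_locales (unfold gs, rule assms(2), rule assms(3))
  show ?thesis by (rule noetherian[of N]) (fact assms(4,5))+
qed

lemma eventually_polynomial_rational_basis:
  assumes "finite S" "S \<subseteq> (SIGMA n:UNIV. carrier (M n))"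
    and "\<And>n. carrier (M n) \<subseteq> generate (M n) (translates F S n)"
  shows "\<exists>e (I :: nat \<Rightarrow> (nat \<times> nat list) set).
    (\<forall>n. comm_group.rational_basis (M n) (e n) (I n)) \<and> eventually_polynomial (\<lambda>n. real (card (I n)))"
proof -
  obtain gs where gs: "set gs = S" using finite_list[OF assms(1)] by blast
  interpret OI_module_gens M F gs
    by unfold_locales (unfold gs, rule assms(2), rule assms(3))
  show ?thesis using standard_rational_basis standard_eventually_polynomial by blast
qed

end

section \<open>Real homology\<close>

text \<open>These are the coordinates with respect to a Hamel basis of the reals over the rationals.
  Being additive, they can be applied to the coefficients of a chain without disturbing
  boundaries.\<close>

lemma rational_coordinates:
  obtains \<phi> :: "real \<Rightarrow> real \<Rightarrow> real"
  where "\<And>b. additive (\<phi> b)" "\<And>b x. \<phi> b x \<in> \<rat>"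
    "\<And>x. finite {b. \<phi> b x \<noteq> 0}" "\<And>x. x = (\<Sum>b | \<phi> b x \<noteq> 0. \<phi> b x * b)"
proof -
  interpret Q: vector_space "\<lambda>(q::rat) (x::real). of_rat q * x"
    by unfold_locales (auto simp: algebra_simps of_rat_add of_rat_mult)
  define B where "B = Q.extend_basis {}"
  have B: "Q.independent B" "\<And>x. x \<in> Q.span B"
    unfolding B_def using Q.independent_extend_basis[of "{}"] Q.span_extend_basis[of "{}"]
    by (auto simp: Q.independent_empty)
  define \<phi> where "\<phi> b x = (of_rat (Q.representation B x b) :: real)" for b x
  have 1: "additive (\<phi> b)" for b
    by unfold_locales (simp add: \<phi>_def Q.representation_add[OF B(1) B(2) B(2)] of_rat_add)
  have 2: "\<phi> b x \<in> \<rat>" for b x by (simp add: \<phi>_def)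
  have 3: "finite {b. \<phi> b x \<noteq> 0}" for x
    using Q.finite_representation[of B x] by (simp add: \<phi>_def)
  have "x = (\<Sum>b | \<phi> b x \<noteq> 0. \<phi> b x * b)" for x
    using Q.sum_nonzero_representation_eq[OF B(1) B(2), of x] by (simp add: \<phi>_def)
  from that[OF 1 2 3 this] show ?thesis .
qed

lemma clear_denominators:
  assumes "finite A" "A \<subseteq> (\<rat> :: real set)"
  shows "\<exists>N::int. N > 0 \<and> (\<forall>x\<in>A. of_int N * x \<in> \<int>)"
  using assms
proof (induction A rule: finite_induct)
  case empty
  show ?case by (intro exI[of _ 1]) auto
next
  case (insert x A)
  then obtain N :: int where N: "N > 0" "\<forall>x\<in>A. of_int N * x \<in> \<int>" by auto
  obtain a b :: int where ab: "b > 0" "x = of_int a / of_int b"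
    using insert.prems by (metis Rats_cases' insert_subset)
  have "of_int (N * b) * y \<in> \<int>" if "y \<in> A" for y
    using N(2) that Ints_mult[of "of_int b" "of_int N * y"] by (simp add: mult.assoc mult.left_commute)
  moreover have "of_int (N * b) * x \<in> \<int>" using ab by simp
  ultimately show ?case using N(1) ab(1) by (intro exI[of _ "N * b"]) auto
qed

section \<open>Chains under a change of coefficients\<close>

lemma lookup_map_zero: "\<phi> 0 = 0 \<Longrightarrow> Poly_Mapping.lookup (Poly_Mapping.map \<phi> c) k = \<phi> (Poly_Mapping.lookup c k)"
  by (simp add: Poly_Mapping.map.rep_eq when_def)

lemma keys_map_subset: "Poly_Mapping.keys (Poly_Mapping.map \<phi> c) \<subseteq> Poly_Mapping.keys c"
  by (auto simp: in_keys_iff Poly_Mapping.map.rep_eq when_def split: if_splits)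

abbreviation cscale :: "'r::comm_ring_1 \<Rightarrow> ('a, 'r) coeff_chain \<Rightarrow> ('a, 'r) coeff_chain" where
  "cscale r \<equiv> Poly_Mapping.map ((*) r)"

lemma lookup_cscale [simp]: "Poly_Mapping.lookup (cscale r c) k = r * Poly_Mapping.lookup c k"
  by (rule lookup_map_zero) simp

lemma cscale_simps:
  "cscale r (c + d) = cscale r c + cscale r d" "cscale (r + s) c = cscale r c + cscale s c"
  "cscale r (cscale s c) = cscale (r * s) c" "cscale 1 c = c" "cscale 0 c = 0" "cscale r 0 = 0"
  by (rule poly_mapping_eqI, simp add: lookup_add algebra_simps)+

lemma lookup_coeff_boundary:
  assumes "finite S" "Poly_Mapping.keys c \<subseteq> S"
  shows "Poly_Mapping.lookup (coeff_boundary p c) \<tau> = (if p = 0 then 0 else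
    \<Sum>\<sigma>\<in>S. \<Sum>k\<le>p. if singular_face p k \<sigma> = \<tau> then (-1) ^ k * Poly_Mapping.lookup c \<sigma> else 0)"
proof -
  have "(\<Sum>\<sigma>\<in>Poly_Mapping.keys c. \<Sum>k\<le>p. if singular_face p k \<sigma> = \<tau> then (-1) ^ k * Poly_Mapping.lookup c \<sigma> else 0)
    = (\<Sum>\<sigma>\<in>S. \<Sum>k\<le>p. if singular_face p k \<sigma> = \<tau> then (-1) ^ k * Poly_Mapping.lookup c \<sigma> else 0)"
    by (rule sum.mono_neutral_left) (use assms in \<open>auto simp: in_keys_iff\<close>)
  then show ?thesis
    by (simp add: coeff_boundary_def lookup_sum lookup_single when_def cong: if_cong)
qed

text \<open>The coefficients of a boundary are signed sums of those of the chain, so additivity is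
  enough. This covers scalar multiplication, the inclusion of the integers and Hamel coordinates
  alike.\<close>

lemma coeff_boundary_map:
  assumes "additive \<phi>"
  shows "coeff_boundary p (Poly_Mapping.map \<phi> c) = Poly_Mapping.map \<phi> (coeff_boundary p c)"
proof (rule poly_mapping_eqI)
  interpret additive \<phi> by fact
  have sgn: "\<phi> ((-1) ^ k * x) = (-1) ^ k * \<phi> x" for k :: nat and x
    by (cases "even k") (auto simp: minus)
  fix \<tau>
  have "Poly_Mapping.lookup (coeff_boundary p (Poly_Mapping.map \<phi> c)) \<tau> = (if p = 0 then 0 else
    \<Sum>\<sigma>\<in>Poly_Mapping.keys c. \<Sum>k\<le>p. if singular_face p k \<sigma> = \<tau> then \<phi> ((-1) ^ k * Poly_Mapping.lookup c \<sigma>) else 0)"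
    by (subst lookup_coeff_boundary[OF _ keys_map_subset])
      (auto simp: lookup_map_zero zero sgn cong: if_cong)
  also have "\<dots> = \<phi> (Poly_Mapping.lookup (coeff_boundary p c) \<tau>)"
    by (subst lookup_coeff_boundary[OF finite_keys order_refl])
      (auto simp: zero sum if_distrib[of \<phi>] cong: if_cong)
  finally show "Poly_Mapping.lookup (coeff_boundary p (Poly_Mapping.map \<phi> c)) \<tau>
      = Poly_Mapping.lookup (Poly_Mapping.map \<phi> (coeff_boundary p c)) \<tau>"
    by (simp add: lookup_map_zero zero)
qed

lemma additive_mult: "additive ((*) (r :: 'r::comm_ring_1))"
  by unfold_locales (simp add: algebra_simps)

lemma coeff_boundary_cscale: "coeff_boundary p (cscale r c) = cscale r (coeff_boundary p c)"
  by (rule coeff_boundary_map[OF additive_mult])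

lemma coeff_boundary_add: "coeff_boundary p (c + d) = coeff_boundary p c + coeff_boundary p d"
proof (rule poly_mapping_eqI)
  fix \<tau>
  have S: "finite (Poly_Mapping.keys c \<union> Poly_Mapping.keys d)"
    "Poly_Mapping.keys (c + d) \<subseteq> Poly_Mapping.keys c \<union> Poly_Mapping.keys d"
    "Poly_Mapping.keys c \<subseteq> Poly_Mapping.keys c \<union> Poly_Mapping.keys d"
    "Poly_Mapping.keys d \<subseteq> Poly_Mapping.keys c \<union> Poly_Mapping.keys d"
    using keys_add[of c d] by auto
  have split: "(if A then (- 1) ^ k * (x + y) else 0)
      = (if A then (- 1) ^ k * x else 0) + (if A then (- 1) ^ k * y else 0)" for A and k :: nat and x y :: 'b
    by (simp add: distrib_left)
  show "Poly_Mapping.lookup (coeff_boundary p (c + d)) \<tau>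
      = Poly_Mapping.lookup (coeff_boundary p c + coeff_boundary p d) \<tau>"
    unfolding lookup_add lookup_coeff_boundary[OF S(1,2)] lookup_coeff_boundary[OF S(1,3)]
      lookup_coeff_boundary[OF S(1,4)]
    unfolding split sum.distrib by simp
qed

lemma coeff_boundary_0: "coeff_boundary p 0 = 0"
  by (simp add: coeff_boundary_def)

text \<open>Needed to read classes in \<open>homology_group\<close> as integer cycles modulo
  \<open>coeff_boundaries\<close>.\<close>

lemma coeff_boundary_int: "coeff_boundary p c = chain_boundary p c"
proof (cases "p = 0")
  case False
  have "(\<Sum>k\<le>p. Poly_Mapping.single (singular_face p k \<sigma>) ((- 1) ^ k * m))
     = frag_cmul m (\<Sum>k\<le>p. frag_cmul ((- 1) ^ k) (frag_of (singular_face p k \<sigma>)))" for \<sigma> :: "(nat \<Rightarrow> real) \<Rightarrow> 'a" and m :: int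
    by (rule poly_mapping_eqI)
      (auto simp: lookup_sum lookup_single when_def sum_distrib_left intro!: sum.cong)
  then show ?thesis using False by (simp add: coeff_boundary_def chain_boundary_def frag_extend_def)
qed (simp add: coeff_boundary_def chain_boundary_def)

lemma coeff_chains_closed:
  "0 \<in> coeff_chains p X" "c \<in> coeff_chains p X \<Longrightarrow> d \<in> coeff_chains p X \<Longrightarrow> c + d \<in> coeff_chains p X"
  "c \<in> coeff_chains p X \<Longrightarrow> Poly_Mapping.map \<phi> c \<in> coeff_chains p X"
  using keys_add[of c d] keys_map_subset[of \<phi> c] by (auto simp: coeff_chains_def)

lemma coeff_cycles_closed:
  "0 \<in> coeff_cycles p X" "c \<in> coeff_cycles p X \<Longrightarrow> d \<in> coeff_cycles p X \<Longrightarrow> c + d \<in> coeff_cycles p X"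
  "c \<in> coeff_cycles p X \<Longrightarrow> cscale r c \<in> coeff_cycles p X"
  by (auto simp: coeff_cycles_def coeff_chains_closed coeff_boundary_add coeff_boundary_cscale coeff_boundary_0 cscale_simps)

lemma coeff_boundaries_closed:
  "0 \<in> coeff_boundaries p X"
  "c \<in> coeff_boundaries p X \<Longrightarrow> d \<in> coeff_boundaries p X \<Longrightarrow> c + d \<in> coeff_boundaries p X"
  "c \<in> coeff_boundaries p X \<Longrightarrow> cscale r c \<in> coeff_boundaries p X"
proof -
  show "0 \<in> coeff_boundaries p X"
    unfolding coeff_boundaries_def by (rule image_eqI[of _ _ 0]) (auto simp: coeff_boundary_0 coeff_chains_closed)
  show "c + d \<in> coeff_boundaries p X" if "c \<in> coeff_boundaries p X" "d \<in> coeff_boundaries p X"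
    using that by (auto simp: coeff_boundaries_def coeff_boundary_add[symmetric] intro: coeff_chains_closed)
  show "cscale r c \<in> coeff_boundaries p X" if "c \<in> coeff_boundaries p X"
    using that by (auto simp: coeff_boundaries_def coeff_boundary_cscale[symmetric] intro: coeff_chains_closed)
qed

lemma uminus_cscale: "- c = cscale (- 1) c"
  by (rule poly_mapping_eqI) simp

lemma coeff_boundaries_minus: "c \<in> coeff_boundaries p X \<Longrightarrow> - c \<in> coeff_boundaries p X"
  unfolding uminus_cscale by (rule coeff_boundaries_closed)

lemma singular_chain_coeff: "singular_chain p X c \<longleftrightarrow> c \<in> coeff_chains p X"
  by (simp add: singular_chain_def coeff_chains_def)

lemma singular_relcycle_coeff: "singular_relcycle p X {} c \<longleftrightarrow> c \<in> coeff_cycles p X"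
  by (simp add: singular_cycle singular_chain_coeff coeff_cycles_def coeff_boundary_int)

lemma singular_relboundary_coeff: "singular_relboundary p X {} c \<longleftrightarrow> c \<in> coeff_boundaries p X"
  by (auto simp: singular_boundary singular_chain_coeff coeff_boundaries_def coeff_boundary_int)

lemma additive_of_int_mult:
  fixes f :: "real \<Rightarrow> real"
  assumes "additive f"
  shows "f (x * of_int n) = f x * of_int n"
proof -
  interpret additive f by fact
  show ?thesis
  proof (induction n rule: int_induct[of _ 0])
    case (step1 i)
    then show ?case by (simp add: distrib_left add)
  next
    case (step2 i)
    then show ?case by (simp add: right_diff_distrib diff)
  qed (simp add: zero)
qed

text \<open>\<open>m\<close> is exact only on the finite set \<open>A\<close>, which will contain
  the coefficients of a chain; \<open>m 0 = 0\<close> allows it to be applied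
  coefficientwise.\<close>

lemma integral_multiple:
  fixes \<phi> :: "real \<Rightarrow> real"
  assumes "additive \<phi>" "\<And>x. \<phi> x \<in> \<rat>" "finite A"
  shows "\<exists>N::int. \<exists>m :: real \<Rightarrow> int. N > 0 \<and> m 0 = 0 \<and> (\<forall>x\<in>A. of_int (m x) = of_int N * \<phi> x)"
proof -
  have "\<exists>N::int. N > 0 \<and> (\<forall>x\<in>\<phi> ` A. of_int N * x \<in> \<int>)"
    by (rule clear_denominators) (use assms in auto)
  then obtain N :: int where N: "N > 0" "\<And>x. x \<in> A \<Longrightarrow> of_int N * \<phi> x \<in> \<int>" by auto
  have "\<phi> 0 = 0" using assms(1) by (rule additive.zero)
  then show ?thesis
    using N by (intro exI[of _ N] exI[of _ "\<lambda>x. \<lfloor>of_int N * \<phi> x\<rfloor>"]) auto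
qed

abbreviation real_chain :: "('a, int) coeff_chain \<Rightarrow> ('a, real) coeff_chain" where
  "real_chain \<equiv> Poly_Mapping.map of_int"

lemma lookup_real_chain [simp]: "Poly_Mapping.lookup (real_chain c) k = of_int (Poly_Mapping.lookup c k)"
  by (rule lookup_map_zero) simp

lemma real_chain_inject: "real_chain c = real_chain d \<Longrightarrow> c = d"
  by (rule poly_mapping_eqI) (metis lookup_real_chain of_int_eq_iff)

lemma coeff_boundary_real_chain: "coeff_boundary p (real_chain c) = real_chain (coeff_boundary p c)"
  by (rule coeff_boundary_map) (unfold_locales, simp)

lemma real_chain_boundaries: "c \<in> coeff_boundaries p X \<Longrightarrow> real_chain c \<in> coeff_boundaries p X"
  by (auto simp: coeff_boundaries_def coeff_boundary_real_chain[symmetric] intro: coeff_chains_closed)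

lemma real_chain_cycles: "c \<in> coeff_cycles p X \<Longrightarrow> real_chain c \<in> coeff_cycles p X"
  by (auto simp: coeff_cycles_def coeff_boundary_real_chain coeff_chains_closed poly_mapping_eqI)

lemma real_chain_floor:
  assumes "m 0 = 0" "\<And>x. x \<in> Poly_Mapping.lookup c ` Poly_Mapping.keys c \<Longrightarrow> of_int (m x) = \<psi> x" "\<psi> 0 = 0"
  shows "real_chain (Poly_Mapping.map m c) = Poly_Mapping.map \<psi> c"
proof (rule poly_mapping_eqI)
  fix k
  show "Poly_Mapping.lookup (real_chain (Poly_Mapping.map m c)) k = Poly_Mapping.lookup (Poly_Mapping.map \<psi> c) k"
    using assms by (cases "k \<in> Poly_Mapping.keys c") (auto simp: lookup_map_zero in_keys_iff)
qed

text \<open>A real relation yields an integral one: a Hamel coordinate in which some coefficient is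
  nonzero is applied, with denominators cleared, to the relation and to the chain bounding it. As
  the \<open>z i\<close> are integral, the coordinate acts on the \<open>r i\<close> alone.\<close>

lemma real_combination_independent:
  fixes z :: "'i \<Rightarrow> ('a, int) coeff_chain" and r :: "'i \<Rightarrow> real"
  assumes "finite I"
    and ind: "\<And>c. (\<Sum>i\<in>I. cscale (c i) (z i)) \<in> coeff_boundaries p X \<Longrightarrow> \<forall>i\<in>I. c i = 0"
    and rel: "(\<Sum>i\<in>I. cscale (r i) (real_chain (z i))) \<in> coeff_boundaries p X"
  shows "\<forall>i\<in>I. r i = 0"
proof (rule ccontr)
  assume "\<not> (\<forall>i\<in>I. r i = 0)"
  then obtain i0 where i0: "i0 \<in> I" "r i0 \<noteq> 0" by blast
  obtain \<phi> :: "real \<Rightarrow> real \<Rightarrow> real" where \<phi>: "\<And>b. additive (\<phi> b)" "\<And>b x. \<phi> b x \<in> \<rat>"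
    "\<And>x. finite {b. \<phi> b x \<noteq> 0}" "\<And>x. x = (\<Sum>b | \<phi> b x \<noteq> 0. \<phi> b x * b)"
    by (rule rational_coordinates) (rule that)
  have "\<exists>b. \<phi> b (r i0) \<noteq> 0"
  proof (rule ccontr)
    assume "\<not> ?thesis"
    then have empty: "{b. \<phi> b (r i0) \<noteq> 0} = {}" by blast
    show False using \<phi>(4)[of "r i0"] i0(2) unfolding empty by simp
  qed
  then obtain b where b: "\<phi> b (r i0) \<noteq> 0" ..
  obtain d where d: "d \<in> coeff_chains (Suc p) X"
      "coeff_boundary (Suc p) d = (\<Sum>i\<in>I. cscale (r i) (real_chain (z i)))"
    using rel by (auto simp: coeff_boundaries_def)
  \<comment> \<open>One common denominator serves the \<open>r i\<close> and the coefficients of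
    \<open>d\<close>, so that both become integral together.\<close>
  obtain N :: int and m where N: "N > 0" "m 0 = 0"
    and m: "\<And>x. x \<in> r ` I \<union> Poly_Mapping.lookup d ` Poly_Mapping.keys d \<Longrightarrow> of_int (m x) = of_int N * \<phi> b x"
    using integral_multiple[OF \<phi>(1,2), of "r ` I \<union> Poly_Mapping.lookup d ` Poly_Mapping.keys d" b] assms(1)
    by auto
  define \<psi> where "\<psi> x = of_int N * \<phi> b x" for x
  have \<psi>: "additive \<psi>" unfolding \<psi>_def by unfold_locales (simp add: additive.add[OF \<phi>(1)] distrib_left)
  interpret \<psi>: additive \<psi> by fact
  have "real_chain (coeff_boundary (Suc p) (Poly_Mapping.map m d)) = Poly_Mapping.map \<psi> (coeff_boundary (Suc p) d)"
    unfolding coeff_boundary_real_chain[symmetric] coeff_boundary_map[OF \<psi>, symmetric]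
    by (subst real_chain_floor[of m d \<psi>]) (use N m \<psi>.zero in \<open>auto simp: \<psi>_def\<close>)
  also have "\<dots> = real_chain (\<Sum>i\<in>I. cscale (m (r i)) (z i))"
  proof (rule poly_mapping_eqI)
    fix k
    have "\<psi> (\<Sum>i\<in>I. r i * of_int (Poly_Mapping.lookup (z i) k))
        = (\<Sum>i\<in>I. of_int (m (r i)) * of_int (Poly_Mapping.lookup (z i) k))"
      unfolding \<psi>.sum additive_of_int_mult[OF \<psi>]
      by (rule sum.cong) (use m in \<open>auto simp: \<psi>_def\<close>)
    then show "Poly_Mapping.lookup (Poly_Mapping.map \<psi> (coeff_boundary (Suc p) d)) k
        = Poly_Mapping.lookup (real_chain (\<Sum>i\<in>I. cscale (m (r i)) (z i))) k"
      unfolding d by (simp add: lookup_map_zero \<psi>.zero lookup_sum)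
  qed
  finally have "coeff_boundary (Suc p) (Poly_Mapping.map m d) = (\<Sum>i\<in>I. cscale (m (r i)) (z i))"
    by (rule real_chain_inject)
  moreover have "Poly_Mapping.map m d \<in> coeff_chains (Suc p) X" using d coeff_chains_closed by blast
  ultimately have "(\<Sum>i\<in>I. cscale (m (r i)) (z i)) \<in> coeff_boundaries p X"
    unfolding coeff_boundaries_def by (rule image_eqI[OF sym])
  from ind[OF this] have "m (r i0) = 0" using i0 by blast
  then show False using m[of "r i0"] i0 b N by auto
qed

text \<open>A real cycle is a real combination of its Hamel coordinates. Each of these is a cycle
  with rational coefficients, hence a rational multiple of an integer cycle, to which
  \<open>span\<close> applies.\<close>

lemma real_combination_spans:
  fixes z :: "'i \<Rightarrow> ('a, int) coeff_chain" and c :: "('a, real) coeff_chain"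
  assumes "finite I"
    and span: "\<And>w. w \<in> coeff_cycles p X \<Longrightarrow>
      \<exists>a>0. \<exists>c. cscale a w - (\<Sum>i\<in>I. cscale (c i) (z i)) \<in> coeff_boundaries p X"
    and c: "c \<in> coeff_cycles p X"
  shows "\<exists>r. c - (\<Sum>i\<in>I. cscale (r i) (real_chain (z i))) \<in> coeff_boundaries p X"
proof -
  define S where "S = {c :: ('a, real) coeff_chain.
    \<exists>r. c - (\<Sum>i\<in>I. cscale (r i) (real_chain (z i))) \<in> coeff_boundaries p X}"
  have S_add: "c + d \<in> S" if cd: "c \<in> S" "d \<in> S" for c d
  proof -
    obtain r s where "c - (\<Sum>i\<in>I. cscale (r i) (real_chain (z i))) \<in> coeff_boundaries p X"
      "d - (\<Sum>i\<in>I. cscale (s i) (real_chain (z i))) \<in> coeff_boundaries p X" using cd by (auto simp: S_def)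
    from coeff_boundaries_closed(2)[OF this]
    have "(c + d) - (\<Sum>i\<in>I. cscale (r i + s i) (real_chain (z i))) \<in> coeff_boundaries p X"
      by (simp add: cscale_simps sum.distrib algebra_simps)
    then show ?thesis unfolding S_def by (intro CollectI exI[of _ "\<lambda>i. r i + s i"])
  qed
  have S_scale: "cscale q c \<in> S" if cS: "c \<in> S" for c q
  proof -
    obtain r where "c - (\<Sum>i\<in>I. cscale (r i) (real_chain (z i))) \<in> coeff_boundaries p X"
      using cS by (auto simp: S_def)
    from coeff_boundaries_closed(3)[OF this, of q]
    have "cscale q (c - (\<Sum>i\<in>I. cscale (r i) (real_chain (z i)))) \<in> coeff_boundaries p X" .
    also have "cscale q (c - (\<Sum>i\<in>I. cscale (r i) (real_chain (z i))))
        = cscale q c - (\<Sum>i\<in>I. cscale (q * r i) (real_chain (z i)))"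
      by (rule poly_mapping_eqI) (simp add: lookup_minus lookup_sum sum_distrib_left algebra_simps)
    finally show ?thesis unfolding S_def by (intro CollectI exI[of _ "\<lambda>i. q * r i"])
  qed
  have S_int: "real_chain w \<in> S" if w: "w \<in> coeff_cycles p X" for w
  proof -
    obtain a :: int and c where a: "a > 0"
      "cscale a w - (\<Sum>i\<in>I. cscale (c i) (z i)) \<in> coeff_boundaries p X" using span[OF w] by blast
    have "real_chain (cscale a w - (\<Sum>i\<in>I. cscale (c i) (z i)))
        = cscale (of_int a) (real_chain w) - (\<Sum>i\<in>I. cscale (of_int (c i)) (real_chain (z i)))"
      by (rule poly_mapping_eqI) (simp add: lookup_minus lookup_sum)
    then have "cscale (of_int a) (real_chain w) \<in> S"
      using real_chain_boundaries[OF a(2)] unfolding S_def by (intro CollectI exI[of _ "\<lambda>i. of_int (c i)"]) simp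
    from S_scale[OF this, of "1 / of_int a"] a(1) show ?thesis by (simp add: cscale_simps)
  qed
  obtain \<phi> :: "real \<Rightarrow> real \<Rightarrow> real" where \<phi>: "\<And>b. additive (\<phi> b)" "\<And>b x. \<phi> b x \<in> \<rat>"
    "\<And>x. finite {b. \<phi> b x \<noteq> 0}" "\<And>x. x = (\<Sum>b | \<phi> b x \<noteq> 0. \<phi> b x * b)"
    by (rule rational_coordinates) (rule that)
  define B where "B = (\<Union>x\<in>Poly_Mapping.lookup c ` Poly_Mapping.keys c. {b. \<phi> b x \<noteq> 0})"
  have finB: "finite B" unfolding B_def using \<phi>(3) by auto
  have c_eq: "c = (\<Sum>b\<in>B. cscale b (Poly_Mapping.map (\<phi> b) c))"
  proof (rule poly_mapping_eqI)
    fix k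
    have "Poly_Mapping.lookup c k = (\<Sum>b | \<phi> b (Poly_Mapping.lookup c k) \<noteq> 0. \<phi> b (Poly_Mapping.lookup c k) * b)"
      by (rule \<phi>(4))
    also have "\<dots> = (\<Sum>b\<in>B. \<phi> b (Poly_Mapping.lookup c k) * b)"
    proof (rule sum.mono_neutral_left[OF finB])
      show "{b. \<phi> b (Poly_Mapping.lookup c k) \<noteq> 0} \<subseteq> B"
      proof (cases "k \<in> Poly_Mapping.keys c")
        case False
        then show ?thesis using additive.zero[OF \<phi>(1)] by (simp add: in_keys_iff)
      qed (auto simp: B_def)
    qed auto
    finally show "Poly_Mapping.lookup c k = Poly_Mapping.lookup (\<Sum>b\<in>B. cscale b (Poly_Mapping.map (\<phi> b) c)) k"
      using additive.zero[OF \<phi>(1)] by (simp add: lookup_sum lookup_map_zero mult.commute)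
  qed
  have S_coord: "Poly_Mapping.map (\<phi> b) c \<in> S" for b
  proof -
    obtain N :: int and m where N: "N > 0" "m 0 = 0"
      and m: "\<And>x. x \<in> Poly_Mapping.lookup c ` Poly_Mapping.keys c \<Longrightarrow> of_int (m x) = of_int N * \<phi> b x"
      using integral_multiple[OF \<phi>(1,2), of "Poly_Mapping.lookup c ` Poly_Mapping.keys c" b]
      by auto
    define \<psi> where "\<psi> x = of_int N * \<phi> b x" for x
    have \<psi>: "additive \<psi>" unfolding \<psi>_def by unfold_locales (simp add: additive.add[OF \<phi>(1)] distrib_left)
    have eq: "real_chain (Poly_Mapping.map m c) = Poly_Mapping.map \<psi> c"
      by (rule real_chain_floor) (use N m additive.zero[OF \<psi>] in \<open>auto simp: \<psi>_def\<close>)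
    have "real_chain (coeff_boundary p (Poly_Mapping.map m c)) = real_chain 0"
      unfolding coeff_boundary_real_chain[symmetric] eq coeff_boundary_map[OF \<psi>]
      using c additive.zero[OF \<psi>]
      by (auto simp: coeff_cycles_def lookup_map_zero intro!: poly_mapping_eqI)
    then have "coeff_boundary p (Poly_Mapping.map m c) = 0" by (rule real_chain_inject)
    then have "Poly_Mapping.map m c \<in> coeff_cycles p X"
      using c by (auto simp: coeff_cycles_def coeff_chains_closed)
    from S_scale[OF S_int[OF this], of "1 / of_int N"]
    have "cscale (1 / of_int N) (Poly_Mapping.map \<psi> c) \<in> S" by (simp add: eq)
    also have "cscale (1 / of_int N) (Poly_Mapping.map \<psi> c) = Poly_Mapping.map (\<phi> b) c"
      by (rule poly_mapping_eqI)
        (use N additive.zero[OF \<psi>] additive.zero[OF \<phi>(1)] in \<open>simp add: lookup_map_zero \<psi>_def\<close>)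
    finally show ?thesis .
  qed
  have S_sum: "(\<Sum>b\<in>B. f b) \<in> S" if "\<And>b. f b \<in> S" for f
  proof -
    have "real_chain (0 :: ('a, int) coeff_chain) = 0" by (rule poly_mapping_eqI) simp
    then have "0 \<in> S" using S_int[OF coeff_cycles_closed(1)] by metis
    then show ?thesis using that by (induction B rule: infinite_finite_induct) (auto intro: S_add)
  qed
  have "(\<Sum>b\<in>B. cscale b (Poly_Mapping.map (\<phi> b) c)) \<in> S"
    by (rule S_sum) (rule S_scale[OF S_coord])
  then have "c \<in> S" by (simp only: c_eq[symmetric])
  then show ?thesis by (simp add: S_def)
qed


section \<open>Real homology as a vector space\<close>

definition hclass :: "nat \<Rightarrow> 'a topology \<Rightarrow> ('a, real) coeff_chain \<Rightarrow> ('a, real) coeff_chain set" where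
  "hclass p X c = (\<lambda>b. b + c) ` coeff_boundaries p X"

lemma hclass_eq_coset: "coeff_boundaries p X +>\<^bsub>coeff_cycle_module p X\<^esub> c = hclass p X c"
  by (auto simp: a_r_coset_def r_coset_def hclass_def coeff_cycle_module_def)

lemma hclass_eq_iff: "hclass p X c = hclass p X d \<longleftrightarrow> c - d \<in> coeff_boundaries p X"
proof
  assume "hclass p X c = hclass p X d"
  moreover have "c \<in> hclass p X c"
    unfolding hclass_def by (rule image_eqI[of _ _ 0]) (auto simp: coeff_boundaries_closed)
  ultimately show "c - d \<in> coeff_boundaries p X" by (auto simp: hclass_def)
next
  assume *: "c - d \<in> coeff_boundaries p X"
  have sub: "hclass p X c \<subseteq> hclass p X d" if "c - d \<in> coeff_boundaries p X" for c d
  proof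
    fix x assume "x \<in> hclass p X c"
    then obtain b where b: "b \<in> coeff_boundaries p X" "x = b + c" by (auto simp: hclass_def)
    then show "x \<in> hclass p X d" unfolding hclass_def
      by (intro image_eqI[of _ _ "b + (c - d)"]) (use that in \<open>auto intro: coeff_boundaries_closed\<close>)
  qed
  show "hclass p X c = hclass p X d"
    using sub[OF *] sub[of d c] coeff_boundaries_minus[OF *] by auto
qed

lemma zero_real_homology: "zero (real_homology p X) = hclass p X 0"
  by (simp add: coeff_homology_def Let_def hclass_def)

lemma carrier_real_homology: "carrier (real_homology p X) = hclass p X ` coeff_cycles p X"
proof -
  have "carrier (coeff_cycle_module p X :: (real, ('a, real) coeff_chain) module) = coeff_cycles p X"
    by (simp add: coeff_cycle_module_def)
  then show ?thesis
    by (auto simp: coeff_homology_def Let_def A_RCOSETS_def' hclass_eq_coset)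
qed

lemma add_real_homology: "hclass p X c \<oplus>\<^bsub>real_homology p X\<^esub> hclass p X d = hclass p X (c + d)"
proof -
  have "hclass p X c \<oplus>\<^bsub>real_homology p X\<^esub> hclass p X d
      = (\<Union>x\<in>hclass p X c. \<Union>y\<in>hclass p X d. {x + y})"
    by (simp add: coeff_homology_def Let_def set_add_def' coeff_cycle_module_def)
  also have "\<dots> = hclass p X (c + d)"
  proof (intro equalityI subsetI)
    fix x assume "x \<in> (\<Union>x\<in>hclass p X c. \<Union>y\<in>hclass p X d. {x + y})"
    then obtain a b where "a \<in> coeff_boundaries p X" "b \<in> coeff_boundaries p X" "x = (a + c) + (b + d)"
      by (auto simp: hclass_def)
    then show "x \<in> hclass p X (c + d)" unfolding hclass_def
      by (intro image_eqI[of _ _ "a + b"]) (auto intro: coeff_boundaries_closed)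
  next
    fix x assume "x \<in> hclass p X (c + d)"
    then obtain a where "a \<in> coeff_boundaries p X" "x = (a + c) + (0 + d)"
      by (auto simp: hclass_def add.assoc)
    moreover have "0 + d \<in> hclass p X d" unfolding hclass_def
      using coeff_boundaries_closed(1) by blast
    ultimately show "x \<in> (\<Union>x\<in>hclass p X c. \<Union>y\<in>hclass p X d. {x + y})"
      unfolding hclass_def by blast
  qed
  finally show ?thesis .
qed

lemma smult_real_homology: "r \<odot>\<^bsub>real_homology p X\<^esub> hclass p X c = hclass p X (cscale r c)"
proof -
  have "r \<odot>\<^bsub>real_homology p X\<^esub> hclass p X c = (\<Union>d\<in>hclass p X c. hclass p X (cscale r d))"
    by (simp add: coeff_homology_def Let_def hclass_eq_coset) (simp add: coeff_cycle_module_def)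
  also have "\<dots> = (\<Union>d\<in>hclass p X c. hclass p X (cscale r c))"
  proof (rule SUP_cong[OF refl])
    fix d assume "d \<in> hclass p X c"
    then have "cscale r d - cscale r c \<in> coeff_boundaries p X"
      by (auto simp: hclass_def cscale_simps intro: coeff_boundaries_closed)
    then show "hclass p X (cscale r d) = hclass p X (cscale r c)" by (simp add: hclass_eq_iff)
  qed
  also have "\<dots> = hclass p X (cscale r c)"
    using coeff_boundaries_closed(1) by (auto simp: hclass_def)
  finally show ?thesis .
qed

lemmas real_homology_simps = zero_real_homology add_real_homology smult_real_homology

lemma vectorspace_real_homology: "vectorspace class_ring (real_homology p X)"
proof -
  have "abelian_group (real_homology p X)"
  proof (rule abelian_groupI)
    fix x assume "x \<in> carrier (real_homology p X)"
    then obtain c where c: "c \<in> coeff_cycles p X" "x = hclass p X c" by (auto simp: carrier_real_homology)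
    have "- c \<in> coeff_cycles p X"
      unfolding uminus_cscale by (rule coeff_cycles_closed(3)) (rule c(1))
    then show "\<exists>y\<in>carrier (real_homology p X). y \<oplus>\<^bsub>real_homology p X\<^esub> x = \<zero>\<^bsub>real_homology p X\<^esub>"
      by (intro bexI[of _ "hclass p X (- c)"]) (auto simp: real_homology_simps carrier_real_homology c(2))
  qed (auto simp: carrier_real_homology real_homology_simps coeff_cycles_closed algebra_simps)
  then have "Module.module class_ring (real_homology p X)"
    by (rule moduleI[OF class_cring.is_cring])
      (auto simp: carrier_real_homology real_homology_simps coeff_cycles_closed cscale_simps)
  then show ?thesis by (simp add: vectorspace_def class_field)
qed

lemma finsum_real_homology:
  assumes "\<And>i. i \<in> I \<Longrightarrow> f i \<in> coeff_cycles p X"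
  shows "finsum (real_homology p X) (\<lambda>i. hclass p X (f i)) I = hclass p X (\<Sum>i\<in>I. f i)"
proof -
  interpret vectorspace class_ring "real_homology p X" by (rule vectorspace_real_homology)
  show ?thesis using assms
  proof (induction I rule: infinite_finite_induct)
    case (insert i I)
    then show ?case
      by (subst finsum_insert) (auto simp: carrier_real_homology add_real_homology)
  qed (auto simp: zero_real_homology)
qed

lemma real_homology_basis:
  fixes z :: "'i \<Rightarrow> ('a, int) coeff_chain"
  assumes "finite I" and z: "\<And>i. i \<in> I \<Longrightarrow> z i \<in> coeff_cycles p X"
    and ind: "\<And>c. (\<Sum>i\<in>I. cscale (c i) (z i)) \<in> coeff_boundaries p X \<Longrightarrow> \<forall>i\<in>I. c i = 0"
    and span: "\<And>w. w \<in> coeff_cycles p X \<Longrightarrow>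
      \<exists>a>0. \<exists>c. cscale a w - (\<Sum>i\<in>I. cscale (c i) (z i)) \<in> coeff_boundaries p X"
  shows "vectorspace.fin_dim class_ring (real_homology p X)"
    and "vectorspace.dim class_ring (real_homology p X) = card I"
proof -
  interpret V: vectorspace class_ring "real_homology p X" by (rule vectorspace_real_homology)
  define v where "v i = hclass p X (real_chain (z i))" for i
  have rz: "real_chain (z i) \<in> coeff_cycles p X" if "i \<in> I" for i using z[OF that] real_chain_cycles by blast
  have vc: "v ` I \<subseteq> carrier (real_homology p X)"
    using rz by (auto simp: v_def carrier_real_homology)
  \<comment> \<open>Linear combinations are indexed by vectors and not by \<open>I\<close>, so
    repetitions must be excluded first. A repetition would be a relation with coefficients 1 and
    -1.\<close>
  have inj: "inj_on v I"
  proof (rule inj_onI, rule ccontr)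
    fix i j assume ij: "i \<in> I" "j \<in> I" "v i = v j" "i \<noteq> j"
    define r where "r k = (if k = i then 1 else if k = j then - 1 else 0 :: real)" for k
    have "(\<Sum>k\<in>I. cscale (r k) (real_chain (z k))) = (\<Sum>k\<in>{i, j}. cscale (r k) (real_chain (z k)))"
      by (rule sum.mono_neutral_right) (use \<open>finite I\<close> ij in \<open>auto simp: r_def cscale_simps\<close>)
    also have "\<dots> = real_chain (z i) - real_chain (z j)"
      using ij(4) by (simp add: r_def cscale_simps uminus_cscale[symmetric])
    finally have "(\<Sum>k\<in>I. cscale (r k) (real_chain (z k))) \<in> coeff_boundaries p X"
      using ij(3) by (simp add: v_def hclass_eq_iff)
    from real_combination_independent[OF \<open>finite I\<close> ind this] have "r i = 0" using ij(1) by blast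
    then show False by (simp add: r_def)
  qed
  have lin: "V.lincomb a (v ` I) = hclass p X (\<Sum>i\<in>I. cscale (a (v i)) (real_chain (z i)))" for a
  proof -
    have "V.lincomb a (v ` I) = (\<Oplus>\<^bsub>real_homology p X\<^esub>i\<in>I. a (v i) \<odot>\<^bsub>real_homology p X\<^esub> v i)"
      unfolding V.lincomb_def using vc
      by (intro V.finsum_reindex[OF _ inj]) (auto intro!: V.smult_closed)
    also have "\<dots> = (\<Oplus>\<^bsub>real_homology p X\<^esub>i\<in>I. hclass p X (cscale (a (v i)) (real_chain (z i))))"
      by (simp add: v_def smult_real_homology)
    also have "\<dots> = hclass p X (\<Sum>i\<in>I. cscale (a (v i)) (real_chain (z i)))"
      by (rule finsum_real_homology) (use rz coeff_cycles_closed in blast)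
    finally show ?thesis .
  qed
  have li: "V.lin_indpt (v ` I)"
  proof (rule V.finite_lin_indpt2)
    fix a assume "V.lincomb a (v ` I) = \<zero>\<^bsub>real_homology p X\<^esub>"
    then have "(\<Sum>i\<in>I. cscale (a (v i)) (real_chain (z i))) \<in> coeff_boundaries p X"
      unfolding lin zero_real_homology hclass_eq_iff by simp
    from real_combination_independent[OF \<open>finite I\<close> ind this]
    show "\<forall>x\<in>v ` I. a x = \<zero>\<^bsub>class_ring\<^esub>" by simp
  qed (use \<open>finite I\<close> vc in auto)
  have gen: "V.span (v ` I) = carrier (real_homology p X)"
  proof
    show "V.span (v ` I) \<subseteq> carrier (real_homology p X)" using V.span_is_subset2[OF vc] .
    show "carrier (real_homology p X) \<subseteq> V.span (v ` I)"
    proof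
      fix x assume "x \<in> carrier (real_homology p X)"
      then obtain c where c: "c \<in> coeff_cycles p X" "x = hclass p X c" by (auto simp: carrier_real_homology)
      obtain r where r: "c - (\<Sum>i\<in>I. cscale (r i) (real_chain (z i))) \<in> coeff_boundaries p X"
        using real_combination_spans[OF \<open>finite I\<close> span c(1)] by blast
      define a where "a y = r (the_inv_into I v y)" for y
      have "(\<Sum>i\<in>I. cscale (a (v i)) (real_chain (z i))) = (\<Sum>i\<in>I. cscale (r i) (real_chain (z i)))"
        by (rule sum.cong) (auto simp: a_def the_inv_into_f_f[OF inj])
      then have "x = V.lincomb a (v ` I)" using r by (simp add: lin c(2) hclass_eq_iff)
      then show "x \<in> V.span (v ` I)" unfolding V.span_def using \<open>finite I\<close> by auto
    qed
  qed
  show "V.fin_dim" unfolding V.fin_dim_def using \<open>finite I\<close> vc gen by (intro exI[of _ "v ` I"]) auto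
  have "V.dim = card (v ` I)"
    by (rule V.dim_basis) (use \<open>finite I\<close> vc gen li in \<open>auto simp: V.basis_def\<close>)
  then show "V.dim = card I" by (simp add: card_image inj)
qed

lemma homology_class_hom:
  "homologous_rel_set p X S \<in> hom (relcycle_group p X S) (relative_homology_group (int p) X S)"
proof -
  interpret normal "singular_relboundary_set p X S" "relcycle_group p X S"
    by (rule normal_subgroup_singular_relboundary_relcycle)
  show ?thesis using r_coset_hom_Mod
    unfolding right_coset_singular_relboundary nontrivial_relative_homology_group by simp
qed

lemma int_pow_relcycle_group:
  assumes "singular_relcycle p X S x"
  shows "x [^]\<^bsub>relcycle_group p X S\<^esub> (k :: int) = cscale k x"
proof -
  have x: "x \<in> singular_relcycle_set p X S" using assms by simp
  have keys: "Poly_Mapping.keys x \<subseteq> singular_simplex_set p X"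
    using assms by (auto simp: singular_relcycle_def singular_chain_def)
  have "x [^]\<^bsub>relcycle_group p X S\<^esub> k = x [^]\<^bsub>chain_group p X\<^esub> k"
    unfolding relcycle_group_def
    by (rule group.int_pow_subgroup_generated[OF group_chain_group])
      (use x in \<open>simp flip: relcycle_group_def\<close>)
  also have "\<dots> = frag_cmul k x" unfolding chain_group_def using keys by simp
  also have "\<dots> = cscale k x" by (rule poly_mapping_eqI) simp
  finally show ?thesis .
qed

lemma finprod_relcycle_group:
  assumes "\<And>i. i \<in> I \<Longrightarrow> singular_relcycle p X S (z i)"
  shows "finprod (relcycle_group p X S) (\<lambda>i. z i [^]\<^bsub>relcycle_group p X S\<^esub> (c i :: int)) I
    = (\<Sum>i\<in>I. cscale (c i) (z i))"
proof -
  interpret comm_group "relcycle_group p X S" by simp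
  show ?thesis using assms
  proof (induction I rule: infinite_finite_induct)
    case (insert i I)
    have "z j [^]\<^bsub>relcycle_group p X S\<^esub> c j \<in> carrier (relcycle_group p X S)" if "j \<in> insert i I" for j
      by (rule int_pow_closed) (use insert.prems that in auto)
    then have "finprod (relcycle_group p X S) (\<lambda>i. z i [^]\<^bsub>relcycle_group p X S\<^esub> c i) (insert i I)
       = z i [^]\<^bsub>relcycle_group p X S\<^esub> c i \<otimes>\<^bsub>relcycle_group p X S\<^esub>
         finprod (relcycle_group p X S) (\<lambda>i. z i [^]\<^bsub>relcycle_group p X S\<^esub> c i) I"
      using insert.hyps by (intro finprod_insert) auto
    then show ?case using insert by (simp add: int_pow_relcycle_group)
  qed auto
qed

text \<open>Cycles representing the basis classes turn independence and generation up to powers into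
  statements on integer cycles modulo boundaries, and those transfer to real coefficients.\<close>

lemma real_homology_rational_basis:
  fixes e :: "'i \<Rightarrow> 'a chain set"
  assumes "comm_group.rational_basis (homology_group (int p) X) e I"
  shows "vectorspace.fin_dim class_ring (real_homology p X)"
    and "vectorspace.dim class_ring (real_homology p X) = card I"
proof -
  let ?H = "homology_group (int p) X" and ?Z = "relcycle_group p X {}"
  let ?c = "homologous_rel_set p X {}"
  interpret Z: comm_group ?Z by simp
  interpret H: comm_group ?H by (rule abelian_homology_group)
  have fin: "finite I" and e: "e \<in> I \<rightarrow> carrier ?H" and ind: "H.int_independent e I"
    and root: "\<And>x. x \<in> carrier ?H \<Longrightarrow> \<exists>a>0::int. x [^]\<^bsub>?H\<^esub> a \<in> generate ?H (e ` I)"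
    using assms unfolding H.rational_basis_def by auto
  have "\<forall>i\<in>I. \<exists>z. z \<in> carrier ?Z \<and> e i = ?c z"
    using e by (force simp: carrier_relative_homology_group)
  then obtain z where z: "\<And>i. i \<in> I \<Longrightarrow> z i \<in> carrier ?Z" "\<And>i. i \<in> I \<Longrightarrow> e i = ?c (z i)" by metis
  have comb: "finprod ?H (\<lambda>i. e i [^]\<^bsub>?H\<^esub> c i) I = ?c (\<Sum>i\<in>I. cscale (c i) (z i))" for c :: "'i \<Rightarrow> int"
  proof -
    have "finprod ?H (\<lambda>i. e i [^]\<^bsub>?H\<^esub> c i) I = finprod ?H (\<lambda>i. ?c (z i) [^]\<^bsub>?H\<^esub> c i) I"
      by (rule H.finprod_cong') (use e in \<open>auto simp: z(2)[symmetric] Pi_iff intro!: H.int_pow_closed\<close>)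
    also have "\<dots> = ?c (finprod ?Z (\<lambda>i. z i [^]\<^bsub>?Z\<^esub> c i) I)"
      by (rule hom_finprod_int_pow[symmetric]) (use z homology_class_hom H.comm_group_axioms in auto)
    also have "finprod ?Z (\<lambda>i. z i [^]\<^bsub>?Z\<^esub> c i) I = (\<Sum>i\<in>I. cscale (c i) (z i))"
      by (rule finprod_relcycle_group) (use z in auto)
    finally show ?thesis .
  qed
  have zc: "\<And>i. i \<in> I \<Longrightarrow> z i \<in> coeff_cycles p X"
    using z by (simp add: singular_relcycle_coeff)
  have 1: "\<forall>i\<in>I. c i = 0" if "(\<Sum>i\<in>I. cscale (c i) (z i)) \<in> coeff_boundaries p X" for c :: "'i \<Rightarrow> int"
  proof -
    have "finprod ?H (\<lambda>i. e i [^]\<^bsub>?H\<^esub> c i) I = \<one>\<^bsub>?H\<^esub>"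
      unfolding comb one_relative_homology_group homologous_rel_set_eq_relboundary singular_relboundary_coeff by fact
    then show ?thesis using ind unfolding H.int_independent_def by blast
  qed
  have 2: "\<exists>a>0. \<exists>c. cscale a w - (\<Sum>i\<in>I. cscale (c i) (z i)) \<in> coeff_boundaries p X"
    if w: "w \<in> coeff_cycles p X" for w :: "('a, int) coeff_chain"
  proof -
    have wZ: "w \<in> carrier ?Z" using w by (simp add: singular_relcycle_coeff)
    then have "?c w \<in> carrier ?H" by (auto simp: carrier_relative_homology_group)
    then obtain a :: int where a: "a > 0" "?c w [^]\<^bsub>?H\<^esub> a \<in> generate ?H (e ` I)" using root by blast
    obtain c :: "'i \<Rightarrow> int" where c: "?c w [^]\<^bsub>?H\<^esub> a = finprod ?H (\<lambda>i. e i [^]\<^bsub>?H\<^esub> c i) I"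
      using H.generate_eq_finprod[OF e fin a(2)] by blast
    have "?c w [^]\<^bsub>?H\<^esub> a = ?c (cscale a w)"
      using hom_int_pow[OF homology_class_hom wZ] wZ by (simp add: int_pow_relcycle_group)
    then have "?c (cscale a w) = ?c (\<Sum>i\<in>I. cscale (c i) (z i))" using c comb by simp
    moreover have "(\<Sum>i\<in>I. cscale (c i) (z i)) \<in> ?c (\<Sum>i\<in>I. cscale (c i) (z i))"
      by (simp add: homologous_rel_refl)
    ultimately have "(\<Sum>i\<in>I. cscale (c i) (z i)) \<in> ?c (cscale a w)" by (simp only:)
    then have "homologous_rel p X {} (cscale a w) (\<Sum>i\<in>I. cscale (c i) (z i))" by simp
    then have "cscale a w - (\<Sum>i\<in>I. cscale (c i) (z i)) \<in> coeff_boundaries p X"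
      by (simp add: homologous_rel_def singular_relboundary_coeff)
    then show ?thesis using a(1) by blast
  qed
  show "vectorspace.fin_dim class_ring (real_homology p X)"
    and "vectorspace.dim class_ring (real_homology p X) = card I"
    by (rule real_homology_basis[OF fin zc 1 2]; assumption)+
qed

section \<open>Attaching cells\<close>

lemma hom_induced_group_hom:
  "group_hom (relative_homology_group p X S) (relative_homology_group p Y T) (hom_induced p X S Y T f)"
  by (simp add: group_hom_def group_hom_axioms_def hom_induced_hom)

lemma hom_induced_id_compose:
  assumes "A \<subseteq> B" "B \<subseteq> C" "A' \<subseteq> B'" "B' \<subseteq> C'"
  shows "hom_induced p (top_of_set B) B' (top_of_set C) C' id (hom_induced p (top_of_set A) A' (top_of_set B) B' id z)
    = hom_induced p (top_of_set A) A' (top_of_set C) C' id z"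
  by (subst hom_induced_compose') (use assms in \<open>auto simp: continuous_map_in_subtopology\<close>)

lemma triple_exact_middle:
  assumes "C \<subseteq> B" "B \<subseteq> A"
  shows "kernel (relative_homology_group p (top_of_set A) C) (relative_homology_group p (top_of_set A) B)
      (hom_induced p (top_of_set A) C (top_of_set A) B id)
    = hom_induced p (top_of_set B) C (top_of_set A) C id ` carrier (relative_homology_group p (top_of_set B) C)"
proof -
  have "subtopology (top_of_set A) B = top_of_set B"
    using assms(2) by (simp add: subtopology_subtopology Int_absorb1)
  then show ?thesis using homology_exactness_triple_3[OF assms(1), of p "top_of_set A"] by simp
qed

text \<open>By exactness for the triple \<open>C \<subseteq> B \<subseteq> A\<close>, the kernel is
  the image of a trivial group.\<close>

lemma triple_inj:
  assumes "C \<subseteq> B" "B \<subseteq> A" "trivial_group (relative_homology_group p (top_of_set B) C)"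
  shows "inj_on (hom_induced p (top_of_set A) C (top_of_set A) B id)
    (carrier (relative_homology_group p (top_of_set A) C))"
proof -
  interpret h: group_hom "relative_homology_group p (top_of_set A) C" "relative_homology_group p (top_of_set A) B"
    "hom_induced p (top_of_set A) C (top_of_set A) B id"
    by (rule hom_induced_group_hom)
  interpret g: group_hom "relative_homology_group p (top_of_set B) C" "relative_homology_group p (top_of_set A) C"
    "hom_induced p (top_of_set B) C (top_of_set A) C id"
    by (rule hom_induced_group_hom)
  have "kernel (relative_homology_group p (top_of_set A) C) (relative_homology_group p (top_of_set A) B)
      (hom_induced p (top_of_set A) C (top_of_set A) B id) = {\<one>\<^bsub>relative_homology_group p (top_of_set A) C\<^esub>}"
    unfolding triple_exact_middle[OF assms(1,2)] using assms(3) by (simp add: trivial_group_def)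
  then show ?thesis by (simp add: h.inj_iff_trivial_ker)
qed

text \<open>The next map in the sequence of the triple ends in a trivial group, so its kernel is
  everything.\<close>

lemma triple_surj:
  assumes "C \<subseteq> B" "B \<subseteq> A" "trivial_group (relative_homology_group (p - 1) (top_of_set B) C)"
  shows "hom_induced p (top_of_set A) C (top_of_set A) B id ` carrier (relative_homology_group p (top_of_set A) C)
    = carrier (relative_homology_group p (top_of_set A) B)"
proof -
  have "subtopology (top_of_set A) B = top_of_set B"
    using assms(2) by (simp add: subtopology_subtopology Int_absorb1)
  then have "kernel (relative_homology_group p (top_of_set A) B) (relative_homology_group (p - 1) (top_of_set B) C)
      (hom_relboundary p (top_of_set A) B C)
    = hom_induced p (top_of_set A) C (top_of_set A) B id ` carrier (relative_homology_group p (top_of_set A) C)"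
    using homology_exactness_triple_1[OF assms(1), of p "top_of_set A"] by simp
  moreover have "hom_relboundary p (top_of_set A) B C z = \<one>\<^bsub>relative_homology_group (p - 1) (top_of_set B) C\<^esub>" for z
    using hom_relboundary[of p "top_of_set A" B C z] assms(3) \<open>subtopology (top_of_set A) B = _\<close>
    by (simp add: trivial_group_def)
  ultimately show ?thesis by (auto simp: kernel_def)
qed

text \<open>Fixing \<open>Y\<close> at all times makes \<open>h\<close> a homotopy of pairs from the
  identity to a map into \<open>Y\<close>.\<close>

lemma trivial_relative_homology_deformation:
  fixes V Y :: "'a::topological_space set" and h :: "real \<Rightarrow> 'a \<Rightarrow> 'a"
  assumes "Y \<subseteq> V" "continuous_on ({0..1} \<times> V) (\<lambda>(t, x). h t x)"
    and "\<And>t x. t \<in> {0..1} \<Longrightarrow> x \<in> V \<Longrightarrow> h t x \<in> V"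
    and "\<And>x. x \<in> V \<Longrightarrow> h 0 x = x" "\<And>x. x \<in> V \<Longrightarrow> h 1 x \<in> Y"
    and "\<And>t x. t \<in> {0..1} \<Longrightarrow> x \<in> Y \<Longrightarrow> h t x = x"
  shows "trivial_group (relative_homology_group p (top_of_set V) Y)"
proof (rule trivial_relative_homology_group_alt)
  have "continuous_on V ((\<lambda>(t, x). h t x) \<circ> (\<lambda>x. (1, x)))"
    by (rule continuous_on_compose) (auto intro!: continuous_intros continuous_on_subset[OF assms(2)])
  then have "continuous_on V (h 1)" by (simp add: comp_def)
  then show "continuous_map (top_of_set V) (subtopology (top_of_set V) Y) (h 1)"
    using assms(1,3,5) by (auto simp: subtopology_subtopology continuous_map_in_subtopology Int_absorb1)
  have "homotopic_with (\<lambda>k. k ` Y \<subseteq> Y) (top_of_set V) (top_of_set V) id (h 1)"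
  proof (subst homotopic_with)
    show "\<exists>k. continuous_map (prod_topology (top_of_set {0..1::real}) (top_of_set V)) (top_of_set V) k \<and>
      (\<forall>x\<in>topspace (top_of_set V). k (0, x) = id x) \<and> (\<forall>x\<in>topspace (top_of_set V). k (1, x) = h 1 x) \<and>
      (\<forall>t\<in>{0..1}. (\<lambda>x. k (t, x)) ` Y \<subseteq> Y)"
    proof (intro exI[of _ "\<lambda>(t, x). h t x"] conjI)
      have "prod_topology (top_of_set {0..1::real}) (top_of_set V) = top_of_set ({0..1} \<times> V)"
        by (simp add: subtopology_Times[symmetric] euclidean_product_topology)
      then show "continuous_map (prod_topology (top_of_set {0..1::real}) (top_of_set V)) (top_of_set V) (\<lambda>(t, x). h t x)"
        using assms(2,3) by (auto simp: continuous_map_in_subtopology)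
    qed (use assms in auto)
    show "(h ` Y \<subseteq> Y) = (k ` Y \<subseteq> Y)" if "\<And>x. x \<in> topspace (top_of_set V) \<Longrightarrow> h x = k x" for h k :: "'a \<Rightarrow> 'a"
      using that assms(1) by (metis image_cong subsetD topspace_euclidean_subtopology)
  qed
  then show "homotopic_with (\<lambda>k. k ` Y \<subseteq> Y) (top_of_set V) (top_of_set V) (h 1) id"
    by (rule homotopic_with_symD)
qed

text \<open>All that attaching a cell \<open>c\<close> with centre \<open>b\<close> along its boundary \<open>B\<close> requires of it.\<close>

definition conical :: "'a::topological_space set \<Rightarrow> 'a set \<Rightarrow> 'a \<Rightarrow> bool" where
  "conical c B b \<longleftrightarrow> closed c \<and> closed {b} \<and> B \<subseteq> c \<and> b \<in> c \<and> b \<notin> B \<and>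
     (\<exists>h. continuous_on ({0..1::real} \<times> (c - {b})) (\<lambda>(t, x). h t x) \<and>
     (\<forall>t\<in>{0..1}. \<forall>x\<in>c - {b}. h t x \<in> c - {b}) \<and> (\<forall>x\<in>c - {b}. h 0 x = x \<and> h 1 x \<in> B) \<and>
     (\<forall>t\<in>{0..1}. \<forall>x\<in>B. h t x = x))"

lemma conical_punctured_trivial:
  assumes "conical c B b"
  shows "trivial_group (relative_homology_group q (top_of_set (c - {b})) B)"
proof -
  obtain h where "continuous_on ({0..1::real} \<times> (c - {b})) (\<lambda>(t, x). h t x)"
    and "\<And>t x. t \<in> {0..1} \<Longrightarrow> x \<in> c - {b} \<Longrightarrow> h t x \<in> c - {b}"
    and "\<And>x. x \<in> c - {b} \<Longrightarrow> h 0 x = x" "\<And>x. x \<in> c - {b} \<Longrightarrow> h 1 x \<in> B"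
    and "\<And>t x. t \<in> {0..1} \<Longrightarrow> x \<in> B \<Longrightarrow> h t x = x"
    using assms unfolding conical_def by blast
  then show ?thesis
    by (intro trivial_relative_homology_deformation[of _ _ h]) (use assms in \<open>auto simp: conical_def\<close>)
qed

text \<open>Excision at the centre, after pushing away from it on both sides.\<close>

lemma attach_cell_surj:
  fixes Y c :: "'a::topological_space set"
  assumes "conical c (c \<inter> Y) b" "closed Y"
  shows "hom_induced p (top_of_set c) (c \<inter> Y) (top_of_set (Y \<union> c)) Y id
      ` carrier (relative_homology_group p (top_of_set c) (c \<inter> Y))
    = carrier (relative_homology_group p (top_of_set (Y \<union> c)) Y)"
proof -
  obtain h where b: "b \<in> c" "b \<notin> Y" and cl_b: "closed {b}" and cl: "closed c"
    and cont: "continuous_on ({0..1::real} \<times> (c - {b})) (\<lambda>(t, x). h t x)"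
    and h: "\<And>t x. t \<in> {0..1} \<Longrightarrow> x \<in> c - {b} \<Longrightarrow> h t x \<in> c - {b}"
    and h01: "\<And>x. x \<in> c - {b} \<Longrightarrow> h 0 x = x" "\<And>x. x \<in> c - {b} \<Longrightarrow> h 1 x \<in> c \<inter> Y"
    and hB: "\<And>t x. t \<in> {0..1} \<Longrightarrow> x \<in> c \<inter> Y \<Longrightarrow> h t x = x"
    using assms(1) unfolding conical_def by auto
  define X where "X = Y \<union> c"
  define V where "V = X - {b}"
  note c_triv = conical_punctured_trivial[OF assms(1)]
  \<comment> \<open>\<open>h\<close> is extended by the identity on \<open>Y\<close>. On the overlap
    of the two closed pieces \<open>h\<close> does not move points, so the extension is
    continuous.\<close>
  define k where "k t x = (if x \<in> Y then x else h t x)" for t x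
  have "continuous_on ({0..1} \<times> Y \<union> {0..1} \<times> (c - {b})) (\<lambda>z. if snd z \<in> Y then snd z else (\<lambda>(t, x). h t x) z)"
  proof (rule continuous_on_cases_local)
    have U: "{0..1} \<times> Y \<union> {0..1::real} \<times> (c - {b}) = {0..1} \<times> V"
      using b by (auto simp: V_def X_def)
    have "{0..1} \<times> Y = ({0..1} \<times> V) \<inter> ((UNIV :: real set) \<times> Y)"
      "{0..1} \<times> (c - {b}) = ({0..1} \<times> V) \<inter> ((UNIV :: real set) \<times> c)"
      using b by (auto simp: V_def X_def)
    moreover have "closed ((UNIV :: real set) \<times> Y)" "closed ((UNIV :: real set) \<times> c)"
      using assms(2) cl by (auto intro: closed_Times)
    ultimately show "closedin (top_of_set ({0..1} \<times> Y \<union> {0..1::real} \<times> (c - {b}))) ({0..1} \<times> Y)"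
      "closedin (top_of_set ({0..1} \<times> Y \<union> {0..1::real} \<times> (c - {b}))) ({0..1} \<times> (c - {b}))"
      unfolding U closedin_closed by blast+
    show "continuous_on ({0..1::real} \<times> Y) snd" by (intro continuous_intros)
  qed (use cont hB in auto)
  then have kcont: "continuous_on ({0..1} \<times> V) (\<lambda>(t, x). k t x)"
    by (rule continuous_on_eq[OF continuous_on_subset]) (auto simp: V_def X_def k_def)
  have V_triv: "trivial_group (relative_homology_group q (top_of_set V) Y)" for q
  proof (rule trivial_relative_homology_deformation[OF _ kcont])
    show "Y \<subseteq> V" using b by (auto simp: V_def X_def)
    show "k t x \<in> V" if "t \<in> {0..1}" "x \<in> V" for t x
      using that h[of t x] by (auto simp: V_def X_def k_def)
    show "k 0 x = x" "k 1 x \<in> Y" if "x \<in> V" for x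
      using that h01[of x] by (auto simp: V_def X_def k_def)
  qed (simp add: k_def)
  have sub: "Y \<subseteq> V" "V \<subseteq> X" "c \<subseteq> X" using b by (auto simp: V_def X_def)
  \<comment> \<open>\<open>V\<close> is open because a single closed point was removed, and
    \<open>Y\<close> is closed, so \<open>Y\<close> can be excised from \<open>(X, V)\<close>; what
    remains of \<open>X\<close> is \<open>c - Y\<close>.\<close>
  have exc: "hom_induced p (top_of_set (c - Y)) (V - Y) (top_of_set X) V id
      \<in> iso (relative_homology_group p (top_of_set (c - Y)) (V - Y)) (relative_homology_group p (top_of_set X) V)"
  proof -
    have "top_of_set X closure_of Y \<subseteq> Y"
      by (rule closure_of_minimal) (use assms(2) sub in \<open>auto simp: closedin_closed\<close>)
    moreover have "openin (top_of_set X) V"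
      unfolding V_def openin_open by (intro exI[of _ "- {b}"]) (use cl_b in auto)
    then have "top_of_set X interior_of V = V" by (simp add: interior_of_openin)
    ultimately have "top_of_set X closure_of Y \<subseteq> top_of_set X interior_of V" using sub by auto
    from homology_excision_axiom[OF this sub(2)]
    have "hom_induced p (subtopology (top_of_set X) (X - Y)) (V - Y) (subtopology (top_of_set X) X) V id
      \<in> iso (relative_homology_group p (subtopology (top_of_set X) (X - Y)) (V - Y))
            (relative_homology_group p (subtopology (top_of_set X) X) V)" .
    moreover have "subtopology (top_of_set X) (X - Y) = top_of_set (c - Y)"
      by (simp add: subtopology_subtopology X_def) (metis Un_Diff Diff_cancel Un_Diff_cancel Un_Int_eq(3) inf_commute sup_bot_left Diff_subset inf.absorb_iff2 le_supI2)
    ultimately show ?thesis by (simp add: subtopology_subtopology)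
  qed
  show ?thesis
  proof (intro equalityI subsetI)
    fix z assume z: "z \<in> carrier (relative_homology_group p (top_of_set (Y \<union> c)) Y)"
    define i where "i = hom_induced p (top_of_set X) Y (top_of_set X) V id"
    have "i z \<in> carrier (relative_homology_group p (top_of_set X) V)"
      unfolding i_def by (rule hom_induced_carrier)
    then have "i z \<in> hom_induced p (top_of_set (c - Y)) (V - Y) (top_of_set X) V id
        ` carrier (relative_homology_group p (top_of_set (c - Y)) (V - Y))"
      using exc by (simp add: iso_def bij_betw_def)
    then obtain w where w: "i z = hom_induced p (top_of_set (c - Y)) (V - Y) (top_of_set X) V id w"
      by (rule imageE)
    \<comment> \<open>Excision moves \<open>z\<close> into \<open>(c, c - {b})\<close>. The
      retraction of the punctured cell lifts it to \<open>(c, c \<inter> Y)\<close>, and the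
      retraction of \<open>V\<close> onto \<open>Y\<close> shows that the lift maps to
      \<open>z\<close>.\<close>
    define w' where "w' = hom_induced p (top_of_set (c - Y)) (V - Y) (top_of_set c) (c - {b}) id w"
    have VY: "V - Y \<subseteq> c - {b}" by (auto simp: V_def X_def)
    have w'z: "hom_induced p (top_of_set c) (c - {b}) (top_of_set X) V id w' = i z"
      unfolding w'_def w by (rule hom_induced_id_compose) (use sub VY in \<open>auto simp: V_def\<close>)
    have "w' \<in> carrier (relative_homology_group p (top_of_set c) (c - {b}))"
      unfolding w'_def by (rule hom_induced_carrier)
    then obtain u where u: "u \<in> carrier (relative_homology_group p (top_of_set c) (c \<inter> Y))"
      "w' = hom_induced p (top_of_set c) (c \<inter> Y) (top_of_set c) (c - {b}) id u"
      using triple_surj[OF _ _ c_triv, of c p] b by auto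
    have "i (hom_induced p (top_of_set c) (c \<inter> Y) (top_of_set X) Y id u)
        = hom_induced p (top_of_set c) (c \<inter> Y) (top_of_set X) V id u"
      unfolding i_def by (rule hom_induced_id_compose) (use sub in auto)
    also have "\<dots> = hom_induced p (top_of_set c) (c - {b}) (top_of_set X) V id w'"
      unfolding u(2) by (rule hom_induced_id_compose[symmetric]) (use sub b in \<open>auto simp: V_def\<close>)
    finally have "i (hom_induced p (top_of_set c) (c \<inter> Y) (top_of_set X) Y id u) = i z" using w'z by simp
    then have "hom_induced p (top_of_set c) (c \<inter> Y) (top_of_set X) Y id u = z"
      using inj_onD[OF triple_inj[OF sub(1,2) V_triv]] z hom_induced_carrier
      unfolding i_def X_def by blast
    then show "z \<in> hom_induced p (top_of_set c) (c \<inter> Y) (top_of_set (Y \<union> c)) Y id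
      ` carrier (relative_homology_group p (top_of_set c) (c \<inter> Y))"
      using u(1) by (auto simp: X_def)
  qed (auto intro: hom_induced_carrier)
qed

text \<open>Cells are attached one at a time. For \<open>Y \<subseteq> X' \<subseteq> X\<close>, a
  class is corrected by one from the last cell so that it vanishes in \<open>(X, X')\<close>; what
  is left comes from \<open>(X', Y)\<close>, where induction applies.\<close>

lemma attach_cells_generate:
  fixes Y :: "'a::topological_space set" and c :: "'j \<Rightarrow> 'a set"
  assumes "finite J" "closed Y"
    and "\<And>j. j \<in> J \<Longrightarrow> conical (c j) (c j \<inter> Y) (b j)"
    and "\<And>i j. i \<in> J \<Longrightarrow> j \<in> J \<Longrightarrow> i \<noteq> j \<Longrightarrow> c i \<inter> c j \<subseteq> Y"
  shows "carrier (relative_homology_group p (top_of_set (Y \<union> \<Union>(c ` J))) Y)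
    \<subseteq> generate (relative_homology_group p (top_of_set (Y \<union> \<Union>(c ` J))) Y)
        (\<Union>j\<in>J. hom_induced p (top_of_set (c j)) (c j \<inter> Y) (top_of_set (Y \<union> \<Union>(c ` J))) Y id
          ` carrier (relative_homology_group p (top_of_set (c j)) (c j \<inter> Y)))"
  using assms(1,3,4)
proof (induction J rule: finite_induct)
  case empty
  have "trivial_group (relative_homology_group p (top_of_set Y) Y)"
    using trivial_relative_homology_group_topspace[of p "top_of_set Y"] by simp
  then show ?case by (auto simp: trivial_group_def intro: generate.one)
next
  case (insert j J)
  define X' where "X' = Y \<union> \<Union>(c ` J)"
  define X where "X = X' \<union> c j"
  have X: "Y \<union> \<Union>(c ` insert j J) = X" by (auto simp: X_def X'_def)
  have closed: "closed (c i)" if "i \<in> insert j J" for i using insert.prems(1)[OF that] by (simp add: conical_def)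
  have X': "closed X'" unfolding X'_def using assms(2) insert.hyps closed by auto
  \<comment> \<open>Earlier cells meet \<open>c j\<close> only inside \<open>Y\<close>, so
    \<open>c j\<close> has the same attaching boundary for \<open>X'\<close> as for
    \<open>Y\<close>.\<close>
  have int: "c j \<inter> X' = c j \<inter> Y"
    using insert.prems(2) insert.hyps by (force simp: X'_def)
  have sub: "Y \<subseteq> X'" "X' \<subseteq> X" by (auto simp: X_def X'_def)
  define H where "H A B = relative_homology_group p (top_of_set A) B" for A B :: "'a set"
  define I where "I A A' B B' = hom_induced p (top_of_set A) A' (top_of_set B) B' id" for A A' B B' :: "'a set"
  interpret HX: comm_group "H X Y" unfolding H_def by simp
  interpret i: group_hom "H X Y" "H X X'" "I X Y X X'"
    unfolding H_def I_def by (rule hom_induced_group_hom)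
  interpret k: group_hom "H X' Y" "H X Y" "I X' Y X Y"
    unfolding H_def I_def by (rule hom_induced_group_hom)
  define S where "S = (\<Union>i\<in>insert j J. I (c i) (c i \<inter> Y) X Y ` carrier (H (c i) (c i \<inter> Y)))"
  have S: "S \<subseteq> carrier (H X Y)" unfolding S_def I_def H_def by (auto intro: hom_induced_carrier)
  have IH: "carrier (H X' Y) \<subseteq> generate (H X' Y) (\<Union>i\<in>J. I (c i) (c i \<inter> Y) X' Y ` carrier (H (c i) (c i \<inter> Y)))"
    unfolding H_def I_def X'_def by (rule insert.IH) (use insert.prems in auto)
  have IH': "I X' Y X Y z \<in> generate (H X Y) S" if "z \<in> carrier (H X' Y)" for z
  proof -
    have gen: "I X' Y X Y z \<in> generate (H X Y) (I X' Y X Y ` (\<Union>i\<in>J. I (c i) (c i \<inter> Y) X' Y ` carrier (H (c i) (c i \<inter> Y))))"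
      by (subst k.generate_img) (use IH that in \<open>auto simp: I_def H_def intro: hom_induced_carrier\<close>)
    have "I X' Y X Y ` (\<Union>i\<in>J. I (c i) (c i \<inter> Y) X' Y ` carrier (H (c i) (c i \<inter> Y))) \<subseteq> S"
    proof clarify
      fix i y assume "i \<in> J" "y \<in> carrier (H (c i) (c i \<inter> Y))"
      moreover have "I X' Y X Y (I (c i) (c i \<inter> Y) X' Y y) = I (c i) (c i \<inter> Y) X Y y"
        unfolding I_def by (rule hom_induced_id_compose) (use sub \<open>i \<in> J\<close> in \<open>auto simp: X'_def\<close>)
      ultimately show "I X' Y X Y (I (c i) (c i \<inter> Y) X' Y y) \<in> S" by (auto simp: S_def)
    qed
    from subsetD[OF HX.mono_generate[OF this] gen] show ?thesis .
  qed
  have "z \<in> generate (H X Y) S" if z: "z \<in> carrier (H X Y)" for z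
  proof -
    have "I X Y X X' z \<in> carrier (H X X')" using z by simp
    moreover have "carrier (H X X') = I (c j) (c j \<inter> Y) X X' ` carrier (H (c j) (c j \<inter> Y))"
      using attach_cell_surj[of "c j" X' "b j" p] X' insert.prems(1)[of j] int
      unfolding H_def I_def X_def by simp
    ultimately obtain w where w: "w \<in> carrier (H (c j) (c j \<inter> Y))"
      "I X Y X X' z = I (c j) (c j \<inter> Y) X X' w" by auto
    define w' where "w' = I (c j) (c j \<inter> Y) X Y w"
    have w': "w' \<in> carrier (H X Y)" unfolding w'_def H_def I_def by (rule hom_induced_carrier)
    have "I X Y X X' w' = I (c j) (c j \<inter> Y) X X' w"
      unfolding w'_def I_def by (rule hom_induced_id_compose) (use sub in \<open>auto simp: X_def\<close>)
    then have "I X Y X X' (z \<otimes>\<^bsub>H X Y\<^esub> inv\<^bsub>H X Y\<^esub> w') = \<one>\<^bsub>H X X'\<^esub>"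
      using z w' w(2) i.hom_closed[OF w'] by simp
    then have "z \<otimes>\<^bsub>H X Y\<^esub> inv\<^bsub>H X Y\<^esub> w' \<in> kernel (H X Y) (H X X') (I X Y X X')"
      using z w' by (simp add: kernel_def)
    then obtain y where y: "y \<in> carrier (H X' Y)" "z \<otimes>\<^bsub>H X Y\<^esub> inv\<^bsub>H X Y\<^esub> w' = I X' Y X Y y"
      using triple_exact_middle[OF sub, of p] unfolding H_def I_def by auto
    have "z = I X' Y X Y y \<otimes>\<^bsub>H X Y\<^esub> w'" using z w' by (simp flip: y(2) add: HX.m_assoc)
    moreover have "w' \<in> generate (H X Y) S" using w by (auto simp: w'_def S_def intro: generate.incl)
    ultimately show ?thesis using IH'[OF y(1)] by (auto intro: generate.eng)
  qed
  then show ?case unfolding X unfolding S_def H_def I_def by blast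
qed

section \<open>Geometry of a product of simplices\<close>

lemma homotopic_with_top_of_set:
  fixes S :: "'a::topological_space set" and U :: "'b::topological_space set"
  assumes "continuous_on ({0..1} \<times> S) (\<lambda>(t, x). h t x)"
    and "\<And>t x. t \<in> {0..1::real} \<Longrightarrow> x \<in> S \<Longrightarrow> h t x \<in> U"
    and "\<And>x. x \<in> S \<Longrightarrow> h 0 x = f x" "\<And>x. x \<in> S \<Longrightarrow> h 1 x = g x"
  shows "homotopic_with (\<lambda>_. True) (top_of_set S) (top_of_set U) f g"
proof (subst homotopic_with)
  show "\<exists>k. continuous_map (prod_topology (top_of_set {0..1::real}) (top_of_set S)) (top_of_set U) k \<and>
      (\<forall>x\<in>topspace (top_of_set S). k (0, x) = f x) \<and> (\<forall>x\<in>topspace (top_of_set S). k (1, x) = g x) \<and>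
      (\<forall>t\<in>{0..1::real}. True)"
  proof (intro exI[of _ "\<lambda>(t, x). h t x"] conjI)
    have "prod_topology (top_of_set {0..1::real}) (top_of_set S) = top_of_set ({0..1} \<times> S)"
      by (simp add: subtopology_Times[symmetric] euclidean_product_topology)
    then show "continuous_map (prod_topology (top_of_set {0..1::real}) (top_of_set S)) (top_of_set U) (\<lambda>(t, x). h t x)"
      using assms(1,2) by (auto simp: continuous_map_in_subtopology)
  qed (use assms in auto)
qed simp

lemma continuous_on_apply2:
  fixes f :: "'a::topological_space \<Rightarrow> 't \<Rightarrow> 'v \<Rightarrow> real"
  assumes "continuous_on S f"
  shows "continuous_on S (\<lambda>z. f z x v)"
  using continuous_on_product_then_coordinatewise[OF continuous_on_product_then_coordinatewise[OF assms]] .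

lemma continuous_on_Min:
  fixes f :: "'i \<Rightarrow> 'a::topological_space \<Rightarrow> real"
  assumes "finite K" "\<And>k. k \<in> K \<Longrightarrow> continuous_on S (f k)"
  shows "continuous_on S (\<lambda>z. Min (insert 1 ((\<lambda>k. f k z) ` K)))"
  using assms
proof (induction K rule: finite_induct)
  case (insert k K)
  have "Min (insert 1 ((\<lambda>k. f k z) ` insert k K)) = min (f k z) (Min (insert 1 ((\<lambda>k. f k z) ` K)))" for z
    using insert.hyps by (simp add: insert_commute[of 1])
  then show ?case using insert by (simp add: continuous_on_min)
qed simp

locale product_cell =
  fixes T :: "'t graph" and \<alpha> :: "'t \<Rightarrow> 'v set"
  assumes finite_verts: "finite (verts T)"
    and finite_cell: "\<And>x. x \<in> verts T \<Longrightarrow> finite (\<alpha> x)"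
    and nonempty_cell: "\<And>x. x \<in> verts T \<Longrightarrow> \<alpha> x \<noteq> {}"
begin

abbreviation "c \<equiv> hom_cell T \<alpha>"

definition bd :: "('t \<Rightarrow> 'v \<Rightarrow> real) set" where
  "bd = {p \<in> c. \<exists>x\<in>verts T. \<exists>v\<in>\<alpha> x. p x v = 0}"

definition n :: "'t \<Rightarrow> real" where "n x = real (card (\<alpha> x))"

definition b :: "'t \<Rightarrow> 'v \<Rightarrow> real" where
  "b x v = (if x \<in> verts T \<and> v \<in> \<alpha> x then 1 / n x else 0)"

definition K :: "('t \<times> 'v) set" where "K = (SIGMA x:verts T. \<alpha> x)"

text \<open>
  Since \<open>\<mu>\<close> vanishes on the boundary and is 1 only at the barycentre \<open>b\<close>, the map
  \<open>\<lambda>p. ray (1 / (1 - \<mu> p)) p\<close> is the radial projection to the boundary.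
\<close>

definition ray :: "real \<Rightarrow> ('t \<Rightarrow> 'v \<Rightarrow> real) \<Rightarrow> 't \<Rightarrow> 'v \<Rightarrow> real" where
  "ray s p = (\<lambda>x v. b x v + s * (p x v - b x v))"

text \<open>The smallest coordinate relative to the barycentre. The entry 1 supplies the value when
  \<open>K\<close> is empty; otherwise every point of the cell has a coordinate at most that of the
  barycentre.\<close>

definition \<mu> :: "('t \<Rightarrow> 'v \<Rightarrow> real) \<Rightarrow> real" where
  "\<mu> p = Min (insert 1 ((\<lambda>(x, v). n x * p x v) ` K))"

lemma n_pos: "x \<in> verts T \<Longrightarrow> n x > 0"
  using finite_cell nonempty_cell by (simp add: n_def card_gt_0_iff)

lemma finite_K: "finite K"
  unfolding K_def using finite_verts finite_cell by blast

lemma cell_iff: "p \<in> c \<longleftrightarrow> (\<forall>x v. 0 \<le> p x v) \<and> (\<forall>x v. (x, v) \<notin> K \<longrightarrow> p x v = 0) \<and>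
    (\<forall>x\<in>verts T. (\<Sum>v\<in>\<alpha> x. p x v) = 1)"
proof
  assume p: "p \<in> c"
  have "0 \<le> p x v" for x v using p by (cases "x \<in> verts T") (auto simp: hom_cell_def simplex_on_def)
  moreover have "p x v = 0" if "(x, v) \<notin> K" for x v
    using p that by (cases "x \<in> verts T") (auto simp: hom_cell_def simplex_on_def K_def)
  ultimately show "(\<forall>x v. 0 \<le> p x v) \<and> (\<forall>x v. (x, v) \<notin> K \<longrightarrow> p x v = 0) \<and>
    (\<forall>x\<in>verts T. (\<Sum>v\<in>\<alpha> x. p x v) = 1)"
    using p by (auto simp: hom_cell_def simplex_on_def)
qed (auto simp: hom_cell_def simplex_on_def K_def fun_eq_iff)

lemma closed_cell: "closed c"
proof -
  have "(\<forall>x v. (x, v) \<notin> K \<longrightarrow> p x v = 0) \<longleftrightarrow> (\<forall>z\<in>-K. p (fst z) (snd z) = 0)"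
    for p :: "'t \<Rightarrow> 'v \<Rightarrow> real" by force
  then have "c = (\<Inter>x v. {p. 0 \<le> p x v}) \<inter> (\<Inter>z\<in>-K. {p. p (fst z) (snd z) = 0}) \<inter>
      (\<Inter>x\<in>verts T. {p. (\<Sum>v\<in>\<alpha> x. p x v) = 1})"
    by (simp add: set_eq_iff cell_iff)
  moreover have "continuous_on UNIV (\<lambda>p :: 't \<Rightarrow> 'v \<Rightarrow> real. p x v)" for x v
    by (rule continuous_on_apply2) (rule continuous_on_id)
  ultimately show ?thesis
    by (auto intro!: closed_Int closed_INT closed_Collect_le closed_Collect_eq continuous_intros)
qed

lemma closed_point: "closed {q :: 't \<Rightarrow> 'v \<Rightarrow> real}"
proof -
  have "{q} = (\<Inter>x v. {p. p x v = q x v})" by (auto simp: fun_eq_iff)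
  moreover have "continuous_on UNIV (\<lambda>p :: 't \<Rightarrow> 'v \<Rightarrow> real. p x v)" for x v
    by (rule continuous_on_apply2) (rule continuous_on_id)
  ultimately show ?thesis
    by (auto intro!: closed_INT closed_Collect_eq continuous_intros)
qed

lemma sum_b: "x \<in> verts T \<Longrightarrow> (\<Sum>v\<in>\<alpha> x. b x v) = 1"
  using n_pos[of x] by (simp add: b_def n_def)

lemma b_cell: "b \<in> c"
  using n_pos sum_b by (auto simp: cell_iff b_def K_def less_imp_le)

lemma b_pos: "(x, v) \<in> K \<Longrightarrow> b x v = 1 / n x \<and> n x > 0"
  using n_pos by (auto simp: b_def K_def)

lemma b_not_bd: "b \<notin> bd"
proof -
  have "b x v \<noteq> 0" if "x \<in> verts T" "v \<in> \<alpha> x" for x v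
    using b_pos[of x v] that by (auto simp: K_def)
  then show ?thesis by (auto simp: bd_def)
qed

lemma sum_ray: "p \<in> c \<Longrightarrow> x \<in> verts T \<Longrightarrow> (\<Sum>v\<in>\<alpha> x. ray s p x v) = 1"
  using sum_b[of x] by (simp add: ray_def sum.distrib sum_distrib_left[symmetric] sum_subtractf cell_iff)

lemma ray_outside: "p \<in> c \<Longrightarrow> (x, v) \<notin> K \<Longrightarrow> ray s p x v = 0"
  by (auto simp: ray_def cell_iff b_def K_def)

lemma \<mu>_le: "(x, v) \<in> K \<Longrightarrow> \<mu> p \<le> n x * p x v"
  unfolding \<mu>_def by (rule Min_le) (use finite_K in force)+

lemma \<mu>_le_1: "\<mu> p \<le> 1"
  unfolding \<mu>_def by (rule Min_le) (use finite_K in auto)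

lemma \<mu>_attained: "\<mu> p < 1 \<Longrightarrow> \<exists>(x, v)\<in>K. n x * p x v = \<mu> p"
proof -
  assume "\<mu> p < 1"
  moreover have "\<mu> p \<in> insert 1 ((\<lambda>(x, v). n x * p x v) ` K)"
    unfolding \<mu>_def by (rule Min_in) (use finite_K in auto)
  ultimately show ?thesis by force
qed

lemma \<mu>_nonneg:
  assumes "p \<in> c"
  shows "0 \<le> \<mu> p"
proof (cases "\<mu> p < 1")
  case True
  then obtain x v where xv: "(x, v) \<in> K" "n x * p x v = \<mu> p" using \<mu>_attained by blast
  have "0 \<le> p x v" using assms by (simp add: cell_iff)
  then show ?thesis using b_pos[OF xv(1)] by (simp add: xv(2)[symmetric])
qed simp

lemma \<mu>_bd: "p \<in> bd \<Longrightarrow> \<mu> p = 0"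
proof -
  assume "p \<in> bd"
  then obtain x v where "(x, v) \<in> K" "p x v = 0" "p \<in> c" by (auto simp: bd_def K_def)
  then show ?thesis using \<mu>_le[of x v p] \<mu>_nonneg[of p] by simp
qed

text \<open>If no coordinate falls below that of the barycentre, equality of the sums in each factor
  leaves no room for a larger one.\<close>

lemma \<mu>_less_1:
  assumes "p \<in> c" "p \<noteq> b"
  shows "\<mu> p < 1"
proof (rule ccontr)
  assume "\<not> \<mu> p < 1"
  then have ge: "n x * p x v \<ge> 1" if "(x, v) \<in> K" for x v using \<mu>_le[OF that, of p] by simp
  have "p x v = b x v" for x v
  proof (cases "(x, v) \<in> K")
    case True
    then have x: "x \<in> verts T" "v \<in> \<alpha> x" by (auto simp: K_def)
    have "(\<Sum>v\<in>\<alpha> x. p x v - b x v) = 0"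
      using sum_b[OF x(1)] assms(1) x(1) by (simp add: sum_subtractf cell_iff)
    moreover have "0 \<le> p x v - b x v" if "v \<in> \<alpha> x" for v
      using ge[of x v] b_pos[of x v] x(1) that by (auto simp: K_def field_simps)
    ultimately have "\<forall>v\<in>\<alpha> x. p x v - b x v = 0"
      using sum_nonneg_eq_0_iff[of "\<alpha> x" "\<lambda>v. p x v - b x v"] finite_cell[OF x(1)] by simp
    then show ?thesis using x(2) by simp
  next
    case False
    then show ?thesis using assms(1) by (auto simp: cell_iff b_def K_def)
  qed
  then show False using assms(2) by (simp add: fun_eq_iff)
qed

text \<open>A relative coordinate \<open>q = n x * p x v\<close> becomes
  \<open>1 - s * (1 - q)\<close>, and \<open>q\<close> is at least \<open>\<mu> p\<close>. The bound
  on \<open>s\<close> is the point where the ray leaves the cell.\<close>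

lemma ray_cell:
  assumes "p \<in> c" "0 \<le> s" "s * (1 - \<mu> p) \<le> 1"
  shows "ray s p \<in> c"
proof -
  have "0 \<le> ray s p x v" for x v
  proof (cases "(x, v) \<in> K")
    case True
    have "s * (1 - n x * p x v) \<le> 1"
      using mult_left_mono[OF _ assms(2), of "1 - n x * p x v" "1 - \<mu> p"] \<mu>_le[OF True, of p] assms(3) by linarith
    moreover have "n x * ray s p x v = 1 - s * (1 - n x * p x v)"
      using b_pos[OF True] by (simp add: ray_def algebra_simps)
    ultimately have "0 \<le> n x * ray s p x v" by linarith
    then show ?thesis using b_pos[OF True] by (simp add: zero_le_mult_iff)
  qed (use ray_outside[OF assms(1)] in simp)
  then show ?thesis using ray_outside[OF assms(1)] sum_ray[OF assms(1)] unfolding cell_iff by blast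
qed

lemma ray_eq_b: "ray s p = b \<Longrightarrow> s \<noteq> 0 \<Longrightarrow> p = b"
  by (auto simp: ray_def fun_eq_iff)

lemma continuous_on_ray:
  assumes "continuous_on S s" "continuous_on S f"
  shows "continuous_on S (\<lambda>z. ray (s z) (f z))"
  unfolding ray_def
  by (rule continuous_on_coordinatewise_then_product, rule continuous_on_coordinatewise_then_product)
    (intro continuous_on_add continuous_on_mult continuous_on_diff continuous_on_const
      assms(1) continuous_on_apply2[OF assms(2)])

lemma continuous_on_\<mu>: "continuous_on S \<mu>"
  unfolding \<mu>_def
  by (rule continuous_on_Min[OF finite_K])
    (auto intro!: continuous_on_mult continuous_on_const continuous_on_apply2[OF continuous_on_id])

lemma conical_cell: "conical c bd b"
proof -
  \<comment> \<open>Linear in \<open>t\<close>, from 1, where the ray is at \<open>p\<close>, to the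
    parameter at which it meets the boundary.\<close>
  define s where "s t p = 1 - t + t / (1 - \<mu> p)" for t p
  have s1: "s t p * (1 - \<mu> p) = (1 - t) * (1 - \<mu> p) + t" if "p \<in> c - {b}" for t p
    using \<mu>_less_1[of p] that by (simp add: s_def field_simps)
  have s: "0 < s t p" "s t p * (1 - \<mu> p) \<le> 1" if "t \<in> {0..1}" "p \<in> c - {b}" for t p
  proof -
    have m: "0 \<le> \<mu> p" "\<mu> p < 1" using \<mu>_nonneg \<mu>_less_1 that by auto
    have "(1 - t) * (1 - \<mu> p) \<le> (1 - t) * 1" by (rule mult_left_mono) (use m that in auto)
    then show "s t p * (1 - \<mu> p) \<le> 1" unfolding s1[OF that(2)] by simp
    have "t / (1 - \<mu> p) \<ge> t" using m that by (simp add: field_simps mult_left_le)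
    moreover have "1 - t > 0 \<or> t / (1 - \<mu> p) > 0" using m that by (cases "t = 0") auto
    ultimately show "0 < s t p" using that unfolding s_def by auto
  qed
  have "ray (s t p) p \<in> c - {b}" if "t \<in> {0..1}" "p \<in> c - {b}" for t p
    using ray_cell[of p "s t p"] s[OF that] ray_eq_b[of "s t p" p] that by auto
  moreover have "ray (s 0 p) p = p" for p by (simp add: s_def ray_def)
  moreover have "ray (s 1 p) p \<in> bd" if p: "p \<in> c - {b}" for p
  proof -
    have m: "\<mu> p < 1" using \<mu>_less_1 p by auto
    then obtain x v where xv: "(x, v) \<in> K" "n x * p x v = \<mu> p" using \<mu>_attained by blast
    have "p x v = \<mu> p / n x" using xv b_pos[OF xv(1)] by (simp add: field_simps)
    then have "ray (s 1 p) p x v = 0" using m b_pos[OF xv(1)] by (simp add: ray_def s_def field_simps)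
    moreover have "ray (s 1 p) p \<in> c" using ray_cell[of p "s 1 p"] s[of 1 p] p by auto
    ultimately show ?thesis using xv(1) by (auto simp: bd_def K_def)
  qed
  moreover have "ray (s t p) p = p" if "p \<in> bd" for t p
    using \<mu>_bd[OF that] by (simp add: s_def ray_def)
  moreover have "continuous_on ({0..1} \<times> (c - {b})) (\<lambda>(t, p). ray (s t p) p)"
  proof -
    have "continuous_on ({0..1} \<times> (c - {b})) (\<lambda>z :: real \<times> ('t \<Rightarrow> 'v \<Rightarrow> real). \<mu> (snd z))"
      using continuous_on_compose[OF continuous_on_snd[OF continuous_on_id] continuous_on_\<mu>]
      by (simp add: comp_def)
    then have "continuous_on ({0..1} \<times> (c - {b})) (\<lambda>z. ray (s (fst z) (snd z)) (snd z))"
      unfolding s_def by (intro continuous_on_ray continuous_intros) (use \<mu>_less_1 in force)+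
    then show ?thesis by (simp add: case_prod_unfold)
  qed
  ultimately show ?thesis
    unfolding conical_def using closed_cell closed_point b_cell b_not_bd
    by (intro conjI exI[of _ "\<lambda>t p. ray (s t p) p"]) (auto simp: bd_def)
qed

lemma contractible_cell: "contractible_space (top_of_set c)"
proof -
  have "homotopic_with (\<lambda>_. True) (top_of_set c) (top_of_set c) id (\<lambda>p. b)"
  proof (rule homotopic_with_top_of_set[where h = "\<lambda>t. ray (1 - t)"])
    have "continuous_on ({0..1} \<times> c) (\<lambda>z. ray (1 - fst z) (snd z))"
      by (intro continuous_on_ray continuous_intros)
    then show "continuous_on ({0..1} \<times> c) (\<lambda>(t, x). ray (1 - t) x)" by (simp add: case_prod_unfold)
    show "ray (1 - t) p \<in> c" if "t \<in> {0..1}" "p \<in> c" for t p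
    proof (rule ray_cell)
      show "(1 - t) * (1 - \<mu> p) \<le> 1"
        by (rule mult_le_one) (use that \<mu>_nonneg[of p] \<mu>_le_1[of p] in auto)
    qed (use that in auto)
  qed (auto simp: ray_def)
  then show ?thesis unfolding contractible_space_def by blast
qed

end

definition cell_dim :: "'t graph \<Rightarrow> ('t \<Rightarrow> 'v set) \<Rightarrow> nat" where
  "cell_dim T \<alpha> = (\<Sum>x\<in>verts T. card (\<alpha> x) - 1)"

context product_cell begin

lemma convex_cell:
  assumes "p \<in> c" "q \<in> c" "t \<in> {0..1}"
  shows "(\<lambda>x v. (1 - t) * p x v + t * q x v) \<in> c"
  using assms by (auto simp: cell_iff sum.distrib sum_distrib_left[symmetric])

lemma sum_ray_diff: "p \<in> c \<Longrightarrow> x \<in> verts T \<Longrightarrow> (\<Sum>v\<in>\<alpha> x. p x v - b x v) = 0"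
  using sum_b by (simp add: sum_subtractf cell_iff)

text \<open>
  Coordinates on the affine hull: one base vertex \<open>v\<^sub>0 x\<close> of each factor is dropped, and the remaining
  pairs are numbered by \<open>e\<close>. Normalising, the punctured cell becomes a sphere up to homotopy.
\<close>

lemma punctured_cell_sphere:
  assumes k: "cell_dim T \<alpha> = Suc m"
  shows "top_of_set (c - {b}) homotopy_equivalent_space nsphere m"
proof -
  define v0 where "v0 x = (SOME v. v \<in> \<alpha> x)" for x
  have v0: "v0 x \<in> \<alpha> x" if "x \<in> verts T" for x
    unfolding v0_def using nonempty_cell[OF that] by (simp add: some_in_eq)
  define J where "J = (SIGMA x:verts T. \<alpha> x - {v0 x})"
  have JK: "J \<subseteq> K" by (auto simp: J_def K_def)
  have finJ: "finite J" by (rule finite_subset[OF JK finite_K])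
  have "card J = (\<Sum>x\<in>verts T. card (\<alpha> x - {v0 x}))"
    unfolding J_def by (rule card_SigmaI) (use finite_verts finite_cell in auto)
  also have "\<dots> = Suc m"
    unfolding k[symmetric] cell_dim_def by (rule sum.cong) (use v0 in \<open>auto simp: card_Diff_singleton\<close>)
  finally have cardJ: "card J = Suc m" .
  then obtain e where e: "bij_betw e {..<Suc m} J"
    using finJ ex_bij_betw_nat_finite[of J] by (auto simp: atLeast0LessThan)
  define e' where "e' = the_inv_into {..<Suc m} e"
  have e'e: "e' (e j) = j" if "j \<le> m" for j
    using that e by (auto simp: e'_def bij_betw_def the_inv_into_f_f)
  have ee': "e (e' z) = z" "e' z \<le> m" if "z \<in> J" for z
  proof -
    show "e (e' z) = z" using that e by (auto simp: e'_def bij_betw_def f_the_inv_into_f)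
    have "e' z \<in> {..<Suc m}" unfolding e'_def using bij_betwE[OF bij_betw_the_inv_into[OF e]] that by blast
    then show "e' z \<le> m" by simp
  qed
  have eJ: "e j \<in> J" if "j \<le> m" for j using that e by (auto simp: bij_betw_def)
  define y where "y p j = p (fst (e j)) (snd (e j)) - b (fst (e j)) (snd (e j))" for p :: "'t \<Rightarrow> 'v \<Rightarrow> real" and j
  define N where "N p = sqrt (\<Sum>j\<le>m. (y p j)\<^sup>2)" for p
  define F where "F p j = (if j \<le> m then y p j / N p else 0)" for p and j :: nat
  \<comment> \<open>Inverse to taking coordinates on vectors with sum zero in each factor: the base
    vertex carries minus the sum of the others.\<close>
  define u where "u w x v = (if (x, v) \<in> J then w (e' (x, v)) else if x \<in> verts T \<and> v = v0 x
    then - (\<Sum>v'\<in>\<alpha> x - {v0 x}. w (e' (x, v'))) else 0)" for w :: "nat \<Rightarrow> real" and x v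
  \<comment> \<open>On the unit sphere \<open>u\<close> is at most \<open>m + 1\<close> in absolute
    value, and the barycentre has coordinates at least \<open>1 / (m + 2)\<close>, so this scale
    keeps the embedded sphere inside the cell.\<close>
  define \<epsilon> where "\<epsilon> = 1 / ((real m + 2) * (real m + 2))"
  define G where "G w = (\<lambda>x v. b x v + \<epsilon> * u w x v)" for w
  have \<epsilon>: "\<epsilon> > 0" by (simp add: \<epsilon>_def)
  define S where "S = {w :: nat \<Rightarrow> real. (\<Sum>j\<le>m. (w j)\<^sup>2) = 1 \<and> (\<forall>j>m. w j = 0)}"
  have sphere: "nsphere m = top_of_set S"
    unfolding nsphere S_def euclidean_product_topology ..
  have u_base: "u w x (v0 x) = - (\<Sum>v'\<in>\<alpha> x - {v0 x}. w (e' (x, v')))" if "x \<in> verts T" for w x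
    using that by (simp add: u_def J_def)
  have sum_split: "sum f (\<alpha> x) = f (v0 x) + sum f (\<alpha> x - {v0 x})" if "x \<in> verts T" for x and f :: "'v \<Rightarrow> real"
    by (rule sum.remove) (use finite_cell v0 that in auto)
  have sum_u: "(\<Sum>v\<in>\<alpha> x. u w x v) = 0" if x: "x \<in> verts T" for w x
  proof -
    have "(\<Sum>v\<in>\<alpha> x - {v0 x}. u w x v) = (\<Sum>v\<in>\<alpha> x - {v0 x}. w (e' (x, v)))"
      by (rule sum.cong) (use x in \<open>auto simp: u_def J_def\<close>)
    then show ?thesis using u_base[OF x] by (simp add: sum_split[OF x])
  qed
  have u_outside: "u w x v = 0" if "(x, v) \<notin> K" for w x v
    using that JK v0 by (auto simp: u_def K_def)
  have card_le: "card (\<alpha> x - {v0 x}) \<le> Suc m" "n x \<le> real m + 2" if x: "x \<in> verts T" for x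
  proof -
    have "card (Pair x ` (\<alpha> x - {v0 x})) \<le> card J"
      by (rule card_mono[OF finJ]) (use x in \<open>auto simp: J_def\<close>)
    then show 1: "card (\<alpha> x - {v0 x}) \<le> Suc m" by (simp add: card_image inj_on_def cardJ)
    have "card (\<alpha> x) = Suc (card (\<alpha> x - {v0 x}))"
      using card_Suc_Diff1[OF finite_cell[OF x] v0[OF x]] by simp
    then show "n x \<le> real m + 2" using 1 by (simp add: n_def)
  qed
  have S_le: "\<bar>w j\<bar> \<le> 1" if "w \<in> S" "j \<le> m" for w j
  proof -
    have "(w j)\<^sup>2 \<le> (\<Sum>j\<le>m. (w j)\<^sup>2)" by (rule member_le_sum) (use that in auto)
    then show ?thesis using that by (simp add: S_def abs_square_le_1)
  qed
  have u_le: "\<bar>u w x v\<bar> \<le> real m + 1" if w: "w \<in> S" for w x v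
  proof (cases "(x, v) \<in> J")
    case True
    then show ?thesis using S_le[OF w ee'(2)[OF True]] by (simp add: u_def)
  next
    case False
    show ?thesis
    proof (cases "x \<in> verts T \<and> v = v0 x")
      case True
      have "\<bar>\<Sum>v'\<in>\<alpha> x - {v0 x}. w (e' (x, v'))\<bar> \<le> (\<Sum>v'\<in>\<alpha> x - {v0 x}. 1)"
        by (rule order_trans[OF sum_abs sum_mono]) (use S_le[OF w] ee'(2) True in \<open>auto simp: J_def\<close>)
      also have "\<dots> \<le> real m + 1" using card_le(1)[of x] True by simp
      finally show ?thesis using True u_base by simp
    qed (use False \<open>(x, v) \<notin> J\<close> in \<open>auto simp: u_def\<close>)
  qed
  have G_cell: "G w \<in> c" if w: "w \<in> S" for w
  proof -
    have "0 \<le> G w x v" for x v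
    proof (cases "(x, v) \<in> K")
      case True
      then have x: "x \<in> verts T" by (simp add: K_def)
      have "\<epsilon> * \<bar>u w x v\<bar> \<le> \<epsilon> * (real m + 2)"
        by (rule mult_left_mono) (use u_le[OF w, of x v] \<epsilon> in auto)
      also have "\<dots> = 1 / (real m + 2)" by (simp add: \<epsilon>_def)
      also have "\<dots> \<le> b x v" using card_le(2)[OF x] b_pos[OF True] by (simp add: frac_le)
      finally have "\<bar>\<epsilon> * u w x v\<bar> \<le> b x v" using \<epsilon> by (simp add: abs_mult)
      then show ?thesis unfolding G_def by linarith
    qed (use u_outside b_cell in \<open>auto simp: G_def cell_iff\<close>)
    moreover have "G w x v = 0" if "(x, v) \<notin> K" for x v
      using u_outside[OF that] b_cell that by (simp add: G_def cell_iff)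
    moreover have "(\<Sum>v\<in>\<alpha> x. G w x v) = 1" if "x \<in> verts T" for x
      using sum_u[OF that] sum_b[OF that] by (simp add: G_def sum.distrib sum_distrib_left[symmetric])
    ultimately show ?thesis unfolding cell_iff by blast
  qed
  have yG: "y (G w) j = \<epsilon> * w j" if "j \<le> m" for w j
    using eJ[OF that] e'e[OF that] by (simp add: y_def G_def u_def)
  have G_ne: "G w \<noteq> b" if "w \<in> S" for w
  proof
    assume "G w = b"
    then have "w j = 0" if "j \<le> m" for j using yG[OF that, of w] \<epsilon> by (simp add: y_def)
    then show False using \<open>w \<in> S\<close> by (simp add: S_def)
  qed
  have FG: "F (G w) = w" if w: "w \<in> S" for w
  proof -
    have "(\<Sum>j\<le>m. (y (G w) j)\<^sup>2) = \<epsilon>\<^sup>2 * (\<Sum>j\<le>m. (w j)\<^sup>2)"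
      unfolding sum_distrib_left by (rule sum.cong) (auto simp: yG power_mult_distrib)
    then have "N (G w) = \<epsilon>" using w \<epsilon> by (simp add: N_def S_def)
    then show ?thesis using w yG \<epsilon> by (auto simp: F_def S_def fun_eq_iff)
  qed
  have uy: "p x v - b x v = u (y p) x v" if p: "p \<in> c" for p x v
  proof -
    have J: "p x v - b x v = y p (e' (x, v))" if "(x, v) \<in> J" for x v
      using ee'(1)[OF that] by (simp add: y_def)
    show ?thesis
    proof (cases "(x, v) \<in> K")
      case False
      then show ?thesis using u_outside[OF False] p b_cell by (simp add: cell_iff)
    next
      case True
      show ?thesis
      proof (cases "(x, v) \<in> J")
        case True
        then show ?thesis using J by (simp add: u_def)
      next
        case False
        then have x: "x \<in> verts T" "v = v0 x" using True by (auto simp: J_def K_def)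
        have "(\<Sum>v'\<in>\<alpha> x - {v0 x}. p x v' - b x v') = (\<Sum>v'\<in>\<alpha> x - {v0 x}. y p (e' (x, v')))"
          by (rule sum.cong) (use J x in \<open>auto simp: J_def\<close>)
        then show ?thesis using sum_ray_diff[OF p x(1)] u_base[OF x(1)] x(2)
          by (simp add: sum_split[OF x(1)])
      qed
    qed
  qed
  have N_pos: "N p > 0" if p: "p \<in> c - {b}" for p
  proof -
    have "\<exists>j\<le>m. y p j \<noteq> 0"
    proof (rule ccontr)
      assume "\<not> ?thesis"
      then have "y p (e' z) = 0" if "z \<in> J" for z using ee'(2)[OF that] by auto
      then have "u (y p) x v = 0" for x v by (auto simp: u_def J_def)
      then have "p = b" using uy[of p] p by (auto simp: fun_eq_iff)
      then show False using p by simp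
    qed
    then have "0 < (\<Sum>j\<le>m. (y p j)\<^sup>2)" by (auto intro!: sum_pos2)
    then show ?thesis by (simp add: N_def)
  qed
  have F_S: "F p \<in> S" if p: "p \<in> c - {b}" for p
  proof -
    have "(\<Sum>j\<le>m. (F p j)\<^sup>2) = (\<Sum>j\<le>m. (y p j)\<^sup>2) / (N p)\<^sup>2"
      unfolding sum_divide_distrib by (rule sum.cong) (auto simp: F_def power_divide)
    moreover have "(N p)\<^sup>2 = (\<Sum>j\<le>m. (y p j)\<^sup>2)" by (simp add: N_def sum_nonneg)
    ultimately show ?thesis using N_pos[OF p] by (simp add: S_def F_def) (metis div_self power_eq_0_iff less_irrefl)
  qed
  \<comment> \<open>Going to the sphere and back moves \<open>p\<close> along its own ray, so the
    straight homotopy to the identity stays in the cell and misses \<open>b\<close>.\<close>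
  have GF: "G (F p) = ray (\<epsilon> / N p) p" if p: "p \<in> c - {b}" for p
  proof -
    have F: "F p (e' z) = y p (e' z) / N p" if "z \<in> J" for z using ee'(2)[OF that] by (simp add: F_def)
    have "u (F p) x v = u (y p) x v / N p" for x v
    proof -
      have "(\<Sum>v'\<in>\<alpha> x - {v0 x}. F p (e' (x, v'))) = (\<Sum>v'\<in>\<alpha> x - {v0 x}. y p (e' (x, v'))) / N p"
        if "x \<in> verts T" unfolding sum_divide_distrib
        by (rule sum.cong) (use F that in \<open>auto simp: J_def\<close>)
      then show ?thesis using F by (simp add: u_def)
    qed
    then show ?thesis using uy[of p] p by (simp add: G_def ray_def)
  qed
  have cont_y: "continuous_on A (\<lambda>p. y p j)" for A j
    unfolding y_def by (intro continuous_on_diff continuous_on_const continuous_on_apply2[OF continuous_on_id])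
  have cont_N: "continuous_on A N" for A
    unfolding N_def by (intro continuous_on_real_sqrt continuous_on_sum continuous_on_power cont_y)
  have cont_F: "continuous_on (c - {b}) F"
  proof (rule continuous_on_coordinatewise_then_product)
    fix j
    have "continuous_on (c - {b}) (\<lambda>p. y p j / N p)"
      by (rule continuous_on_divide[OF cont_y cont_N]) (use N_pos in force)
    then show "continuous_on (c - {b}) (\<lambda>p. F p j)" by (cases "j \<le> m") (simp_all add: F_def)
  qed
  have cont_G: "continuous_on A G" for A
  proof -
    have "continuous_on A (\<lambda>w. u w x v)" for x v
    proof -
      have w: "continuous_on A (\<lambda>w :: nat \<Rightarrow> real. w j)" for j
        by (rule continuous_on_product_then_coordinatewise[OF continuous_on_id])
      consider "(x, v) \<in> J" | "(x, v) \<notin> J" "x \<in> verts T \<and> v = v0 x" | "(x, v) \<notin> J" "\<not> (x \<in> verts T \<and> v = v0 x)"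
        by blast
      then show ?thesis
        by cases (auto simp: u_def intro!: continuous_on_minus continuous_on_sum w)
    qed
    then show ?thesis unfolding G_def
      by (intro continuous_on_coordinatewise_then_product continuous_on_add continuous_on_mult continuous_on_const)
  qed
  have hom: "homotopic_with (\<lambda>_. True) (top_of_set (c - {b})) (top_of_set (c - {b})) (G \<circ> F) id"
  proof (rule homotopic_with_symD, rule homotopic_with_top_of_set[where h = "\<lambda>t p. ray (1 - t + t * (\<epsilon> / N p)) p"])
    have N2: "continuous_on ({0..1} \<times> (c - {b})) (\<lambda>z :: real \<times> ('t \<Rightarrow> 'v \<Rightarrow> real). N (snd z))"
      using continuous_on_compose[OF continuous_on_snd[OF continuous_on_id] cont_N] by (simp add: comp_def)
    have "continuous_on ({0..1} \<times> (c - {b})) (\<lambda>z. ray (1 - fst z + fst z * (\<epsilon> / N (snd z))) (snd z))"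
      by (intro continuous_on_ray continuous_on_add continuous_on_diff continuous_on_mult continuous_on_divide
          continuous_on_const continuous_on_fst continuous_on_snd continuous_on_id N2)
        (use N_pos in force)
    then show "continuous_on ({0..1} \<times> (c - {b})) (\<lambda>(t, p). ray (1 - t + t * (\<epsilon> / N p)) p)"
      by (simp add: case_prod_unfold)
    fix t p assume t: "t \<in> {0..1::real}" and p: "p \<in> c - {b}"
    define s where "s = 1 - t + t * (\<epsilon> / N p)"
    have "ray s p = (\<lambda>x v. (1 - t) * p x v + t * ray (\<epsilon> / N p) p x v)"
      by (simp add: ray_def s_def fun_eq_iff algebra_simps)
    also have "\<dots> \<in> c"
      by (rule convex_cell[OF _ _ t]) (use p GF[OF p] G_cell[OF F_S[OF p]] in auto)
    finally have "ray s p \<in> c" .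
    moreover have "s > 0"
    proof (cases "t = 0")
      case False
      then have "t * (\<epsilon> / N p) > 0" using t \<epsilon> N_pos[OF p] by simp
      then show ?thesis using t by (simp add: s_def)
    qed (simp add: s_def)
    then have "ray s p \<noteq> b" using ray_eq_b[of s p] p by auto
    ultimately show "ray (1 - t + t * (\<epsilon> / N p)) p \<in> c - {b}" by (simp add: s_def)
  next
    fix p assume p: "p \<in> c - {b}"
    show "ray (1 - 0 + 0 * (\<epsilon> / N p)) p = id p" by (simp add: ray_def)
    show "ray (1 - 1 + 1 * (\<epsilon> / N p)) p = (G \<circ> F) p" using GF[OF p] by simp
  qed
  have "homotopic_with (\<lambda>_. True) (top_of_set S) (top_of_set S) (F \<circ> G) id"
  proof (rule homotopic_with_equal)
    have "continuous_on S (F \<circ> G)"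
      by (rule continuous_on_compose[OF cont_G continuous_on_subset[OF cont_F]]) (use G_cell G_ne in auto)
    then show "continuous_map (top_of_set S) (top_of_set S) (F \<circ> G)"
      using FG by (simp add: continuous_map_in_subtopology image_subset_iff)
  qed (use FG in auto)
  moreover have "continuous_map (top_of_set (c - {b})) (top_of_set S) F"
    using cont_F F_S by (auto simp: continuous_map_in_subtopology)
  moreover have "continuous_map (top_of_set S) (top_of_set (c - {b})) G"
    using cont_G G_cell G_ne by (auto simp: continuous_map_in_subtopology)
  ultimately show ?thesis
    unfolding homotopy_equivalent_space_def sphere using hom by blast
qed

lemma punctured_cell_iso:
  "hom_induced p (top_of_set c) bd (top_of_set c) (c - {b}) id
    \<in> iso (relative_homology_group p (top_of_set c) bd) (relative_homology_group p (top_of_set c) (c - {b}))"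
proof -
  have sub: "bd \<subseteq> c - {b}" "c - {b} \<subseteq> c" using b_not_bd by (auto simp: bd_def)
  note triv = conical_punctured_trivial[OF conical_cell]
  show ?thesis
    using triple_inj[OF sub triv] triple_surj[OF sub triv] hom_induced_hom
    by (simp add: iso_def bij_betw_def)
qed

text \<open>In dimension 0 the cell is a point with empty boundary. Otherwise the boundary may be
  enlarged to the punctured cell, contractibility of the cell lowers the degree by one, and the
  punctured cell is a sphere up to homotopy.\<close>

lemma relative_homology_cell:
  shows trivial_relative_homology_cell:
    "p \<noteq> int (cell_dim T \<alpha>) \<Longrightarrow> trivial_group (relative_homology_group p (top_of_set c) bd)"
  and cyclic_relative_homology_cell: "cyclic_group (relative_homology_group p (top_of_set c) bd)"
proof -
  let ?R = "relative_homology_group p (top_of_set c) bd"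
  have "(p \<noteq> int (cell_dim T \<alpha>) \<longrightarrow> trivial_group ?R) \<and> cyclic_group ?R"
  proof (cases "cell_dim T \<alpha>")
    case 0
    have card: "card (\<alpha> x) = 1" if "x \<in> verts T" for x
    proof -
      have "card (\<alpha> x) - 1 = 0" using 0 that finite_verts by (simp add: cell_dim_def)
      moreover have "card (\<alpha> x) > 0" using finite_cell nonempty_cell that by (simp add: card_gt_0_iff)
      ultimately show ?thesis by simp
    qed
    have "p = b" if p: "p \<in> c" for p
    proof -
      have "p x v = b x v" for x v
      proof (cases "(x, v) \<in> K")
        case True
        then have x: "x \<in> verts T" "v \<in> \<alpha> x" by (auto simp: K_def)
        have "\<alpha> x = {v}" using card[OF x(1)] x(2) by (auto simp: card_1_singleton_iff)
        then show ?thesis using sum_ray_diff[OF p x(1)] by simp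
      qed (use p b_cell in \<open>simp add: cell_iff\<close>)
      then show ?thesis by (simp add: fun_eq_iff)
    qed
    then have c: "c = {b}" using b_cell by blast
    then have "bd = {}" using b_not_bd by (auto simp: bd_def)
    then show ?thesis
      using homology_dimension_axiom[of "top_of_set {b}" b p] homology_coefficients[of "top_of_set {b}" b]
        isomorphic_group_cyclicity[of "homology_group 0 (top_of_set {b})" integer_group] trivial_imp_cyclic_group
      unfolding c 0 by (cases "p = 0") auto
  next
    case (Suc m)
    let ?P = "reduced_homology_group (p - 1) (top_of_set (c - {b}))"
    let ?S = "reduced_homology_group (p - 1) (nsphere m)"
    have PS: "?P \<cong> ?S"
      by (rule homotopy_equivalent_space_imp_isomorphic_reduced_homology_groups[OF punctured_cell_sphere[OF Suc]])
    have "c - {b} \<noteq> {}"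
    proof -
      obtain g where "continuous_map (nsphere m) (top_of_set (c - {b})) g"
        using punctured_cell_sphere[OF Suc] by (auto simp: homotopy_equivalent_space_def)
      then have "g \<in> topspace (nsphere m) \<rightarrow> c - {b}" by (auto simp: continuous_map_def)
      then show ?thesis using in_topspace_nsphere[of m] by blast
    qed
    then have "relative_homology_group p (top_of_set c) (c - {b}) \<cong> reduced_homology_group (p - 1) (subtopology (top_of_set c) (c - {b}))"
      by (intro isomorphic_group_relative_homology_of_contractible contractible_cell) auto
    also have "subtopology (top_of_set c) (c - {b}) = top_of_set (c - {b})"
      by (simp add: subtopology_subtopology Int_absorb1 Diff_subset)
    finally have "relative_homology_group p (top_of_set c) (c - {b}) \<cong> ?P" .
    then have RS: "?R \<cong> ?S"
      by (rule iso_trans[OF is_isoI[OF punctured_cell_iso] iso_trans[OF _ PS]])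
    have "trivial_group ?R \<longleftrightarrow> trivial_group ?S"
      by (rule isomorphic_group_triviality[OF RS]) simp_all
    moreover have "cyclic_group ?R \<longleftrightarrow> cyclic_group ?S"
      by (rule isomorphic_group_cyclicity[OF RS]) simp_all
    ultimately show ?thesis
      using cyclic_reduced_homology_group_nsphere reduced_homology_group_nsphere(2)[of "p - 1" m] Suc by auto
  qed
  then show "p \<noteq> int (cell_dim T \<alpha>) \<Longrightarrow> trivial_group ?R" "cyclic_group ?R" by auto
qed

end

section \<open>Skeleta of Hom-complexes\<close>

text \<open>The cells of dimension less than \<open>k\<close>, so that the index 0 gives the empty set.\<close>

definition skeleton :: "'t graph \<Rightarrow> 'v graph \<Rightarrow> nat \<Rightarrow> ('t \<Rightarrow> 'v \<Rightarrow> real) set" where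
  "skeleton T G k = (\<Union>\<alpha>\<in>{\<alpha> \<in> multi_homs T G. cell_dim T \<alpha> < k}. hom_cell T \<alpha>)"

definition cells :: "'t graph \<Rightarrow> 'v graph \<Rightarrow> nat \<Rightarrow> ('t \<Rightarrow> 'v set) set" where
  "cells T G k = {\<alpha> \<in> multi_homs T G. cell_dim T \<alpha> = k}"

lemma skeleton_0: "skeleton T G 0 = {}"
  by (simp add: skeleton_def)

lemma skeleton_mono: "k \<le> l \<Longrightarrow> skeleton T G k \<subseteq> skeleton T G l"
  unfolding skeleton_def by force

lemma skeleton_Suc: "skeleton T G (Suc k) = skeleton T G k \<union> \<Union>(hom_cell T ` cells T G k)"
  by (auto simp: skeleton_def cells_def less_Suc_eq)

lemma multi_homs_cell:
  "\<alpha> \<in> multi_homs T G \<Longrightarrow> x \<in> verts T \<Longrightarrow> \<alpha> x \<subseteq> verts G \<and> \<alpha> x \<noteq> {}"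
  unfolding multi_homs_def by blast

lemma multi_homs_eqI:
  assumes "\<alpha> \<in> multi_homs T G" "\<beta> \<in> multi_homs T G" "\<And>x. x \<in> verts T \<Longrightarrow> \<alpha> x = \<beta> x"
  shows "\<alpha> = \<beta>"
proof (rule extensionalityI[OF _ _ assms(3)])
  show "\<alpha> \<in> extensional (verts T)" "\<beta> \<in> extensional (verts T)"
    using assms(1,2) by (simp_all add: multi_homs_def PiE_def)
qed

lemma multi_homs_restrict:
  assumes "\<alpha> \<in> multi_homs T G" "simple_graph T" "\<And>x. x \<in> verts T \<Longrightarrow> \<beta> x \<subseteq> \<alpha> x \<and> \<beta> x \<noteq> {}"
  shows "restrict \<beta> (verts T) \<in> multi_homs T G"
proof -
  have "x \<in> verts T \<and> y \<in> verts T" if "{x, y} \<in> edges T" for x y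
    using assms(2) that unfolding simple_graph_def by (blast dest: doubleton_eq_iff[THEN iffD1])
  then have "\<forall>x y. {x, y} \<in> edges T \<longrightarrow>
      (\<forall>x'\<in>restrict \<beta> (verts T) x. \<forall>y'\<in>restrict \<beta> (verts T) y. {x', y'} \<in> edges G)"
    using assms(1,3) unfolding multi_homs_def by (simp add: subset_eq)
  moreover have "\<beta> x \<subseteq> verts G \<and> \<beta> x \<noteq> {}" if "x \<in> verts T" for x
    using multi_homs_cell[OF assms(1) that] assms(3)[OF that] by blast
  ultimately show ?thesis unfolding multi_homs_def by auto
qed

locale hom_graphs =
  fixes T :: "'t graph" and G :: "'v graph"
  assumes T: "simple_graph T" and G: "simple_graph G"
begin

lemma finite_T: "finite (verts T)" and finite_G: "finite (verts G)"
  using T G by (auto simp: simple_graph_def)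

lemma finite_multi_homs: "finite (multi_homs T G)"
proof (rule finite_subset)
  show "multi_homs T G \<subseteq> verts T \<rightarrow>\<^sub>E Pow (verts G)"
    unfolding multi_homs_def by auto
  show "finite (verts T \<rightarrow>\<^sub>E Pow (verts G))" using finite_T finite_G by (intro finite_PiE) auto
qed

lemma finite_cells: "finite (cells T G k)"
  using finite_multi_homs by (simp add: cells_def)

lemma product_cell: "\<alpha> \<in> multi_homs T G \<Longrightarrow> product_cell T \<alpha>"
  using multi_homs_cell[of \<alpha> T G] finite_T finite_G
  by unfold_locales (auto intro: finite_subset)

lemma cell_dim_mono:
  assumes "\<beta> \<in> multi_homs T G" "\<And>x. x \<in> verts T \<Longrightarrow> \<alpha> x \<subseteq> \<beta> x"
  shows "cell_dim T \<alpha> \<le> cell_dim T \<beta>"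
  unfolding cell_dim_def
  by (rule sum_mono) (use assms product_cell.finite_cell[OF product_cell[OF assms(1)]] in \<open>auto intro!: diff_le_mono card_mono\<close>)

lemma closed_skeleton: "closed (skeleton T G k)"
  unfolding skeleton_def
  by (intro closed_UN) (use finite_multi_homs product_cell.closed_cell product_cell in auto)

text \<open>Off the boundary, a point of \<open>\<alpha>\<close> has every vertex of
  \<open>\<alpha> x\<close> in its support, and the support lies in every cell containing the
  point.\<close>

lemma interior_subset:
  assumes "\<alpha> \<in> multi_homs T G" "\<beta> \<in> multi_homs T G"
    and "p \<in> hom_cell T \<alpha>" "p \<in> hom_cell T \<beta>" "p \<notin> product_cell.bd T \<alpha>" "x \<in> verts T"
  shows "\<alpha> x \<subseteq> \<beta> x"
proof
  fix v assume "v \<in> \<alpha> x"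
  interpret A: product_cell T \<alpha> by (rule product_cell) fact
  interpret B: product_cell T \<beta> by (rule product_cell) fact
  have "p x v \<noteq> 0" using assms \<open>v \<in> \<alpha> x\<close> by (auto simp: A.bd_def)
  then show "v \<in> \<beta> x" using assms(4,6) by (auto simp: B.cell_iff B.K_def)
qed

lemma bd_subset_skeleton:
  assumes "\<alpha> \<in> cells T G k" "p \<in> product_cell.bd T \<alpha>"
  shows "p \<in> skeleton T G k"
proof -
  have \<alpha>: "\<alpha> \<in> multi_homs T G" "cell_dim T \<alpha> = k" using assms(1) by (auto simp: cells_def)
  interpret product_cell T \<alpha> by (rule product_cell) fact
  obtain x0 v0 where x0: "x0 \<in> verts T" "v0 \<in> \<alpha> x0" "p x0 v0 = 0" and p: "p \<in> c"
    using assms(2) by (auto simp: bd_def)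
  \<comment> \<open>The support of \<open>p\<close> gives the smallest cell containing
    \<open>p\<close>, a proper face of \<open>\<alpha>\<close> because a coordinate
    vanishes.\<close>
  define \<beta> where "\<beta> = restrict (\<lambda>x. {v \<in> \<alpha> x. p x v \<noteq> 0}) (verts T)"
  have ne: "{v \<in> \<alpha> x. p x v \<noteq> 0} \<noteq> {}" if "x \<in> verts T" for x
  proof
    assume "{v \<in> \<alpha> x. p x v \<noteq> 0} = {}"
    then have "(\<Sum>v\<in>\<alpha> x. p x v) = 0" by (intro sum.neutral) auto
    then show False using p that by (simp add: cell_iff)
  qed
  have \<beta>: "\<beta> \<in> multi_homs T G"
    unfolding \<beta>_def by (rule multi_homs_restrict[OF \<alpha>(1) T]) (use ne in auto)
  interpret B: product_cell T \<beta> by (rule product_cell) fact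
  have "(\<Sum>v\<in>\<beta> x. p x v) = (\<Sum>v\<in>\<alpha> x. p x v)" if "x \<in> verts T" for x
    by (rule sum.mono_neutral_left) (use that finite_cell in \<open>auto simp: \<beta>_def\<close>)
  moreover have "B.K = {(x, v). (x, v) \<in> K \<and> p x v \<noteq> 0}"
    unfolding B.K_def K_def by (auto simp: \<beta>_def)
  ultimately have "p \<in> B.c" using p unfolding B.cell_iff cell_iff by auto
  moreover have "cell_dim T \<beta> < k"
    unfolding \<alpha>(2)[symmetric] cell_dim_def
  proof (rule sum_strict_mono_ex1[OF finite_T])
    have le: "card (\<beta> x) \<le> card (\<alpha> x)" if "x \<in> verts T" for x
      by (rule card_mono) (use finite_cell that in \<open>auto simp: \<beta>_def\<close>)
    then show "\<forall>x\<in>verts T. card (\<beta> x) - 1 \<le> card (\<alpha> x) - 1" by (simp add: diff_le_mono)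
    have "\<beta> x0 \<subset> \<alpha> x0" using x0 by (auto simp: \<beta>_def)
    then have "card (\<beta> x0) < card (\<alpha> x0)" using finite_cell[OF x0(1)] by (rule psubset_card_mono[rotated])
    moreover have "card (\<beta> x0) > 0" using B.finite_cell B.nonempty_cell x0(1) by (simp add: card_gt_0_iff)
    ultimately show "\<exists>x\<in>verts T. card (\<beta> x) - 1 < card (\<alpha> x) - 1" using x0(1) by (intro bexI[of _ x0]) auto
  qed
  ultimately show ?thesis using \<beta> by (auto simp: skeleton_def)
qed

lemma cell_inter_skeleton:
  assumes "\<alpha> \<in> cells T G k"
  shows "hom_cell T \<alpha> \<inter> skeleton T G k = product_cell.bd T \<alpha>"
proof -
  have \<alpha>: "\<alpha> \<in> multi_homs T G" "cell_dim T \<alpha> = k" using assms by (auto simp: cells_def)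
  interpret product_cell T \<alpha> by (rule product_cell) fact
  have "p \<in> bd" if p: "p \<in> c" "p \<in> skeleton T G k" for p
  proof (rule ccontr)
    assume "p \<notin> bd"
    moreover obtain \<beta> where "\<beta> \<in> multi_homs T G" "cell_dim T \<beta> < k" "p \<in> hom_cell T \<beta>"
      using p(2) by (auto simp: skeleton_def)
    ultimately show False
      using interior_subset[OF \<alpha>(1), of \<beta> p] cell_dim_mono[of \<beta> \<alpha>] p(1) \<alpha>(2) by force
  qed
  moreover have "bd \<subseteq> c" by (auto simp: bd_def)
  ultimately show ?thesis using bd_subset_skeleton[OF assms] by blast
qed

text \<open>A common point outside the skeleton is interior to \<open>\<alpha>\<close>, which makes
  \<open>\<alpha>\<close> a face of \<open>\<beta>\<close>; equal dimensions then force
  equality.\<close>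

lemma cells_inter_subset_skeleton:
  assumes "\<alpha> \<in> cells T G k" "\<beta> \<in> cells T G k" "\<alpha> \<noteq> \<beta>"
  shows "hom_cell T \<alpha> \<inter> hom_cell T \<beta> \<subseteq> skeleton T G k"
proof
  fix p assume p: "p \<in> hom_cell T \<alpha> \<inter> hom_cell T \<beta>"
  have \<alpha>: "\<alpha> \<in> multi_homs T G" "cell_dim T \<alpha> = k" and \<beta>: "\<beta> \<in> multi_homs T G" "cell_dim T \<beta> = k"
    using assms by (auto simp: cells_def)
  interpret A: product_cell T \<alpha> by (rule product_cell) fact
  interpret B: product_cell T \<beta> by (rule product_cell) fact
  show "p \<in> skeleton T G k"
  proof (rule ccontr)
    assume "p \<notin> skeleton T G k"
    then have "p \<notin> A.bd" using bd_subset_skeleton[OF assms(1)] by blast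
    then have sub: "\<alpha> x \<subseteq> \<beta> x" if "x \<in> verts T" for x
      using interior_subset[OF \<alpha>(1) \<beta>(1)] p that by blast
    have le: "card (\<alpha> x) \<le> card (\<beta> x)" if "x \<in> verts T" for x
      using card_mono[OF B.finite_cell sub] that by blast
    have "\<alpha> x = \<beta> x" if x: "x \<in> verts T" for x
    proof (rule ccontr)
      assume "\<alpha> x \<noteq> \<beta> x"
      then have "card (\<alpha> x) < card (\<beta> x)" using psubset_card_mono[OF B.finite_cell[OF x]] sub[OF x] by blast
      moreover have "card (\<alpha> x) > 0" using A.finite_cell A.nonempty_cell x by (simp add: card_gt_0_iff)
      ultimately have "\<exists>x\<in>verts T. card (\<alpha> x) - 1 < card (\<beta> x) - 1" using x by (intro bexI[of _ x]) auto
      then have "cell_dim T \<alpha> < cell_dim T \<beta>" unfolding cell_dim_def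
        by (intro sum_strict_mono_ex1[OF finite_T]) (use le in \<open>auto intro: diff_le_mono\<close>)
      then show False using \<alpha> \<beta> by simp
    qed
    then show False using multi_homs_eqI[OF \<alpha>(1) \<beta>(1)] assms(3) by blast
  qed
qed

abbreviation "skel_rel p k \<equiv> relative_homology_group p (top_of_set (skeleton T G (Suc k))) (skeleton T G k)"

abbreviation "cell_map p k \<alpha> \<equiv> hom_induced p (top_of_set (hom_cell T \<alpha>)) (product_cell.bd T \<alpha>)
  (top_of_set (skeleton T G (Suc k))) (skeleton T G k) id"

abbreviation "cell_homology p \<alpha> \<equiv> relative_homology_group p (top_of_set (hom_cell T \<alpha>)) (product_cell.bd T \<alpha>)"

lemma skeleton_cells_generate:
  "carrier (skel_rel p k) \<subseteq> generate (skel_rel p k) (\<Union>\<alpha>\<in>cells T G k. cell_map p k \<alpha> ` carrier (cell_homology p \<alpha>))"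
proof -
  have cone: "conical (hom_cell T \<alpha>) (hom_cell T \<alpha> \<inter> skeleton T G k) (product_cell.b T \<alpha>)" if "\<alpha> \<in> cells T G k" for \<alpha>
    using product_cell.conical_cell[OF product_cell] that
    unfolding cell_inter_skeleton[OF that] by (simp add: cells_def)
  have eq: "(\<Union>\<alpha>\<in>cells T G k. hom_induced p (top_of_set (hom_cell T \<alpha>)) (hom_cell T \<alpha> \<inter> skeleton T G k)
      (top_of_set (skeleton T G (Suc k))) (skeleton T G k) id
      ` carrier (relative_homology_group p (top_of_set (hom_cell T \<alpha>)) (hom_cell T \<alpha> \<inter> skeleton T G k)))
    = (\<Union>\<alpha>\<in>cells T G k. cell_map p k \<alpha> ` carrier (cell_homology p \<alpha>))"
    by (rule SUP_cong) (auto simp: cell_inter_skeleton)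
  show ?thesis
    by (rule attach_cells_generate[where J = "cells T G k" and Y = "skeleton T G k" and c = "hom_cell T"
        and b = "product_cell.b T" and p = p, folded skeleton_Suc, unfolded eq,
        OF finite_cells closed_skeleton cone cells_inter_subset_skeleton])
qed

lemma trivial_skel_rel:
  assumes "p \<noteq> int k"
  shows "trivial_group (skel_rel p k)"
proof -
  interpret group "skel_rel p k" by simp
  have "cell_map p k \<alpha> ` carrier (cell_homology p \<alpha>) \<subseteq> {\<one>\<^bsub>skel_rel p k\<^esub>}" if "\<alpha> \<in> cells T G k" for \<alpha>
  proof -
    have "trivial_group (cell_homology p \<alpha>)"
      using product_cell.trivial_relative_homology_cell[OF product_cell] that assms by (auto simp: cells_def)
    then show ?thesis
      by (simp add: trivial_group_def group_hom.hom_one[OF hom_induced_group_hom])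
  qed
  then have "(\<Union>\<alpha>\<in>cells T G k. cell_map p k \<alpha> ` carrier (cell_homology p \<alpha>)) \<subseteq> {\<one>\<^bsub>skel_rel p k\<^esub>}" by blast
  from order_trans[OF skeleton_cells_generate mono_generate[OF this]]
  have "carrier (skel_rel p k) \<subseteq> generate (skel_rel p k) {\<one>\<^bsub>skel_rel p k\<^esub>}" .
  then show ?thesis using generate_one one_closed by (auto simp: trivial_group_def)
qed

abbreviation "skel_hom p k \<equiv> homology_group p (top_of_set (skeleton T G k))"

text \<open>As \<open>skeleton T G k\<close> has only cells of dimension below \<open>k\<close>,
  this is vanishing above the dimension. The sequence of consecutive skeleta carries it
  upwards.\<close>

lemma trivial_skel_hom: "int k \<le> p \<Longrightarrow> trivial_group (skel_hom p k)"
proof (induction k)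
  case 0
  then show ?case using trivial_homology_group_empty[of "top_of_set (skeleton T G 0)"] by (simp add: skeleton_0)
next
  case (Suc k)
  have sub: "{} \<subseteq> skeleton T G k" "skeleton T G k \<subseteq> skeleton T G (Suc k)" by (simp_all add: skeleton_mono)
  have "inj_on (hom_induced p (top_of_set (skeleton T G (Suc k))) {} (top_of_set (skeleton T G (Suc k))) (skeleton T G k) id)
      (carrier (skel_hom p (Suc k)))"
    by (rule triple_inj[OF sub]) (use Suc in simp)
  moreover have "trivial_group (skel_rel p k)" by (rule trivial_skel_rel) (use Suc.prems in simp)
  then have "hom_induced p (top_of_set (skeleton T G (Suc k))) {} (top_of_set (skeleton T G (Suc k))) (skeleton T G k) id z
      = \<one>\<^bsub>skel_rel p k\<^esub>" for z
    using hom_induced_carrier[of p "top_of_set (skeleton T G (Suc k))" "{}" "top_of_set (skeleton T G (Suc k))" "skeleton T G k" id z]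
    by (simp add: trivial_group_def)
  ultimately have "\<And>y z. y \<in> carrier (skel_hom p (Suc k)) \<Longrightarrow> z \<in> carrier (skel_hom p (Suc k)) \<Longrightarrow> y = z"
    by (simp add: inj_on_def)
  then have "carrier (skel_hom p (Suc k)) = {\<one>\<^bsub>skel_hom p (Suc k)\<^esub>}"
    using group.is_monoid[OF group_relative_homology_group] monoid.one_closed by blast
  then show ?case by (simp add: trivial_group_def)
qed

text \<open>\<open>skeleton T G (Suc i)\<close> is the \<open>i\<close>-skeleton in the usual
  numbering. The obstruction to injectivity is the homology of the previous skeleton in degree
  \<open>i\<close>, which vanishes.\<close>

lemma skel_hom_inj:
  "inj_on (hom_induced (int i) (top_of_set (skeleton T G (Suc i))) {} (top_of_set (skeleton T G (Suc i))) (skeleton T G i) id)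
    (carrier (skel_hom (int i) (Suc i)))"
  by (rule triple_inj) (simp_all add: trivial_skel_hom skeleton_mono)

text \<open>Attaching cells of dimension greater than \<open>i\<close> adds no classes in degree
  \<open>i\<close>, because the relative group in that degree is trivial.\<close>

lemma skel_hom_surj:
  assumes "Suc i \<le> k"
  shows "hom_induced (int i) (top_of_set (skeleton T G (Suc i))) {} (top_of_set (skeleton T G k)) {} id ` carrier (skel_hom (int i) (Suc i))
    = carrier (skel_hom (int i) k)"
  using assms
proof (induction k rule: dec_induct)
  case base
  show ?case by (subst image_cong[OF refl hom_induced_id]) simp_all
next
  case (step k)
  have sub: "{} \<subseteq> skeleton T G k" "skeleton T G k \<subseteq> skeleton T G (Suc k)" "skeleton T G (Suc i) \<subseteq> skeleton T G k"
    using step by (simp_all add: skeleton_mono)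
  have "trivial_group (skel_rel (int i) k)" by (rule trivial_skel_rel) (use step in simp)
  then have "hom_induced (int i) (top_of_set (skeleton T G (Suc k))) {} (top_of_set (skeleton T G (Suc k))) (skeleton T G k) id z
      = \<one>\<^bsub>skel_rel (int i) k\<^esub>" for z
    using hom_induced_carrier[of "int i" "top_of_set (skeleton T G (Suc k))" "{}" "top_of_set (skeleton T G (Suc k))" "skeleton T G k" id z]
    by (simp add: trivial_group_def)
  then have "carrier (skel_hom (int i) (Suc k))
      = hom_induced (int i) (top_of_set (skeleton T G k)) {} (top_of_set (skeleton T G (Suc k))) {} id ` carrier (skel_hom (int i) k)"
    using triple_exact_middle[OF sub(1,2), of "int i"] by (simp add: kernel_def)
  also have "\<dots> = hom_induced (int i) (top_of_set (skeleton T G (Suc i))) {} (top_of_set (skeleton T G (Suc k))) {} id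
      ` carrier (skel_hom (int i) (Suc i))"
    unfolding step.IH[symmetric] image_image
    by (rule image_cong[OF refl], rule hom_induced_id_compose) (use sub in auto)
  finally show ?case ..
qed

lemma hom_complex_skeleton: "\<exists>k\<ge>l. hom_complex T G = top_of_set (skeleton T G k)"
proof (intro exI conjI)
  let ?k = "Suc (Max (insert l (cell_dim T ` multi_homs T G)))"
  have "cell_dim T \<alpha> < ?k" if "\<alpha> \<in> multi_homs T G" for \<alpha>
    unfolding less_Suc_eq_le by (rule Max_ge) (use finite_multi_homs that in auto)
  then show "hom_complex T G = top_of_set (skeleton T G ?k)"
    unfolding hom_complex_def skeleton_def by (metis (mono_tags, lifting) Collect_mem_eq Collect_cong)
  have "l \<le> Max (insert l (cell_dim T ` multi_homs T G))"
    by (rule Max_ge) (use finite_multi_homs in auto)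
  then show "l \<le> ?k" by simp
qed

end

section \<open>Maps induced by graph homomorphisms\<close>

lemma continuous_on_hom_complex_map: "continuous_on S (hom_complex_map G \<phi>)"
  unfolding hom_complex_map_def
  by (rule continuous_on_coordinatewise_then_product, rule continuous_on_coordinatewise_then_product)
    (intro continuous_on_sum continuous_on_apply2[OF continuous_on_id])

lemma hom_complex_map_compose:
  assumes "finite (verts G)" "finite (verts G')" "\<phi> \<in> verts G \<rightarrow> verts G'"
    and "\<And>v. v \<in> verts G \<Longrightarrow> \<theta> v = \<psi> (\<phi> v)"
  shows "hom_complex_map G \<theta> p = hom_complex_map G' \<psi> (hom_complex_map G \<phi> p)"
proof (intro ext)
  fix x u
  have "(\<Sum>w\<in>{w \<in> verts G'. \<psi> w = u}. \<Sum>v\<in>{v \<in> verts G. \<phi> v = w}. p x v)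
      = (\<Sum>w\<in>{w \<in> verts G'. \<psi> w = u}. \<Sum>v\<in>{v \<in> {v \<in> verts G. \<theta> v = u}. \<phi> v = w}. p x v)"
    by (intro sum.cong refl) (use assms(4) in auto)
  also have "\<dots> = (\<Sum>v\<in>{v \<in> verts G. \<theta> v = u}. p x v)"
    by (rule sum.group) (use assms in auto)
  finally show "hom_complex_map G \<theta> p x u = hom_complex_map G' \<psi> (hom_complex_map G \<phi> p) x u"
    by (simp add: hom_complex_map_def)
qed

locale hom_graph_map = src: hom_graphs T G + tgt: hom_graphs T G'
  for T :: "'t graph" and G :: "'v graph" and G' :: "'w graph" +
  fixes \<phi> :: "'v \<Rightarrow> 'w"
  assumes \<phi>: "graph_hom G G' \<phi>"
begin

definition image_cell :: "('t \<Rightarrow> 'v set) \<Rightarrow> 't \<Rightarrow> 'w set" where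
  "image_cell \<alpha> = restrict (\<lambda>x. \<phi> ` \<alpha> x) (verts T)"

lemma image_cell_apply [simp]: "x \<in> verts T \<Longrightarrow> image_cell \<alpha> x = \<phi> ` \<alpha> x"
  by (simp add: image_cell_def)

lemma image_multi_hom:
  assumes "\<alpha> \<in> multi_homs T G"
  shows "image_cell \<alpha> \<in> multi_homs T G'"
proof -
  have "x \<in> verts T \<and> y \<in> verts T" if "{x, y} \<in> edges T" for x y
    using src.T that unfolding simple_graph_def by (blast dest: doubleton_eq_iff[THEN iffD1])
  then have "\<forall>x y. {x, y} \<in> edges T \<longrightarrow>
      (\<forall>x'\<in>image_cell \<alpha> x. \<forall>y'\<in>image_cell \<alpha> y. {x', y'} \<in> edges G')"
    using assms \<phi> unfolding multi_homs_def graph_hom_def by (fastforce simp: image_cell_def)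
  moreover have "\<phi> ` \<alpha> x \<subseteq> verts G' \<and> \<phi> ` \<alpha> x \<noteq> {}" if "x \<in> verts T" for x
    using multi_homs_cell[OF assms that] \<phi> unfolding graph_hom_def by blast
  ultimately show ?thesis unfolding multi_homs_def image_cell_def by auto
qed

lemma cell_dim_image: "\<alpha> \<in> multi_homs T G \<Longrightarrow> cell_dim T (image_cell \<alpha>) \<le> cell_dim T \<alpha>"
  unfolding cell_dim_def
  by (rule sum_mono)
    (use product_cell.finite_cell[OF src.product_cell] in \<open>auto intro!: diff_le_mono card_image_le\<close>)

lemma hom_complex_map_cell_eq:
  assumes "\<alpha> \<in> multi_homs T G" "p \<in> hom_cell T \<alpha>"
  shows "hom_complex_map G \<phi> p x w = (if x \<in> verts T then \<Sum>v\<in>{v \<in> \<alpha> x. \<phi> v = w}. p x v else 0)"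
proof -
  interpret product_cell T \<alpha> by (rule src.product_cell) fact
  show ?thesis
  proof (cases "x \<in> verts T")
    case True
    have "(\<Sum>v\<in>{v \<in> \<alpha> x. \<phi> v = w}. p x v) = (\<Sum>v\<in>{v \<in> verts G. \<phi> v = w}. p x v)"
      by (rule sum.mono_neutral_left)
        (use assms(2) src.finite_G multi_homs_cell[OF assms(1) True] in \<open>auto simp: cell_iff K_def\<close>)
    then show ?thesis using True by (simp add: hom_complex_map_def)
  next
    case False
    then show ?thesis using assms(2) by (auto simp: hom_complex_map_def cell_iff K_def intro!: sum.neutral)
  qed
qed

lemma hom_complex_map_cell:
  assumes "\<alpha> \<in> multi_homs T G" "p \<in> hom_cell T \<alpha>"
  shows "hom_complex_map G \<phi> p \<in> hom_cell T (image_cell \<alpha>)"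
proof -
  interpret A: product_cell T \<alpha> by (rule src.product_cell) fact
  interpret B: product_cell T "image_cell \<alpha>" by (rule tgt.product_cell image_multi_hom)+ fact
  note eq = hom_complex_map_cell_eq[OF assms]
  have p: "0 \<le> p x v" for x v using assms(2) by (simp add: A.cell_iff)
  have "0 \<le> hom_complex_map G \<phi> p x w" for x w
    unfolding eq by (auto intro: sum_nonneg p)
  moreover have "hom_complex_map G \<phi> p x w = 0" if "(x, w) \<notin> B.K" for x w
    unfolding eq using that by (auto simp: B.K_def intro!: sum.neutral)
  moreover have "(\<Sum>w\<in>image_cell \<alpha> x. hom_complex_map G \<phi> p x w) = 1" if x: "x \<in> verts T" for x
  proof -
    have "(\<Sum>w\<in>image_cell \<alpha> x. hom_complex_map G \<phi> p x w)
        = (\<Sum>w\<in>\<phi> ` \<alpha> x. \<Sum>v\<in>{v \<in> \<alpha> x. \<phi> v = w}. p x v)"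
      using x by (simp add: eq)
    also have "\<dots> = (\<Sum>v\<in>\<alpha> x. p x v)"
      by (rule sum.image_gen[symmetric]) (rule A.finite_cell[OF x])
    finally show ?thesis using assms(2) x by (simp add: A.cell_iff)
  qed
  ultimately show ?thesis unfolding B.cell_iff by blast
qed

lemma hom_complex_map_skeleton: "hom_complex_map G \<phi> \<in> skeleton T G k \<rightarrow> skeleton T G' k"
proof
  fix p assume "p \<in> skeleton T G k"
  then obtain \<alpha> where \<alpha>: "\<alpha> \<in> multi_homs T G" "cell_dim T \<alpha> < k" "p \<in> hom_cell T \<alpha>"
    by (auto simp: skeleton_def)
  then show "hom_complex_map G \<phi> p \<in> skeleton T G' k"
    using image_multi_hom[OF \<alpha>(1)] cell_dim_image[OF \<alpha>(1)] hom_complex_map_cell[OF \<alpha>(1,3)]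
    unfolding skeleton_def by auto
qed

lemma continuous_map_hom_complex:
  "continuous_map (hom_complex T G) (hom_complex T G') (hom_complex_map G \<phi>)"
  unfolding hom_complex_def continuous_map_in_subtopology
proof
  show "hom_complex_map G \<phi> \<in> topspace (top_of_set (\<Union>\<alpha>\<in>multi_homs T G. hom_cell T \<alpha>))
      \<rightarrow> (\<Union>\<alpha>\<in>multi_homs T G'. hom_cell T \<alpha>)"
    using image_multi_hom hom_complex_map_cell by fastforce
qed (simp add: continuous_on_hom_complex_map)

text \<open>Each factor is mapped bijectively onto a simplex by renaming vertices, so points with a
  zero coordinate correspond and the induced map is a homeomorphism of pairs. Vertices in different
  factors may still be identified.\<close>

lemma cell_homology_iso:
  assumes "\<alpha> \<in> multi_homs T G" "\<And>x. x \<in> verts T \<Longrightarrow> inj_on \<phi> (\<alpha> x)"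
  shows "hom_induced p (top_of_set (hom_cell T \<alpha>)) (product_cell.bd T \<alpha>)
      (top_of_set (hom_cell T (image_cell \<alpha>))) (product_cell.bd T (image_cell \<alpha>)) (hom_complex_map G \<phi>)
    \<in> iso (src.cell_homology p \<alpha>) (tgt.cell_homology p (image_cell \<alpha>))"
proof -
  interpret A: product_cell T \<alpha> by (rule src.product_cell) fact
  interpret B: product_cell T "image_cell \<alpha>" by (rule tgt.product_cell image_multi_hom)+ fact
  define \<psi> where "\<psi> q = (\<lambda>x v. if (x, v) \<in> A.K then q x (\<phi> v) else 0)" for q :: "'t \<Rightarrow> 'w \<Rightarrow> real"
  have at: "hom_complex_map G \<phi> r x (\<phi> v) = r x v" if "(x, v) \<in> A.K" "r \<in> A.c" for r x v
  proof -
    have x: "x \<in> verts T" "v \<in> \<alpha> x" using that by (auto simp: A.K_def)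
    have "{v' \<in> \<alpha> x. \<phi> v' = \<phi> v} = {v}" using assms(2)[OF x(1)] x(2) by (auto dest: inj_onD)
    then show ?thesis using hom_complex_map_cell_eq[OF assms(1) that(2)] x(1) by simp
  qed
  have \<psi>_cell: "\<psi> q \<in> A.c" if q: "q \<in> B.c" for q
  proof -
    have "(\<Sum>v\<in>\<alpha> x. \<psi> q x v) = 1" if x: "x \<in> verts T" for x
    proof -
      have "(\<Sum>v\<in>\<alpha> x. \<psi> q x v) = (\<Sum>v\<in>\<alpha> x. q x (\<phi> v))"
        by (rule sum.cong) (use x in \<open>auto simp: \<psi>_def A.K_def\<close>)
      also have "\<dots> = (\<Sum>w\<in>image_cell \<alpha> x. q x w)"
        using x by (simp add: sum.reindex[OF assms(2)[OF x]])
      finally show ?thesis using q x by (simp add: B.cell_iff)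
    qed
    then show ?thesis using q by (auto simp: A.cell_iff B.cell_iff \<psi>_def)
  qed
  have left: "\<psi> (hom_complex_map G \<phi> r) = r" if "r \<in> A.c" for r
    using at[OF _ that] that by (auto simp: \<psi>_def fun_eq_iff A.cell_iff)
  have right: "hom_complex_map G \<phi> (\<psi> q) = q" if q: "q \<in> B.c" for q
  proof (intro ext)
    fix x w
    show "hom_complex_map G \<phi> (\<psi> q) x w = q x w"
    proof (cases "(x, w) \<in> B.K")
      case True
      then obtain v where v: "(x, v) \<in> A.K" "w = \<phi> v" by (auto simp: B.K_def A.K_def)
      then show ?thesis using at[OF v(1) \<psi>_cell[OF q]] by (simp add: \<psi>_def)
    next
      case False
      then show ?thesis
        using q hom_complex_map_cell[OF assms(1) \<psi>_cell[OF q]] by (simp add: B.cell_iff)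
    qed
  qed
  have bd: "hom_complex_map G \<phi> ` A.bd = B.bd"
  proof (intro equalityI subsetI)
    fix q assume "q \<in> hom_complex_map G \<phi> ` A.bd"
    then obtain r x v where r: "r \<in> A.c" "x \<in> verts T" "v \<in> \<alpha> x" "r x v = 0" "q = hom_complex_map G \<phi> r"
      by (auto simp: A.bd_def)
    have "q x (\<phi> v) = 0" using at[of x v r] r by (simp add: A.K_def)
    then show "q \<in> B.bd" using r hom_complex_map_cell[OF assms(1) r(1)] by (auto simp: B.bd_def)
  next
    fix q assume "q \<in> B.bd"
    then obtain x v where q: "q \<in> B.c" "x \<in> verts T" "v \<in> \<alpha> x" "q x (\<phi> v) = 0"
      by (auto simp: B.bd_def)
    have "\<psi> q x v = 0" using q by (simp add: \<psi>_def)
    then have "\<psi> q \<in> A.bd" using \<psi>_cell[OF q(1)] q by (auto simp: A.bd_def)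
    then show "q \<in> hom_complex_map G \<phi> ` A.bd" using right[OF q(1)] by (metis imageI)
  qed
  have "continuous_on B.c \<psi>"
    unfolding \<psi>_def
  proof (rule continuous_on_coordinatewise_then_product, rule continuous_on_coordinatewise_then_product)
    show "continuous_on B.c (\<lambda>q. if (x, v) \<in> A.K then q x (\<phi> v) else 0)" for x v
      by (cases "(x, v) \<in> A.K") (simp_all add: continuous_on_apply2[OF continuous_on_id])
  qed
  then have "homeomorphic_maps (top_of_set A.c) (top_of_set B.c) (hom_complex_map G \<phi>) \<psi>"
    unfolding homeomorphic_maps_def
    using continuous_on_hom_complex_map hom_complex_map_cell[OF assms(1)] \<psi>_cell left right
    by (auto simp: continuous_map_in_subtopology)
  then have "homeomorphic_map (top_of_set A.c) (top_of_set B.c) (hom_complex_map G \<phi>)"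
    using homeomorphic_map_maps by blast
  then show ?thesis
    by (rule homeomorphic_map_relative_homology_iso) (use bd in \<open>auto simp: A.bd_def\<close>)
qed

end

section \<open>Functoriality over FI\<close>

lemma hom_induced_pair_functor:
  assumes "\<And>m n f. f \<in> FI_mor m n \<Longrightarrow> continuous_map (X m) (X n) (\<Phi> m n f)"
    and "\<And>m n f. f \<in> FI_mor m n \<Longrightarrow> \<Phi> m n f \<in> A m \<rightarrow> A n"
    and "\<And>x. x \<in> topspace (X l) \<Longrightarrow> \<Phi> l n (compose {1..l} g f) x = \<Phi> m n g (\<Phi> l m f x)"
    and "f \<in> FI_mor l m" "g \<in> FI_mor m n"
  shows "hom_induced p (X l) (A l) (X n) (A n) (\<Phi> l n (compose {1..l} g f)) z
    = hom_induced p (X m) (A m) (X n) (A n) (\<Phi> m n g) (hom_induced p (X l) (A l) (X m) (A m) (\<Phi> l m f) z)"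
proof -
  have "hom_induced p (X l) (A l) (X n) (A n) (\<Phi> l n (compose {1..l} g f))
      = hom_induced p (X l) (A l) (X n) (A n) (\<Phi> m n g \<circ> \<Phi> l m f)"
    by (rule hom_induced_eq) (use assms(3) in simp)
  then show ?thesis using assms by (simp add: hom_induced_compose')
qed

locale FI_hom_complex =
  fixes T :: "'t graph" and G :: "nat \<Rightarrow> 'v graph" and F :: "nat \<Rightarrow> nat \<Rightarrow> (nat \<Rightarrow> nat) \<Rightarrow> 'v \<Rightarrow> 'v"
  assumes T: "simple_graph T" and FI: "FI_graph G F"
begin

lemma G: "simple_graph (G n)"
  using FI by (simp add: FI_graph_def)

lemma F_hom: "f \<in> FI_mor m n \<Longrightarrow> graph_hom (G m) (G n) (F m n f)"
  using FI by (simp add: FI_graph_def)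

lemma F_closed: "f \<in> FI_mor m n \<Longrightarrow> v \<in> verts (G m) \<Longrightarrow> F m n f v \<in> verts (G n)"
  using F_hom by (fastforce simp: graph_hom_def)

lemma F_id: "v \<in> verts (G n) \<Longrightarrow> F n n (FI_id n) v = v"
  using FI by (simp add: FI_graph_def)

lemma F_compose: "f \<in> FI_mor l m \<Longrightarrow> g \<in> FI_mor m n \<Longrightarrow> v \<in> verts (G l) \<Longrightarrow>
    F l n (compose {1..l} g f) v = F m n g (F l m f v)"
  using FI unfolding FI_graph_def by blast

sublocale hom_graphs T "G n" for n
  by unfold_locales (rule T G)+

lemma graph_map: "f \<in> FI_mor m n \<Longrightarrow> hom_graph_map T (G m) (G n) (F m n f)"
  by unfold_locales (rule F_hom)

definition \<Phi> :: "nat \<Rightarrow> nat \<Rightarrow> (nat \<Rightarrow> nat) \<Rightarrow> ('t \<Rightarrow> 'v \<Rightarrow> real) \<Rightarrow> 't \<Rightarrow> 'v \<Rightarrow> real" where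
  "\<Phi> m n f = hom_complex_map (G m) (F m n f)"

lemma \<Phi>_compose:
  assumes "f \<in> FI_mor l m" "g \<in> FI_mor m n"
  shows "\<Phi> l n (compose {1..l} g f) p = \<Phi> m n g (\<Phi> l m f p)"
  unfolding \<Phi>_def
  by (rule hom_complex_map_compose) (use finite_G F_closed F_compose assms in auto)

text \<open>The sum over \<open>verts (G n)\<close> drops all other coordinates, so points are fixed
  only because those coordinates vanish on the cells.\<close>

lemma \<Phi>_id:
  assumes "p \<in> topspace (hom_complex T (G n))"
  shows "\<Phi> n n (FI_id n) p = p"
proof (intro ext)
  fix x w
  obtain \<alpha> where \<alpha>: "\<alpha> \<in> multi_homs T (G n)" "p \<in> hom_cell T \<alpha>"
    using assms by (auto simp: hom_complex_def)
  interpret product_cell T \<alpha> by (rule product_cell) fact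
  have out: "p x v = 0" if "v \<notin> verts (G n)" for v
  proof -
    have "(x, v) \<notin> K" using multi_homs_cell[OF \<alpha>(1), of x] that by (auto simp: K_def)
    then show ?thesis using \<alpha>(2) by (simp add: cell_iff)
  qed
  have "{v \<in> verts (G n). F n n (FI_id n) v = w} = (if w \<in> verts (G n) then {w} else {})"
    using F_id by auto
  then show "\<Phi> n n (FI_id n) p x w = p x w"
    using out[of w] by (simp add: \<Phi>_def hom_complex_map_def)
qed

lemma \<Phi>_skeleton: "f \<in> FI_mor m n \<Longrightarrow> \<Phi> m n f \<in> skeleton T (G m) k \<rightarrow> skeleton T (G n) k"
  unfolding \<Phi>_def by (rule hom_graph_map.hom_complex_map_skeleton[OF graph_map])

lemma continuous_map_\<Phi>_skeleton:
  "f \<in> FI_mor m n \<Longrightarrow> continuous_map (top_of_set (skeleton T (G m) k)) (top_of_set (skeleton T (G n) k)) (\<Phi> m n f)"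
  using \<Phi>_skeleton[of f m n k] continuous_on_hom_complex_map
  by (auto simp: continuous_map_in_subtopology \<Phi>_def)

lemma continuous_map_\<Phi>:
  "f \<in> FI_mor m n \<Longrightarrow> continuous_map (hom_complex T (G m)) (hom_complex T (G n)) (\<Phi> m n f)"
  unfolding \<Phi>_def by (rule hom_graph_map.continuous_map_hom_complex[OF graph_map])

lemma FI_space_hom_complex: "FI_space (\<lambda>n. hom_complex T (G n)) \<Phi>"
  unfolding FI_space_def using continuous_map_\<Phi> \<Phi>_id \<Phi>_compose by blast

abbreviation "H_hom i \<equiv> \<lambda>m n f. hom_induced (int i) (hom_complex T (G m)) {} (hom_complex T (G n)) {} (\<Phi> m n f)"

abbreviation "H_rel i \<equiv> \<lambda>m n f. hom_induced (int i) (top_of_set (skeleton T (G m) (Suc i))) (skeleton T (G m) i)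
  (top_of_set (skeleton T (G n) (Suc i))) (skeleton T (G n) i) (\<Phi> m n f)"

lemma H_hom_compose:
  assumes "f \<in> FI_mor l m" "g \<in> FI_mor m n"
  shows "H_hom i l n (compose {1..l} g f) z = H_hom i m n g (H_hom i l m f z)"
  using hom_induced_pair_functor[of "\<lambda>n. hom_complex T (G n)" \<Phi> "\<lambda>n. {}" l n g f m "int i" z]
    continuous_map_\<Phi> \<Phi>_compose assms by auto

lemma FI_module_hom_complex: "FI_module (\<lambda>n. homology_group (int i) (hom_complex T (G n))) (H_hom i)"
  unfolding FI_module_def
proof (intro conjI allI ballI)
  show "H_hom i n n (FI_id n) x = x" if "x \<in> carrier (homology_group (int i) (hom_complex T (G n)))" for n x
  proof (rule hom_induced_id_gen[OF _ \<Phi>_id that])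
    show "continuous_map (hom_complex T (G n)) (hom_complex T (G n)) (\<Phi> n n (FI_id n))"
      by (rule continuous_map_\<Phi>) (rule OI_mor_FI[OF FI_id_OI])
  qed
  show "H_hom i l n (compose {1..l} g f) x = H_hom i m n g (H_hom i l m f x)"
    if "f \<in> FI_mor l m" "g \<in> FI_mor m n" for l m n f g x
    by (rule H_hom_compose[OF that])
qed (simp_all add: abelian_homology_group hom_induced_hom)

lemma OI_module_hom_complex: "OI_module (\<lambda>n. homology_group (int i) (hom_complex T (G n))) (H_hom i)"
proof (rule OI_module.intro)
  show "H_hom i l n (compose {1..l} g f) x = H_hom i m n g (H_hom i l m f x)"
    if "f \<in> OI_mor l m" "g \<in> OI_mor m n" for l m n f g x
    by (rule H_hom_compose[OF OI_mor_FI OI_mor_FI]) (fact that)+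
qed (simp_all add: abelian_homology_group hom_induced_hom)

lemma OI_module_skeleton: "OI_module (\<lambda>n. skel_rel n (int i) i) (H_rel i)"
proof (rule OI_module.intro)
  fix l m n f g z assume "f \<in> OI_mor l m" "g \<in> OI_mor m n"
  then show "H_rel i l n (compose {1..l} g f) z = H_rel i m n g (H_rel i l m f z)"
    using hom_induced_pair_functor[of "\<lambda>n. top_of_set (skeleton T (G n) (Suc i))" \<Phi> "\<lambda>n. skeleton T (G n) i" l n g f m "int i" z]
      continuous_map_\<Phi>_skeleton \<Phi>_skeleton \<Phi>_compose OI_mor_FI by auto
qed (simp_all add: hom_induced_hom)

end

section \<open>Stable FI-graphs\<close>

text \<open>Replaces an arbitrary injection by an order-preserving one: \<open>u\<close> enumerates
  a set containing the range, and \<open>g\<close> retains the reordering.\<close>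

lemma FI_mor_factor:
  assumes u: "u \<in> OI_mor s n" and f: "f \<in> FI_mor m n" and sub: "f ` {1..m} \<subseteq> u ` {1..s}"
  shows "\<exists>g\<in>FI_mor m s. compose {1..m} u g = f"
proof -
  define g where "g = (\<lambda>k\<in>{1..m}. the_inv_into {1..s} u (f k))"
  have inj: "inj_on u {1..s}" "inj_on f {1..m}" using u f by (auto simp: OI_mor_def FI_mor_def)
  have g: "u (g k) = f k" "g k \<in> {1..s}" if "k \<in> {1..m}" for k
  proof -
    have "f k \<in> u ` {1..s}" using sub that by blast
    then show "u (g k) = f k" "g k \<in> {1..s}"
      using f_the_inv_into_f[OF inj(1)] the_inv_into_into[OF inj(1) _ order_refl] that by (simp_all add: g_def)
  qed
  have "inj_on g {1..m}"
    using inj_onD[OF inj(2)] g(1) by (metis inj_onI)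
  moreover have "g \<in> {1..m} \<rightarrow>\<^sub>E {1..s}" using g(2) by (auto simp: g_def)
  ultimately have "g \<in> FI_mor m s" by (simp add: FI_mor_def)
  moreover have "f \<in> extensional {1..m}" using f by (simp add: FI_mor_def PiE_def)
  then have "compose {1..m} u g = f"
    using g(1) by (auto simp: compose_def extensional_def fun_eq_iff)
  ultimately show ?thesis by blast
qed

lemma sorted_list_slists:
  assumes "U \<subseteq> {1..n}"
  shows "sorted_list_of_set U \<in> slists (card U) 0 n" "inj_of (sorted_list_of_set U) ` {1..card U} = U"
proof -
  have fin: "finite U" using assms finite_subset by blast
  show "sorted_list_of_set U \<in> slists (card U) 0 n"
    using assms fin by (auto simp: slists_def)
  have len: "length (sorted_list_of_set U) = card U" by simp
  show "inj_of (sorted_list_of_set U) ` {1..card U} = U"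
  proof (intro equalityI subsetI)
    fix y assume "y \<in> inj_of (sorted_list_of_set U) ` {1..card U}"
    then obtain k where "k \<in> {1..card U}" "y = sorted_list_of_set U ! (k - 1)"
      by (auto simp: inj_of_def)
    then have "y \<in> set (sorted_list_of_set U)" using nth_mem[of "k - 1" "sorted_list_of_set U"] by auto
    then show "y \<in> U" using fin by simp
  next
    fix y assume "y \<in> U"
    then have "y \<in> set (sorted_list_of_set U)" using fin by simp
    then obtain i where "i < card U" "y = sorted_list_of_set U ! i" by (metis in_set_conv_nth len)
    then show "y \<in> inj_of (sorted_list_of_set U) ` {1..card U}"
      by (intro image_eqI[of _ _ "Suc i"]) (auto simp: inj_of_def)
  qed
qed

text \<open>If the degree were larger, subtracting the bound would not change the leading term, and
  a polynomial with positive leading coefficient cannot stay nonpositive. A negative leading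
  coefficient contradicts the lower bound.\<close>

lemma degree_le_of_growth:
  fixes P :: "real poly"
  assumes "\<forall>\<^sub>F n in sequentially. 0 \<le> poly P (real n) \<and> poly P (real n) \<le> C * real n ^ e"
  shows "degree P \<le> e"
proof (rule ccontr)
  assume deg: "\<not> degree P \<le> e"
  then have lc: "lead_coeff P \<noteq> 0" by auto
  have contra: False if Q: "lead_coeff Q > 0" "\<forall>\<^sub>F n in sequentially. poly Q (real n) \<le> 0" for Q :: "real poly"
  proof -
    obtain x0 where x0: "\<And>x. x \<ge> x0 \<Longrightarrow> poly Q x \<ge> lead_coeff Q" using poly_pinfty_gt_lc[OF Q(1)] by blast
    obtain N where "\<And>n. n \<ge> N \<Longrightarrow> poly Q (real n) \<le> 0" using Q(2) by (auto simp: eventually_sequentially)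
    moreover have "real (max N (nat \<lceil>x0\<rceil>)) \<ge> x0" by linarith
    ultimately show False using x0[of "real (max N (nat \<lceil>x0\<rceil>))"] Q(1)
      by (metis less_le_trans max.cobounded1 not_le)
  qed
  show False
  proof (cases "lead_coeff P > 0")
    case True
    have "degree (monom (- C) e) < degree P" using deg degree_monom_le[of "- C" e] by linarith
    then have "lead_coeff (P + monom (- C) e) = lead_coeff P"
      using deg by (subst degree_add_eq_left) auto
    moreover have "\<forall>\<^sub>F n in sequentially. poly (P + monom (- C) e) (real n) \<le> 0"
      using assms by eventually_elim (simp add: poly_monom)
    ultimately show False using contra[of "P + monom (- C) e"] True by simp
  next
    case False
    then have "lead_coeff (- P) > 0" using lc by (metis lead_coeff_minus neg_0_less_iff_less not_less_iff_gr_or_eq)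
    moreover have "\<forall>\<^sub>F n in sequentially. poly (- P) (real n) \<le> 0"
      using assms by eventually_elim simp
    ultimately show False by (rule contra)
  qed
qed

locale stable_hom_complex = FI_hom_complex T G F
  for T :: "'t graph" and G :: "nat \<Rightarrow> 'v graph" and F +
  fixes d :: nat
  assumes stable: "vertex_stable G F d"
begin

lemma vertex_from_stable_range:
  assumes "v \<in> verts (G n)"
  shows "\<exists>m\<le>d. \<exists>f\<in>FI_mor m n. \<exists>w\<in>verts (G m). F m n f w = v"
proof (cases "n \<le> d")
  case True
  then show ?thesis using assms F_id OI_mor_FI[OF FI_id_OI] by blast
next
  case False
  then have "d \<le> n" by simp
  then have "\<exists>f\<in>FI_mor d n. \<exists>w\<in>verts (G d). F d n f w = v" using assms
  proof (induction n arbitrary: v rule: dec_induct)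
    case base
    then show ?case using F_id OI_mor_FI[OF FI_id_OI] by blast
  next
    case (step n)
    have "\<exists>w\<in>verts (G n). \<exists>f\<in>FI_mor n (Suc n). F n (Suc n) f w = v"
      using stable[unfolded vertex_stable_def, rule_format, of n v] step.prems step.hyps by simp
    then obtain w f where f: "w \<in> verts (G n)" "f \<in> FI_mor n (Suc n)" "F n (Suc n) f w = v" by blast
    obtain g u where g: "g \<in> FI_mor d n" "u \<in> verts (G d)" "F d n g u = w" using step.IH[OF f(1)] by blast
    have "inj_on (compose {1..d} f g) {1..d}"
    proof (rule inj_onI)
      fix x y assume xy: "x \<in> {1..d}" "y \<in> {1..d}" "compose {1..d} f g x = compose {1..d} f g y"
      then have "g x \<in> {1..n}" "g y \<in> {1..n}" "f (g x) = f (g y)"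
        using g(1) by (auto simp: FI_mor_def compose_eq)
      then have "g x = g y" using f(2) by (auto simp: FI_mor_def dest: inj_onD)
      then show "x = y" using xy g(1) by (auto simp: FI_mor_def dest: inj_onD)
    qed
    moreover have "compose {1..d} f g \<in> {1..d} \<rightarrow>\<^sub>E {1..Suc n}"
      using f(2) g(1) by (auto simp: FI_mor_def compose_def)
    ultimately have "compose {1..d} f g \<in> FI_mor d (Suc n)" by (simp add: FI_mor_def)
    moreover have "F d (Suc n) (compose {1..d} f g) u = v"
      using F_compose[OF g(1) f(2) g(2)] f(3) g(3) by simp
    ultimately show ?case using g(2) by blast
  qed
  then show ?thesis by blast
qed

text \<open>Each vertex uses at most \<open>d\<close> points of \<open>[n]\<close>. The union of
  these sets is enumerated increasingly, and all the injections factor through the enumeration,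
  their reorderings being absorbed into \<open>b v\<close>.\<close>

lemma common_support:
  assumes "finite W" "W \<subseteq> verts (G n)"
  shows "\<exists>s\<le>card W * d. \<exists>xs\<in>slists s 0 n. \<exists>b. \<forall>v\<in>W. b v \<in> verts (G s) \<and> F s n (inj_of xs) (b v) = v"
proof -
  have "\<forall>v\<in>W. \<exists>m f w. m \<le> d \<and> f \<in> FI_mor m n \<and> w \<in> verts (G m) \<and> F m n f w = v"
    using vertex_from_stable_range assms(2) by blast
  then obtain m f w where mf: "\<And>v. v \<in> W \<Longrightarrow> m v \<le> d \<and> f v \<in> FI_mor (m v) n \<and> w v \<in> verts (G (m v)) \<and> F (m v) n (f v) (w v) = v"
    by metis
  define U where "U = (\<Union>v\<in>W. f v ` {1..m v})"
  have U: "U \<subseteq> {1..n}" using mf by (fastforce simp: U_def FI_mor_def)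
  define xs where "xs = sorted_list_of_set U"
  have xs: "xs \<in> slists (card U) 0 n" "inj_of xs ` {1..card U} = U"
    unfolding xs_def by (rule sorted_list_slists[OF U])+
  have "card U \<le> (\<Sum>v\<in>W. card (f v ` {1..m v}))" unfolding U_def by (rule card_UN_le) fact
  also have "\<dots> \<le> (\<Sum>v\<in>W. d)"
  proof (rule sum_mono)
    fix v assume "v \<in> W"
    then show "card (f v ` {1..m v}) \<le> d" using card_image_le[of "{1..m v}" "f v"] mf[of v] by auto
  qed
  finally have "card U \<le> card W * d" by simp
  moreover have "\<exists>b. b \<in> verts (G (card U)) \<and> F (card U) n (inj_of xs) b = v" if v: "v \<in> W" for v
  proof -
    have "f v ` {1..m v} \<subseteq> inj_of xs ` {1..card U}" using v xs(2) by (auto simp: U_def)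
    then obtain g where g: "g \<in> FI_mor (m v) (card U)" "compose {1..m v} (inj_of xs) g = f v"
      using FI_mor_factor[OF inj_of_OI[OF xs(1)], of "f v" "m v"] mf[OF v] by blast
    have "F (card U) n (inj_of xs) (F (m v) (card U) g (w v)) = v"
      using F_compose[OF g(1) OI_mor_FI[OF inj_of_OI[OF xs(1)]], of "w v"] mf[OF v] g(2) by simp
    then show ?thesis using F_closed[OF g(1)] mf[OF v] by blast
  qed
  then have "\<exists>b. \<forall>v\<in>W. b v \<in> verts (G (card U)) \<and> F (card U) n (inj_of xs) (b v) = v" by metis
  ultimately show ?thesis using xs(1) by blast
qed

lemma sum_card_cell:
  assumes "\<tau> \<in> cells T (G n) k"
  shows "(\<Sum>x\<in>verts T. card (\<tau> x)) = k + card (verts T)"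
proof -
  have \<tau>: "\<tau> \<in> multi_homs T (G n)" "cell_dim T \<tau> = k" using assms by (auto simp: cells_def)
  interpret product_cell T \<tau> by (rule product_cell) fact
  have "(\<Sum>x\<in>verts T. card (\<tau> x)) = (\<Sum>x\<in>verts T. (card (\<tau> x) - 1) + 1)"
    by (rule sum.cong) (use finite_cell nonempty_cell in \<open>auto simp: Suc_diff_le card_gt_0_iff Suc_le_eq\<close>)
  also have "\<dots> = k + card (verts T)" by (simp only: sum.distrib \<tau>(2)[symmetric] cell_dim_def) simp
  finally show ?thesis .
qed

text \<open>
  Edges of \<open>G\<^sub>n\<close> need not come from smaller graphs, so lifting the vertices of a cell does not lift the cell.
  But the cells among the translates of finitely many vertex configurations are closed upwards, and
  Dickson's lemma provides finitely many minimal ones.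
\<close>

lemma cells_finitely_generated:
  "\<exists>Q. finite Q \<and> Q \<subseteq> (SIGMA m:UNIV. cells T (G m) k) \<and>
    (\<forall>n. \<forall>\<tau>\<in>cells T (G n) k. \<exists>(m, \<alpha>)\<in>Q. \<exists>h\<in>OI_mor m n.
      \<forall>x\<in>verts T. inj_on (F m n h) (\<alpha> x) \<and> \<tau> x = F m n h ` \<alpha> x)"
proof -
  \<comment> \<open>A configuration assigns sets of vertices of \<open>G s\<close> to the vertices
    of \<open>T\<close>. It need not be a cell itself. The bound on \<open>s\<close> comes from
    \<open>common_support\<close>, since a cell involves at most \<open>k + card (verts T)\<close>
    vertices.\<close>
  define Ty where "Ty = (SIGMA s:{..(k + card (verts T)) * d}. verts T \<rightarrow>\<^sub>E Pow (verts (G s)))"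
  have "finite Ty" unfolding Ty_def
    by (intro finite_SigmaI finite_PiE finite_Pow_iff[THEN iffD2] finite_T finite_G) auto
  then obtain tys where tys: "set tys = Ty" using finite_list by blast
  define ms where "ms = map fst tys"
  define cell where "cell n j xs = (\<lambda>x\<in>verts T. F (ms ! j) n (inj_of xs) ` snd (tys ! j) x)" for n j xs
  \<comment> \<open>Configurations act as generators, and their translates are the monomials; those
    giving an injectively mapped cell are kept. The last component is arbitrary, and 0 is used
    below.\<close>
  define P where "P = {(n, (j, xs), a :: nat) | n j xs a. (j, xs) \<in> mons ms n \<and> cell n j xs \<in> cells T (G n) k \<and>
    (\<forall>x\<in>verts T. inj_on (F (ms ! j) n (inj_of xs)) (snd (tys ! j) x))}"
  obtain Q where Q: "finite Q" "Q \<subseteq> P"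
    "\<forall>(n, u, b) \<in> P. \<exists>(m, t, a) \<in> Q. \<exists>h \<in> OI_mor m n. act h t = u \<and> a \<le> b"
    using mons_gaps_basis[of P ms] unfolding P_def by blast
  define Q' where "Q' = (\<lambda>(m, t, a). (m, cell m (fst t) (snd t))) ` Q"
  have 3: "\<exists>(m, \<alpha>)\<in>Q'. \<exists>h\<in>OI_mor m n.
      \<forall>x\<in>verts T. inj_on (F m n h) (\<alpha> x) \<and> \<tau> x = F m n h ` \<alpha> x"
    if \<tau>: "\<tau> \<in> cells T (G n) k" for n \<tau>
  proof -
    have \<tau>': "\<tau> \<in> multi_homs T (G n)" using \<tau> by (simp add: cells_def)
    interpret product_cell T \<tau> by (rule product_cell) fact
    define W where "W = (\<Union>x\<in>verts T. \<tau> x)"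
    have W: "finite W" "W \<subseteq> verts (G n)"
      using finite_T finite_cell multi_homs_cell[OF \<tau>'] by (auto simp: W_def)
    have "card W \<le> k + card (verts T)"
      unfolding W_def sum_card_cell[OF \<tau>, symmetric] by (rule card_UN_le[OF finite_T])
    moreover obtain s xs b where s: "s \<le> card W * d" "xs \<in> slists s 0 n"
      and b: "\<And>v. v \<in> W \<Longrightarrow> b v \<in> verts (G s) \<and> F s n (inj_of xs) (b v) = v"
      using common_support[OF W] by blast
    ultimately have sK: "s \<le> (k + card (verts T)) * d" by (meson le_trans mult_le_mono1)
    define A where "A = (\<lambda>x\<in>verts T. b ` \<tau> x)"
    have A: "F s n (inj_of xs) ` A x = \<tau> x" "inj_on (F s n (inj_of xs)) (A x)" "A x \<subseteq> verts (G s)"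
      if x: "x \<in> verts T" for x
    proof -
      have bx: "b v \<in> verts (G s)" "F s n (inj_of xs) (b v) = v" if "v \<in> \<tau> x" for v
        using b[of v] x that by (auto simp: W_def)
      show "F s n (inj_of xs) ` A x = \<tau> x" using bx(2) x by (force simp: A_def)
      show "inj_on (F s n (inj_of xs)) (A x)" using bx(2) x by (auto simp: A_def inj_on_def)
      show "A x \<subseteq> verts (G s)" using bx(1) x by (auto simp: A_def)
    qed
    have "(s, A) \<in> set tys" using sK A(3) by (auto simp: tys Ty_def A_def)
    then obtain j where j: "j < length tys" "tys ! j = (s, A)" by (auto simp: in_set_conv_nth)
    have jm: "(j, xs) \<in> mons ms n" using j s(2) by (simp add: mons_def ms_def)
    have "cell n j xs x = \<tau> x" for x
    proof (cases "x \<in> verts T")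
      case True
      then show ?thesis using A(1) j by (simp add: cell_def ms_def)
    next
      case False
      moreover have "\<tau> \<in> extensional (verts T)" using \<tau>' by (simp add: multi_homs_def PiE_def)
      ultimately show ?thesis by (simp add: cell_def extensional_def)
    qed
    then have cell: "cell n j xs = \<tau>" by blast
    have "(n, (j, xs), 0) \<in> P" using jm cell \<tau> A(2) j by (simp add: P_def ms_def)
    then obtain m t a h where q: "(m, t, a) \<in> Q" "h \<in> OI_mor m n" "act h t = (j, xs)" using Q(3) by blast
    obtain ys where t: "t = (j, ys)" "map h ys = xs" using q(3) by (cases t) (auto simp: act_def)
    have ys: "(j, ys) \<in> mons ms m" using q(1) Q(2) t(1) by (auto simp: P_def)
    then have ys': "ys \<in> slists s 0 m" "length ys = s" using j by (auto simp: mons_def ms_def slists_def)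
    \<comment> \<open>The map from \<open>G s\<close> to \<open>G n\<close> factors through
      \<open>G m\<close>, where the configuration already forms a cell.\<close>
    have comp: "F s n (inj_of xs) v = F m n h (F s m (inj_of ys) v)" if "v \<in> verts (G s)" for v
      using F_compose[OF OI_mor_FI[OF inj_of_OI[OF ys'(1)]] OI_mor_FI[OF q(2)] that]
        compose_inj_of[of ys h] ys'(2) t(2) by simp
    have "inj_on (F m n h) (cell m j ys x) \<and> \<tau> x = F m n h ` cell m j ys x" if x: "x \<in> verts T" for x
    proof
      have c: "cell m j ys x = F s m (inj_of ys) ` A x" using x j by (simp add: cell_def ms_def)
      have eq: "F s n (inj_of xs) v = F m n h (F s m (inj_of ys) v)" if "v \<in> A x" for v
        using comp A(3)[OF x] that by blast
      show "\<tau> x = F m n h ` cell m j ys x"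
        unfolding c A(1)[OF x, symmetric] image_image by (rule image_cong[OF refl eq])
      show "inj_on (F m n h) (cell m j ys x)"
        unfolding c by (rule inj_on_imageI) (simp add: comp_def eq[symmetric] A(2)[OF x] cong: inj_on_cong)
    qed
    then show ?thesis
      unfolding Q'_def by (intro bexI[of _ "(m, cell m j ys)"]) (use q(1,2) t(1) in \<open>force\<close>)+
  qed
  have 2: "Q' \<subseteq> (SIGMA m:UNIV. cells T (G m) k)"
    using Q(2) by (auto simp: P_def Q'_def)
  have 1: "finite Q'" using Q(1) by (simp add: Q'_def)
  show ?thesis by (intro exI[of _ Q'] conjI allI ballI 1 2 3)
qed

end

lemma (in group) generate_subset_generate:
  assumes "A \<subseteq> generate G B" "B \<subseteq> carrier G"
  shows "generate G A \<subseteq> generate G B"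
  by (rule generate_subgroup_incl[OF assms(1) generate_is_subgroup[OF assms(2)]])

text \<open>An FI-submodule is closed under OI-translates, so generators over OI also generate over
  FI.\<close>

lemma (in OI_module) FI_finitely_generated:
  assumes "finite S" "S \<subseteq> (SIGMA n:UNIV. carrier (M n))"
    and "\<And>n. carrier (M n) \<subseteq> generate (M n) (translates F S n)"
  shows "FI_finitely_generated M F"
  unfolding FI_finitely_generated_def
proof (intro exI[of _ S] conjI allI impI)
  fix N n assume N: "FI_submodule N M F \<and> S \<subseteq> (SIGMA n:UNIV. N n)"
  then have sub: "subgroup (N n) (M n)" by (simp add: FI_submodule_def)
  have "translates F S n \<subseteq> N n"
    using N OI_mor_FI unfolding translates_def FI_submodule_def by blast
  then have "generate (M n) (translates F S n) \<subseteq> N n" by (rule M.generate_subgroup_incl[OF _ sub])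
  then show "N n = carrier (M n)" using assms(3)[of n] subgroup.subset[OF sub] by blast
qed (fact assms)+

section \<open>Generators of the relative homology of skeleta\<close>

context stable_hom_complex begin

text \<open>When \<open>i\<close> is the dimension of the cell this is an orientation. The choices
  for different cells are unrelated.\<close>

definition gen :: "nat \<Rightarrow> ('t \<Rightarrow> 'v set) \<Rightarrow> ('t \<Rightarrow> 'v \<Rightarrow> real) chain set" where
  "gen i \<alpha> = (SOME g. g \<in> carrier (cell_homology (int i) \<alpha>) \<and>
    carrier (cell_homology (int i) \<alpha>) = range (\<lambda>a::int. g [^]\<^bsub>cell_homology (int i) \<alpha>\<^esub> a))"

lemma gen:
  assumes "\<alpha> \<in> cells T (G n) k"
  shows "gen i \<alpha> \<in> carrier (cell_homology (int i) \<alpha>)"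
    and "carrier (cell_homology (int i) \<alpha>) = range (\<lambda>a::int. gen i \<alpha> [^]\<^bsub>cell_homology (int i) \<alpha>\<^esub> a)"
proof -
  have "cyclic_group (cell_homology (int i) \<alpha>)"
    using product_cell.cyclic_relative_homology_cell[OF product_cell] assms by (auto simp: cells_def)
  then have "\<exists>g. g \<in> carrier (cell_homology (int i) \<alpha>) \<and>
    carrier (cell_homology (int i) \<alpha>) = range (\<lambda>a::int. g [^]\<^bsub>cell_homology (int i) \<alpha>\<^esub> a)"
    by (auto simp: group.cyclic_group[OF group_relative_homology_group])
  from someI_ex[OF this] show "gen i \<alpha> \<in> carrier (cell_homology (int i) \<alpha>)"
    and "carrier (cell_homology (int i) \<alpha>) = range (\<lambda>a::int. gen i \<alpha> [^]\<^bsub>cell_homology (int i) \<alpha>\<^esub> a)"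
    unfolding gen_def by blast+
qed

lemma cell_map_pow:
  assumes "x \<in> carrier (cell_homology p \<alpha>)"
  shows "cell_map n p k \<alpha> (x [^]\<^bsub>cell_homology p \<alpha>\<^esub> (a::int)) = cell_map n p k \<alpha> x [^]\<^bsub>skel_rel n p k\<^esub> a"
  by (rule group_hom.hom_int_pow[OF hom_induced_group_hom assms])

lemma cell_map_closed: "cell_map n p k \<alpha> x \<in> carrier (skel_rel n p k)"
  by (rule hom_induced_carrier)

text \<open>The group of each cell is cyclic, so one class for each cell is enough; this is what
  bounds the rank.\<close>

lemma skel_rel_generated:
  "carrier (skel_rel n (int i) i) \<subseteq> generate (skel_rel n (int i) i)
    ((\<lambda>\<alpha>. cell_map n (int i) i \<alpha> (gen i \<alpha>)) ` cells T (G n) i)"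
proof -
  let ?R = "skel_rel n (int i) i"
  let ?E = "(\<lambda>\<alpha>. cell_map n (int i) i \<alpha> (gen i \<alpha>)) ` cells T (G n) i"
  interpret R: group ?R by simp
  have E: "?E \<subseteq> carrier ?R" using cell_map_closed by blast
  have "cell_map n (int i) i \<alpha> x \<in> generate ?R ?E"
    if \<alpha>: "\<alpha> \<in> cells T (G n) i" and x: "x \<in> carrier (cell_homology (int i) \<alpha>)" for \<alpha> x
  proof -
    obtain a :: int where "x = gen i \<alpha> [^]\<^bsub>cell_homology (int i) \<alpha>\<^esub> a" using gen(2)[OF \<alpha>, of i] x by auto
    then have "cell_map n (int i) i \<alpha> x = cell_map n (int i) i \<alpha> (gen i \<alpha>) [^]\<^bsub>?R\<^esub> a"
      using cell_map_pow[OF gen(1)[OF \<alpha>]] by simp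
    moreover have "cell_map n (int i) i \<alpha> (gen i \<alpha>) \<in> generate ?R ?E" using \<alpha> by (auto intro: generate.incl)
    ultimately show ?thesis using R.subgroup_int_pow_closed[OF R.generate_is_subgroup[OF E]] by simp
  qed
  then have "(\<Union>\<alpha>\<in>cells T (G n) i. cell_map n (int i) i \<alpha> ` carrier (cell_homology (int i) \<alpha>)) \<subseteq> generate ?R ?E"
    by blast
  from order_trans[OF skeleton_cells_generate R.generate_subset_generate[OF this E]] show ?thesis .
qed

text \<open>\<open>h\<close> maps \<open>\<alpha>\<close> with its boundary homeomorphically onto
  \<open>\<tau>\<close>, so a class of \<open>\<tau>\<close> comes from a multiple of the generator
  chosen for \<open>\<alpha>\<close>. The exponent \<open>a\<close> absorbs any mismatch of
  orientations, and naturality carries the statement into the skeleta.\<close>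

lemma cell_map_translate:
  assumes \<alpha>: "\<alpha> \<in> cells T (G m) i" and \<tau>: "\<tau> \<in> cells T (G n) i" and h: "h \<in> OI_mor m n"
    and inj: "\<And>x. x \<in> verts T \<Longrightarrow> inj_on (F m n h) (\<alpha> x)" and im: "\<And>x. x \<in> verts T \<Longrightarrow> \<tau> x = F m n h ` \<alpha> x"
    and x: "x \<in> carrier (cell_homology (int i) \<tau>)"
  shows "\<exists>a::int. cell_map n (int i) i \<tau> x
    = H_rel i m n h (cell_map m (int i) i \<alpha> (gen i \<alpha>)) [^]\<^bsub>skel_rel n (int i) i\<^esub> a"
proof -
  note hF = OI_mor_FI[OF h]
  interpret \<phi>: hom_graph_map T "G m" "G n" "F m n h" by (rule graph_map[OF hF])
  have \<alpha>': "\<alpha> \<in> multi_homs T (G m)" "\<tau> \<in> multi_homs T (G n)" using \<alpha> \<tau> by (auto simp: cells_def)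
  have img: "\<phi>.image_cell \<alpha> = \<tau>"
    by (rule multi_homs_eqI[OF \<phi>.image_multi_hom[OF \<alpha>'(1)] \<alpha>'(2)]) (simp add: im)
  define f where "f = hom_induced (int i) (top_of_set (hom_cell T \<alpha>)) (product_cell.bd T \<alpha>)
    (top_of_set (hom_cell T \<tau>)) (product_cell.bd T \<tau>) (\<Phi> m n h)"
  have "f \<in> iso (cell_homology (int i) \<alpha>) (cell_homology (int i) \<tau>)"
    using \<phi>.cell_homology_iso[OF \<alpha>'(1) inj] unfolding img f_def \<Phi>_def .
  then obtain y where y: "y \<in> carrier (cell_homology (int i) \<alpha>)" "x = f y"
    using x by (auto simp: iso_def bij_betw_def)
  obtain a :: int where a: "y = gen i \<alpha> [^]\<^bsub>cell_homology (int i) \<alpha>\<^esub> a" using gen(2)[OF \<alpha>, of i] y(1) by auto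
  have sub: "hom_cell T \<alpha> \<subseteq> skeleton T (G m) (Suc i)" "hom_cell T \<tau> \<subseteq> skeleton T (G n) (Suc i)"
    using \<alpha> \<tau> by (auto simp: skeleton_Suc)
  have \<Phi>c: "\<Phi> m n h \<in> hom_cell T \<alpha> \<rightarrow> hom_cell T \<tau>"
    using \<phi>.hom_complex_map_cell[OF \<alpha>'(1)] unfolding img \<Phi>_def by blast
  have cont: "continuous_on A (\<Phi> m n h)" for A unfolding \<Phi>_def by (rule continuous_on_hom_complex_map)
  \<comment> \<open>Boundaries are intersections of cells with the lower skeleton, and both are
    preserved.\<close>
  have bd: "\<Phi> m n h \<in> product_cell.bd T \<alpha> \<rightarrow> product_cell.bd T \<tau>"
    using \<Phi>c \<Phi>_skeleton[OF hF, of i]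
    unfolding cell_inter_skeleton[OF \<alpha>, symmetric] cell_inter_skeleton[OF \<tau>, symmetric] by blast
  have bds: "id \<in> product_cell.bd T \<alpha> \<rightarrow> skeleton T (G m) i" "id \<in> product_cell.bd T \<tau> \<rightarrow> skeleton T (G n) i"
    using bd_subset_skeleton[OF \<alpha>] bd_subset_skeleton[OF \<tau>] by auto
  have c1: "continuous_map (top_of_set (hom_cell T \<alpha>)) (top_of_set (hom_cell T \<tau>)) (\<Phi> m n h)"
    using cont \<Phi>c by (auto simp: continuous_map_in_subtopology)
  have c2: "continuous_map (top_of_set (hom_cell T \<tau>)) (top_of_set (skeleton T (G n) (Suc i))) id"
    "continuous_map (top_of_set (hom_cell T \<alpha>)) (top_of_set (skeleton T (G m) (Suc i))) id"
    using sub by (auto simp: continuous_map_in_subtopology)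
  have "cell_map n (int i) i \<tau> x = H_rel i m n h (cell_map m (int i) i \<alpha> y)"
    unfolding y(2) f_def hom_induced_compose'[OF c1 bd c2(1) bds(2)]
      hom_induced_compose'[OF c2(2) bds(1) continuous_map_\<Phi>_skeleton[OF hF] \<Phi>_skeleton[OF hF]] by simp
  also have "\<dots> = H_rel i m n h (cell_map m (int i) i \<alpha> (gen i \<alpha>)) [^]\<^bsub>skel_rel n (int i) i\<^esub> a"
    unfolding a cell_map_pow[OF gen(1)[OF \<alpha>]]
    by (rule group_hom.hom_int_pow[OF hom_induced_group_hom cell_map_closed])
  finally show ?thesis by blast
qed

lemma skel_rel_OI_generated:
  "\<exists>S. finite S \<and> S \<subseteq> (SIGMA n:UNIV. carrier (skel_rel n (int i) i)) \<and>
    (\<forall>n. carrier (skel_rel n (int i) i) \<subseteq> generate (skel_rel n (int i) i) (translates (H_rel i) S n))"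
proof -
  obtain Q where Q: "finite Q" "Q \<subseteq> (SIGMA m:UNIV. cells T (G m) i)"
    "\<forall>n. \<forall>\<tau>\<in>cells T (G n) i. \<exists>(m, \<alpha>)\<in>Q. \<exists>h\<in>OI_mor m n.
      \<forall>x\<in>verts T. inj_on (F m n h) (\<alpha> x) \<and> \<tau> x = F m n h ` \<alpha> x"
    using cells_finitely_generated[of i] by (elim exE conjE) (rule that)
  define S where "S = (\<lambda>(m, \<alpha>). (m, cell_map m (int i) i \<alpha> (gen i \<alpha>))) ` Q"
  have S: "S \<subseteq> (SIGMA n:UNIV. carrier (skel_rel n (int i) i))"
    unfolding S_def using cell_map_closed by auto
  have "carrier (skel_rel n (int i) i) \<subseteq> generate (skel_rel n (int i) i) (translates (H_rel i) S n)" for n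
  proof -
    let ?R = "skel_rel n (int i) i"
    interpret R: group ?R by simp
    have tr: "translates (H_rel i) S n \<subseteq> carrier ?R"
      by (auto simp: translates_def intro: hom_induced_carrier)
    have "cell_map n (int i) i \<tau> x \<in> generate ?R (translates (H_rel i) S n)"
      if \<tau>: "\<tau> \<in> cells T (G n) i" and x: "x \<in> carrier (cell_homology (int i) \<tau>)" for \<tau> x
    proof -
      obtain z where z: "z \<in> Q" "case z of (m, \<alpha>) \<Rightarrow> \<exists>h\<in>OI_mor m n.
          \<forall>x\<in>verts T. inj_on (F m n h) (\<alpha> x) \<and> \<tau> x = F m n h ` \<alpha> x"
        using bspec[OF spec[OF Q(3)] \<tau>] by (rule bexE)
      obtain m \<alpha> where z_eq: "z = (m, \<alpha>)" by (cases z)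
      obtain h where h: "h \<in> OI_mor m n" "\<forall>x\<in>verts T. inj_on (F m n h) (\<alpha> x) \<and> \<tau> x = F m n h ` \<alpha> x"
        using z(2) unfolding z_eq prod.case by (rule bexE)
      note q = z(1)[unfolded z_eq] h
      have \<alpha>: "\<alpha> \<in> cells T (G m) i" using q(1) Q(2) by blast
      obtain a :: int where a: "cell_map n (int i) i \<tau> x
          = H_rel i m n h (cell_map m (int i) i \<alpha> (gen i \<alpha>)) [^]\<^bsub>?R\<^esub> a"
        using cell_map_translate[OF \<alpha> \<tau> q(2) _ _ x] q(3) by auto
      have "(m, cell_map m (int i) i \<alpha> (gen i \<alpha>)) \<in> S" using q(1) by (force simp: S_def)
      then have "H_rel i m n h (cell_map m (int i) i \<alpha> (gen i \<alpha>)) \<in> translates (H_rel i) S n"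
        using q(2) unfolding translates_def by blast
      then show ?thesis
        unfolding a by (intro R.subgroup_int_pow_closed[OF R.generate_is_subgroup[OF tr]] generate.incl)
    qed
    then have "(\<Union>\<alpha>\<in>cells T (G n) i. cell_map n (int i) i \<alpha> ` carrier (cell_homology (int i) \<alpha>))
        \<subseteq> generate ?R (translates (H_rel i) S n)" by blast
    from order_trans[OF skeleton_cells_generate R.generate_subset_generate[OF this tr]] show ?thesis .
  qed
  then show ?thesis using S Q(1) by (intro exI[of _ S]) (auto simp: S_def)
qed

section \<open>Homology of the Hom-complex as a subquotient\<close>

abbreviation "sk n k \<equiv> top_of_set (skeleton T (G n) k)"

abbreviation "j_map i n \<equiv> hom_induced (int i) (sk n (Suc i)) {} (sk n (Suc i)) (skeleton T (G n) i) id"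

abbreviation "q_map i n \<equiv> hom_induced (int i) (sk n (Suc i)) {} (hom_complex T (G n)) {} id"

abbreviation "H_sk i m n f \<equiv> hom_induced (int i) (sk m (Suc i)) {} (sk n (Suc i)) {} (\<Phi> m n f)"

lemma continuous_map_sk_hom_complex: "continuous_map (sk n k) (hom_complex T (G n)) id"
proof -
  obtain l where l: "l \<ge> k" "hom_complex T (G n) = sk n l" using hom_complex_skeleton by blast
  then show ?thesis using skeleton_mono[OF l(1), of T "G n"] by (auto simp: continuous_map_in_subtopology)
qed

lemma j_map_natural:
  assumes "f \<in> FI_mor m n"
  shows "j_map i n (H_sk i m n f y) = H_rel i m n f (j_map i m y)"
proof -
  have "j_map i n (H_sk i m n f y) = hom_induced (int i) (sk m (Suc i)) {} (sk n (Suc i)) (skeleton T (G n) i) (id \<circ> \<Phi> m n f) y"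
    by (rule hom_induced_compose')
      (simp_all only: continuous_map_\<Phi>_skeleton[OF assms] continuous_map_id Pi_empty UNIV_I)
  moreover have "H_rel i m n f (j_map i m y)
      = hom_induced (int i) (sk m (Suc i)) {} (sk n (Suc i)) (skeleton T (G n) i) (\<Phi> m n f \<circ> id) y"
    by (rule hom_induced_compose')
      (simp_all only: continuous_map_\<Phi>_skeleton[OF assms] \<Phi>_skeleton[OF assms] continuous_map_id Pi_empty UNIV_I)
  ultimately show ?thesis by simp
qed

lemma q_map_natural:
  assumes "f \<in> FI_mor m n"
  shows "q_map i n (H_sk i m n f y) = H_hom i m n f (q_map i m y)"
proof -
  have "q_map i n (H_sk i m n f y) = hom_induced (int i) (sk m (Suc i)) {} (hom_complex T (G n)) {} (id \<circ> \<Phi> m n f) y"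
    by (rule hom_induced_compose')
      (simp_all only: continuous_map_\<Phi>_skeleton[OF assms] continuous_map_sk_hom_complex Pi_empty UNIV_I)
  moreover have "H_hom i m n f (q_map i m y)
      = hom_induced (int i) (sk m (Suc i)) {} (hom_complex T (G n)) {} (\<Phi> m n f \<circ> id) y"
    by (rule hom_induced_compose')
      (simp_all only: continuous_map_\<Phi>[OF assms] continuous_map_sk_hom_complex Pi_empty UNIV_I)
  ultimately show ?thesis by simp
qed

lemma q_map_surj: "q_map i n ` carrier (skel_hom n (int i) (Suc i)) = carrier (homology_group (int i) (hom_complex T (G n)))"
proof -
  obtain l where l: "l \<ge> Suc i" "hom_complex T (G n) = sk n l" using hom_complex_skeleton by blast
  show ?thesis unfolding l(2) by (rule skel_hom_surj[OF l(1)])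
qed

text \<open>The image \<open>N\<close> of the homology of the skeleton is a submodule of a finitely
  generated module, hence finitely generated. As \<open>j_map\<close> is injective, its generators
  lift to generators for the skeleton, and \<open>q_map\<close> carries these onto generators for
  the complex.\<close>

lemma hom_complex_OI_generated:
  "\<exists>S. finite S \<and> S \<subseteq> (SIGMA n:UNIV. carrier (homology_group (int i) (hom_complex T (G n)))) \<and>
    (\<forall>n. carrier (homology_group (int i) (hom_complex T (G n)))
      \<subseteq> generate (homology_group (int i) (hom_complex T (G n))) (translates (H_hom i) S n))"
proof -
  interpret R: OI_module "\<lambda>n. skel_rel n (int i) i" "H_rel i" by (rule OI_module_skeleton)
  let ?K = "\<lambda>n. skel_hom n (int i) (Suc i)"
  have jhom: "group_hom (?K n) (skel_rel n (int i) i) (j_map i n)" for n by (rule hom_induced_group_hom)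
  have qhom: "group_hom (?K n) (homology_group (int i) (hom_complex T (G n))) (q_map i n)" for n
    by (rule hom_induced_group_hom)
  define N where "N n = j_map i n ` carrier (?K n)" for n
  obtain S0 where S0: "finite S0" "S0 \<subseteq> (SIGMA n:UNIV. carrier (skel_rel n (int i) i))"
    "\<And>n. carrier (skel_rel n (int i) i) \<subseteq> generate (skel_rel n (int i) i) (translates (H_rel i) S0 n)"
    using skel_rel_OI_generated[of i] by (elim exE conjE) (rule that, assumption+, erule spec)
  have N_sub: "subgroup (N n) (skel_rel n (int i) i)" for n
    unfolding N_def by (rule group_hom.img_is_subgroup[OF jhom])
  have N_inv: "H_rel i m n h x \<in> N n" if "h \<in> OI_mor m n" "x \<in> N m" for m n h x
    using that j_map_natural[OF OI_mor_FI[OF that(1)], symmetric]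
    unfolding N_def by (auto intro!: imageI hom_induced_carrier)
  have "\<exists>S. finite S \<and> S \<subseteq> (SIGMA n:UNIV. N n) \<and>
      (\<forall>n. N n \<subseteq> generate (skel_rel n (int i) i) (translates (H_rel i) S n))"
    using S0 N_sub N_inv by (rule R.finitely_generated_submodule)
  then obtain S where S: "finite S" "S \<subseteq> (SIGMA n:UNIV. N n)"
    "\<And>n. N n \<subseteq> generate (skel_rel n (int i) i) (translates (H_rel i) S n)"
    by (elim exE conjE) (rule that, assumption+, erule spec)
  have "\<exists>t. t \<in> carrier (?K (fst s)) \<and> snd s = j_map i (fst s) t" if "s \<in> S" for s
  proof -
    have "snd s \<in> N (fst s)" using subsetD[OF S(2) that] by (elim SigmaE) (simp only: fst_conv snd_conv)
    then show ?thesis unfolding N_def by (elim imageE) (rule exI, rule conjI)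
  qed
  then have "\<forall>s\<in>S. \<exists>t. t \<in> carrier (?K (fst s)) \<and> snd s = j_map i (fst s) t" by (rule ballI)
  then have "\<exists>t. \<forall>s\<in>S. t s \<in> carrier (?K (fst s)) \<and> snd s = j_map i (fst s) (t s)" by (rule bchoice)
  then obtain t where t': "\<forall>s\<in>S. t s \<in> carrier (?K (fst s)) \<and> snd s = j_map i (fst s) (t s)" by (rule exE)
  have t: "t s \<in> carrier (?K (fst s))" "snd s = j_map i (fst s) (t s)" if "s \<in> S" for s
    using bspec[OF t' that] by (rule conjunct1, rule conjunct2)
  define S' where "S' = (\<lambda>s. (fst s, q_map i (fst s) (t s))) ` S"
  have "carrier (homology_group (int i) (hom_complex T (G n)))
      \<subseteq> generate (homology_group (int i) (hom_complex T (G n))) (translates (H_hom i) S' n)" for n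
  proof
    fix z assume "z \<in> carrier (homology_group (int i) (hom_complex T (G n)))"
    then obtain y where y: "y \<in> carrier (?K n)" "z = q_map i n y" using q_map_surj[of i n] by blast
    \<comment> \<open>The link between the two modules: \<open>j_map\<close> covers the translates
      of \<open>S\<close> by these elements, and \<open>q_map\<close> sends them to translates of
      \<open>S'\<close>.\<close>
    define Tr where "Tr = {H_sk i (fst s) n f (t s) | s f. s \<in> S \<and> f \<in> OI_mor (fst s) n}"
    have Tr: "Tr \<subseteq> carrier (?K n)" by (auto simp: Tr_def intro: hom_induced_carrier)
    have "translates (H_rel i) S n \<subseteq> j_map i n ` Tr"
    proof
      fix w assume "w \<in> translates (H_rel i) S n"
      then obtain m x f where w: "(m, x) \<in> S" "f \<in> OI_mor m n" "w = H_rel i m n f x"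
        by (auto simp: translates_def)
      have "w = j_map i n (H_sk i m n f (t (m, x)))"
        using j_map_natural[OF OI_mor_FI[OF w(2)]] t(2)[OF w(1)] w(3) by simp
      moreover have "H_sk i m n f (t (m, x)) \<in> Tr" using w(1,2) by (force simp: Tr_def)
      ultimately show "w \<in> j_map i n ` Tr" by blast
    qed
    then have "generate (skel_rel n (int i) i) (translates (H_rel i) S n) \<subseteq> j_map i n ` generate (?K n) Tr"
      unfolding group_hom.generate_img[OF jhom Tr, symmetric] by (rule R.M.mono_generate)
    moreover have "j_map i n y \<in> N n" using y(1) by (auto simp: N_def)
    ultimately obtain y' where y': "y' \<in> generate (?K n) Tr" "j_map i n y = j_map i n y'"
      using S(3)[of n] by blast
    have "y' \<in> carrier (?K n)" using group.generate_in_carrier[OF _ Tr y'(1)] by simp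
    then have "y = y'" using inj_onD[OF skel_hom_inj y'(2) y(1)] by simp
    then have "z \<in> q_map i n ` generate (?K n) Tr" using y(2) y'(1) by blast
    then have zq: "z \<in> generate (homology_group (int i) (hom_complex T (G n))) (q_map i n ` Tr)"
      by (simp only: group_hom.generate_img[OF qhom Tr])
    have "q_map i n ` Tr \<subseteq> translates (H_hom i) S' n"
    proof
      fix w assume "w \<in> q_map i n ` Tr"
      then obtain s f where s: "s \<in> S" "f \<in> OI_mor (fst s) n" "w = q_map i n (H_sk i (fst s) n f (t s))"
        by (auto simp: Tr_def)
      have "w = H_hom i (fst s) n f (q_map i (fst s) (t s))"
        using q_map_natural[OF OI_mor_FI[OF s(2)]] s(3) by simp
      then show "w \<in> translates (H_hom i) S' n" using s(1,2) unfolding translates_def S'_def by blast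
    qed
    from group.mono_generate[OF group_relative_homology_group this] zq
    show "z \<in> generate (homology_group (int i) (hom_complex T (G n))) (translates (H_hom i) S' n)" by blast
  qed
  moreover have "S' \<subseteq> (SIGMA n:UNIV. carrier (homology_group (int i) (hom_complex T (G n))))"
    unfolding S'_def by (auto intro: hom_induced_carrier)
  moreover have "finite S'" using S(1) by (simp add: S'_def)
  ultimately show ?thesis by blast
qed

text \<open>Independent classes lift along the surjection \<open>q_map\<close> and stay independent
  under the injection \<open>j_map\<close>, whose target has one generator for each cell.\<close>

lemma rational_basis_card_le:
  fixes e :: "'i \<Rightarrow> ('t \<Rightarrow> 'v \<Rightarrow> real) chain set"
  assumes "comm_group.rational_basis (homology_group (int i) (hom_complex T (G n))) e I"
  shows "card I \<le> card (cells T (G n) i)"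
proof -
  let ?H = "homology_group (int i) (hom_complex T (G n))"
  let ?K = "skel_hom n (int i) (Suc i)" and ?R = "skel_rel n (int i) i"
  have comm: "comm_group ?H" "comm_group ?K" "comm_group ?R" by (simp_all add: abelian_homology_group)
  interpret R: comm_group ?R by (rule comm(3))
  have fin: "finite I" and e: "e \<in> I \<rightarrow> carrier ?H" and ind: "comm_group.int_independent ?H e I"
    using assms unfolding comm_group.rational_basis_def[OF comm(1)] by auto
  have "\<forall>x\<in>I. \<exists>y. y \<in> carrier ?K \<and> e x = q_map i n y" using e q_map_surj[of i n] by blast
  then obtain y where y: "\<And>x. x \<in> I \<Longrightarrow> y x \<in> carrier ?K" "\<And>x. x \<in> I \<Longrightarrow> e x = q_map i n (y x)" by metis
  have "finprod ?H (\<lambda>x. (q_map i n \<circ> y) x [^]\<^bsub>?H\<^esub> c x) I = finprod ?H (\<lambda>x. e x [^]\<^bsub>?H\<^esub> c x) I" for c :: "'i \<Rightarrow> int"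
  proof (rule comm_monoid.finprod_cong'[OF comm_group.axioms(1)[OF comm(1)] refl])
    show "(\<lambda>x. e x [^]\<^bsub>?H\<^esub> c x) \<in> I \<rightarrow> carrier ?H"
      using e by (auto intro!: group.int_pow_closed)
  qed (simp add: y(2))
  then have "comm_group.int_independent ?H (q_map i n \<circ> y) I"
    using ind unfolding comm_group.int_independent_def[OF comm(1)] by simp
  then have "comm_group.int_independent ?K y I"
    by (rule int_independent_hom_preimage[OF comm(2,1) hom_induced_hom, rotated]) (use y(1) in auto)
  then have "comm_group.int_independent ?R (j_map i n \<circ> y) I"
    by (rule int_independent_hom_image[OF comm(2,3) hom_induced_hom skel_hom_inj, rotated]) (use y(1) in auto)
  moreover have "j_map i n \<circ> y \<in> I \<rightarrow> generate ?R ((\<lambda>\<alpha>. cell_map n (int i) i \<alpha> (gen i \<alpha>)) ` cells T (G n) i)"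
    by (rule Pi_I, simp only: o_apply, rule subsetD[OF skel_rel_generated hom_induced_carrier])
  ultimately have "card I \<le> card ((\<lambda>\<alpha>. cell_map n (int i) i \<alpha> (gen i \<alpha>)) ` cells T (G n) i)"
    by (intro R.int_independent_card_le[OF _ _ fin]) (use finite_cells cell_map_closed in auto)
  also have "\<dots> \<le> card (cells T (G n) i)" by (rule card_image_le[OF finite_cells])
  finally show ?thesis .
qed

text \<open>Every vertex comes from some \<open>G s\<close> with \<open>s \<le> d\<close> along an
  increasing list, and there are at most \<open>n ^ s\<close> lists of length \<open>s\<close>. At
  \<open>n = 0\<close> the step from \<open>n ^ s\<close> to \<open>n ^ d\<close> could
  fail.\<close>

lemma card_verts_le:
  assumes "n \<ge> 1"
  shows "card (verts (G n)) \<le> (\<Sum>s\<le>d. card (verts (G s))) * n ^ d"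
proof -
  have "verts (G n) \<subseteq> (\<Union>s\<le>d. \<Union>xs\<in>slists s 0 n. F s n (inj_of xs) ` verts (G s))"
  proof
    fix v assume "v \<in> verts (G n)"
    then obtain s xs b where "s \<le> d" "xs \<in> slists s 0 n" "b v \<in> verts (G s)" "F s n (inj_of xs) (b v) = v"
      using common_support[of "{v}" n] by auto
    then show "v \<in> (\<Union>s\<le>d. \<Union>xs\<in>slists s 0 n. F s n (inj_of xs) ` verts (G s))" by force
  qed
  then have "card (verts (G n)) \<le> card (\<Union>s\<le>d. \<Union>xs\<in>slists s 0 n. F s n (inj_of xs) ` verts (G s))"
    by (rule card_mono[rotated]) (use finite_slists finite_G in auto)
  also have "\<dots> \<le> (\<Sum>s\<le>d. card (\<Union>xs\<in>slists s 0 n. F s n (inj_of xs) ` verts (G s)))"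
    by (rule card_UN_le) simp
  also have "\<dots> \<le> (\<Sum>s\<le>d. card (verts (G s)) * n ^ d)"
  proof (rule sum_mono)
    fix s assume "s \<in> {..d}"
    have "card (\<Union>xs\<in>slists s 0 n. F s n (inj_of xs) ` verts (G s)) \<le> (\<Sum>xs\<in>slists s 0 n. card (verts (G s)))"
      by (rule order_trans[OF card_UN_le[OF finite_slists] sum_mono]) (rule card_image_le[OF finite_G])
    also have "\<dots> = card (slists s 0 n) * card (verts (G s))" by simp
    also have "card (slists s 0 n) \<le> card {xs. set xs \<subseteq> {0<..n} \<and> length xs = s}"
      by (rule card_mono[OF finite_lists_length_eq]) (auto simp: slists_def)
    also have "\<dots> = n ^ s" by (simp add: card_lists_length_eq)
    also have "n ^ s \<le> n ^ d" using assms \<open>s \<in> {..d}\<close> by (auto intro: power_increasing)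
    finally show "card (\<Union>xs\<in>slists s 0 n. F s n (inj_of xs) ` verts (G s)) \<le> card (verts (G s)) * n ^ d"
      by (simp add: mult.commute)
  qed
  also have "\<dots> = (\<Sum>s\<le>d. card (verts (G s))) * n ^ d" by (simp add: sum_distrib_right)
  finally show ?thesis .
qed

lemma card_cells_le: "card (cells T (G n) k) \<le> (card (verts T) * card (verts (G n))) ^ (k + card (verts T))"
proof -
  let ?A = "verts T \<times> verts (G n)"
  let ?K = "k + card (verts T)"
  have fin: "finite ?A" using finite_T finite_G by blast
  have "inj_on (Sigma (verts T)) (cells T (G n) k)"
  proof (rule inj_onI)
    fix \<sigma> \<tau> assume \<sigma>\<tau>: "\<sigma> \<in> cells T (G n) k" "\<tau> \<in> cells T (G n) k" "Sigma (verts T) \<sigma> = Sigma (verts T) \<tau>"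
    have "\<sigma> x = \<tau> x" if "x \<in> verts T" for x
    proof -
      have "\<sigma> x = Sigma (verts T) \<sigma> `` {x}" "\<tau> x = Sigma (verts T) \<tau> `` {x}" using that by auto
      then show ?thesis using \<sigma>\<tau>(3) by simp
    qed
    then show "\<sigma> = \<tau>" using multi_homs_eqI[of \<sigma> T "G n" \<tau>] \<sigma>\<tau> by (simp add: cells_def)
  qed
  moreover have "Sigma (verts T) ` cells T (G n) k \<subseteq> {B. B \<subseteq> ?A \<and> card B = ?K}"
  proof clarify
    fix \<tau> assume \<tau>: "\<tau> \<in> cells T (G n) k"
    then have \<tau>': "\<tau> \<in> multi_homs T (G n)" by (simp add: cells_def)
    interpret product_cell T \<tau> by (rule product_cell) fact
    have "card (Sigma (verts T) \<tau>) = ?K"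
      using sum_card_cell[OF \<tau>] finite_T finite_cell by (simp add: card_SigmaI)
    then show "Sigma (verts T) \<tau> \<subseteq> ?A \<and> card (Sigma (verts T) \<tau>) = ?K"
      using multi_homs_cell[OF \<tau>'] by blast
  qed
  ultimately have "card (cells T (G n) k) \<le> card {B. B \<subseteq> ?A \<and> card B = ?K}"
    by (rule card_inj_on_le) (use fin in simp)
  also have "\<dots> = card ?A choose ?K" by (rule n_subsets[OF fin])
  also have "\<dots> \<le> card ?A ^ ?K" by (cases "?K \<le> card ?A") (simp_all add: binomial_le_pow binomial_eq_0)
  finally show ?thesis by (simp add: card_cartesian_product)
qed

lemma real_homology_eventually_polynomial:
  "(\<forall>n. vectorspace.fin_dim class_ring (real_homology i (hom_complex T (G n)))) \<and>
    (\<exists>P :: real poly. degree P \<le> card (verts T) * (d * (i + 1)) \<and>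
      (\<forall>\<^sub>F n in sequentially.
        real (vectorspace.dim class_ring (real_homology i (hom_complex T (G n)))) = poly P (real n)))"
proof -
  interpret H: OI_module "\<lambda>n. homology_group (int i) (hom_complex T (G n))" "H_hom i"
    by (rule OI_module_hom_complex)
  obtain S where S: "finite S" "S \<subseteq> (SIGMA n:UNIV. carrier (homology_group (int i) (hom_complex T (G n))))"
    "\<And>n. carrier (homology_group (int i) (hom_complex T (G n)))
      \<subseteq> generate (homology_group (int i) (hom_complex T (G n))) (translates (H_hom i) S n)"
    using hom_complex_OI_generated[of i] by (elim exE conjE) (rule that, assumption+, erule spec)
  obtain e and I :: "nat \<Rightarrow> (nat \<times> nat list) set"
    where basis: "\<And>n. comm_group.rational_basis (homology_group (int i) (hom_complex T (G n))) (e n) (I n)"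
      and poly: "eventually_polynomial (\<lambda>n. real (card (I n)))"
    using H.eventually_polynomial_rational_basis[OF S] by blast
  note dim = real_homology_rational_basis[OF basis]
  obtain P where P: "\<forall>\<^sub>F n in sequentially. real (card (I n)) = poly P (real n)"
    using poly by (auto simp: eventually_polynomial_def)
  define t where "t = card (verts T)"
  define D where "D = (\<Sum>s\<le>d. card (verts (G s)))"
  have "card (I n) \<le> (t * D) ^ (i + t) * n ^ (d * (i + t))" if "n \<ge> 1" for n
  proof -
    have "card (I n) \<le> (t * card (verts (G n))) ^ (i + t)"
      using rational_basis_card_le[OF basis] card_cells_le[of n i] unfolding t_def by (rule order_trans)
    also have "\<dots> \<le> (t * (D * n ^ d)) ^ (i + t)"
      by (intro power_mono mult_left_mono) (use card_verts_le[OF that] in \<open>simp_all add: D_def\<close>)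
    also have "\<dots> = (t * D) ^ (i + t) * n ^ (d * (i + t))"
      by (simp only: mult.assoc[symmetric] power_mult_distrib power_mult)
    finally show ?thesis .
  qed
  then have "real (card (I n)) \<le> real ((t * D) ^ (i + t)) * real n ^ (d * (i + t))" if "n \<ge> 1" for n
    using that by (metis of_nat_le_iff of_nat_mult of_nat_power)
  then have "\<forall>\<^sub>F n in sequentially. real (card (I n)) \<le> real ((t * D) ^ (i + t)) * real n ^ (d * (i + t))"
    unfolding eventually_sequentially by blast
  with P have growth: "\<forall>\<^sub>F n in sequentially. 0 \<le> poly P (real n) \<and>
      poly P (real n) \<le> real ((t * D) ^ (i + t)) * real n ^ (d * (i + t))"
    by eventually_elim (metis of_nat_0_le_iff)
  have "degree P \<le> t * (d * (i + 1))"
  \<comment> \<open>For \<open>t = 0\<close> and \<open>i > 0\<close> the constant in the growth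
    bound vanishes and squeezes the values of \<open>P\<close> to 0. In all other cases
    \<open>i + t \<le> t * (i + 1)\<close>.\<close>
  proof (cases "t = 0 \<and> i > 0")
    case True
    then have "\<forall>\<^sub>F n in sequentially. 0 \<le> poly P (real n) \<and> poly P (real n) \<le> 0 * real n ^ 0"
      using growth by (simp add: power_0_left)
    then show ?thesis using degree_le_of_growth by force
  next
    case False
    have "degree P \<le> d * (i + t)" by (rule degree_le_of_growth[OF growth])
    also have "i + t \<le> t * (i + 1)" using False by (cases t) auto
    then have "d * (i + t) \<le> d * (t * (i + 1))" by (rule mult_le_mono2)
    finally show ?thesis by (simp only: mult.left_commute)
  qed
  then show ?thesis using dim P unfolding t_def by auto
qed

lemma representation_stable_hom_complex:
  "representation_stable (\<lambda>n. hom_complex T (G n)) \<Phi>"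
proof -
  have "FI_finitely_generated (\<lambda>n. homology_group (int i) (hom_complex T (G n))) (H_hom i)" for i
    using hom_complex_OI_generated[of i] OI_module.FI_finitely_generated[OF OI_module_hom_complex[of i]] by blast
  then show ?thesis
    unfolding representation_stable_def Let_def using FI_space_hom_complex FI_module_hom_complex by blast
qed

end

theorem theorem5:
  fixes T :: "'t graph"
    and G :: "nat \<Rightarrow> 'v graph"
    and F :: "nat \<Rightarrow> nat \<Rightarrow> (nat \<Rightarrow> nat) \<Rightarrow> 'v \<Rightarrow> 'v"
    and d :: nat
  assumes "simple_graph T"
    and "FI_graph G F"
    and "vertex_stable G F d"
  shows "representation_stable (\<lambda>n. hom_complex T (G n)) (\<lambda>m n f. hom_complex_map (G m) (F m n f)) \<and>
    (\<forall>i::nat.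
      (\<forall>n. vectorspace.fin_dim class_ring (real_homology i (hom_complex T (G n)))) \<and>
      (\<exists>P :: real poly. degree P \<le> card (verts T) * (d * (i + 1)) \<and>
         (\<forall>\<^sub>F n in sequentially.
            real (vectorspace.dim class_ring (real_homology i (hom_complex T (G n))))
              = poly P (real n))))"
proof -
  interpret stable_hom_complex T G F d by unfold_locales fact+
  have \<Phi>: "\<Phi> = (\<lambda>m n f. hom_complex_map (G m) (F m n f))" by (simp only: \<Phi>_def fun_eq_iff simp_thms)
  show ?thesis
    unfolding \<Phi>[symmetric]
    by (intro conjI representation_stable_hom_complex allI real_homology_eventually_polynomial[THEN conjunct1, THEN spec]
        real_homology_eventually_polynomial[THEN conjunct2])
qed

end
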